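(* Let $G$ be a group acting on a non-empty set $S$. Then the abstract twisted Brin--Thompson group $SV_G$ is relatively simple. More precisely, with $K=\ker(G\curvearrowright S)$, the kernel $SK_G$ of the natural map $SV_G\to SV_{G/K}$ is a proper normal subgroup of $SV_G$, and every proper normal subgroup of $SV_G$ is contained in $SK_G$.
   Context: Relatively simple: a group $\Gamma$ is relatively simple if it has a proper normal subgroup $N$ (called the largest normal subgroup) such that every proper normal subgroup of $\Gamma$ is contained in $N$. Abstract twisted Brin--Thompson groups. Let $G$ act on the left on a non-empty set $S$ (not necessarily faithfully), and let $K=\ker(G\curvearrowright S)$. Let $C=\{0,1\}^{\mathbb N}$ be the Cantor set, $C^S$ the space of functions $S\to C$ with the product topology, and $C^S(m)$ the disjoint union of $m$ copies of $C^S$ ($m\ge 1$). For $\psi\colon S\to\{0,1\}^*$ (finite words) with $\psi(s)$ empty for all but finitely many $s$, the dyadic brick $B(\psi)$ is $\{\kappa\in C^S\mid \psi(s)\text{ is a prefix of }\kappa(s)\ \forall s\}$, with canonical homeomorphism $h_\psi\colon C^S\to B(\psi)$, $h_\psi(\kappa)(s)=\psi(s)\cdot\kappa(s)$. The Brin--Thompson groupoid $S\mathcal V$ consists of all homeomorphisms $C^S(m)\to C^S(n)$ obtained by partitioning domain and range into the same finite number of dyadic bricks (inside the copies of $C^S$) and mapping domain bricks to range bricks via canonical homeomorphisms $h_\varphi\circ h_\psi^{-1}$. It contains, for $s\in S$, the simple split $x_s\colon C^S\to C^S(2)$ (sending the half where $\kappa(s)$ starts with $0$, resp. $1$, to the first,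 resp. second, copy by deleting that first letter of $\kappa(s)$), and for $\sigma\in\Sigma_n$ the permutation $p_\sigma$ of the copies in $C^S(n)$ (copy $i$ goes to copy $\sigma(i)$); it has an obvious direct sum $\oplus$ (juxtaposition). The groupoid $S\mathcal V_G$ has objects the positive integers and is generated by $S\mathcal V$ together with, for each $n$, a copy of $G^n$ based at the object $n$ (with $(g_1,\dots,g_n)$ also written $g_1\oplus\cdots\oplus g_n$), subject to the set of relations that is closed under compositions and direct sums and contains $x_{g.s}\circ g=(g\oplus g)\circ x_s$ for $s\in S,g\in G$, and $(g_1\oplus\cdots\oplus g_n)\circ p_\sigma=p_\sigma\circ(g_{\sigma(1)}\oplus\cdots\oplus g_{\sigma(n)})$ for $\sigma\in\Sigma_n$, $g_i\in G$. The group $SV_G$ is the group of morphisms of $S\mathcal V_G$ from the object $1$ to itself. Multicolored forests are the elements obtained from identities and simple splits under composition and direct sum; multicolored trees are those with domain $C^S(1)$. Every element of $SV_G$ has the form $[T_-,\sigma,(g_1,\dots,g_n),T_+]:=T_-^{-1}\circ p_\sigma\circ(g_1,\dots,g_n)\circ T_+$ with $T_\pm$ multicolored trees with $n$ leaves, i.e. range $C^S(n)$. (Equivalently, letting $G$ act on $C^S$ by $(g\kappa)(s)=\kappa(g^{-1}.s)$, $SV_G$ is the group of pairs $(h,\gamma)$, $h$ a homeomorphism of $C^S$ and $\gamma\colon C^S\to G$, for which there are finite partitions of $C^S$ into dyadic bricks $B(\psi_1),\dots,B(\psi_n)$ and $B(\varphi_1),\dots,B(\varphi_n)$ and $g_1,\dots,g_n\in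 G$ with $h|_{B(\psi_i)}=h_{\varphi_i}\circ g_i\circ h_{\psi_i}^{-1}$ and $\gamma|_{B(\psi_i)}\equiv g_i$; the product is $(h,\gamma)(h',\gamma')=(hh',\ \kappa\mapsto\gamma(h'(\kappa))\gamma'(\kappa))$.) The natural map $SV_G\to SV_{G/K}$ (for the induced faithful action of $G/K$ on $S$) is $[T_-,\sigma,(g_1,\dots,g_n),T_+]\mapsto[T_-,\sigma,(g_1K,\dots,g_nK),T_+]$; its kernel $SK_G$ consists of the elements $[T,\mathrm{id},(k_1,\dots,k_n),T]$ with $T$ a multicolored tree and $k_i\in K$. *)

theory Defs
  imports "HOL-Algebra.Algebra" "HOL-Library.Omega_Words_Fun"
begin

definition relatively_simple :: "('a, 'b) monoid_scheme \<Rightarrow> bool" where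
  "relatively_simple \<Gamma> \<longleftrightarrow> group \<Gamma> \<and>
     (\<exists>N. N \<lhd> \<Gamma> \<and> N \<noteq> carrier \<Gamma> \<and>
          (\<forall>H. H \<lhd> \<Gamma> \<longrightarrow> H \<noteq> carrier \<Gamma> \<longrightarrow> H \<subseteq> N))"

text \<open>
  The letters 0 and 1 are \<open>False\<close> and \<open>True\<close>.  Functions on the carrier set \<open>S\<close> are extensional.
  The \<open>m\<close> copies of the Cantor cube are numbered from \<open>0\<close> to \<open>m - 1\<close>, and a point
  of their disjoint union is a pair (number of the copy, point of the cube).
\<close>

type_synonym 's cube_point = "'s \<Rightarrow> bool word"
type_synonym 's copies_point = "nat \<times> 's cube_point"

definition cantor_cube :: "'s set \<Rightarrow> 's cube_point set" where
  "cantor_cube S = S \<rightarrow>\<^sub>E UNIV"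

definition cantor_copies :: "'s set \<Rightarrow> nat \<Rightarrow> 's copies_point set" where
  "cantor_copies S m = {..<m} \<times> cantor_cube S"

definition brick_addresses :: "'s set \<Rightarrow> ('s \<Rightarrow> bool list) set" where
  "brick_addresses S = {\<psi>. finite {s \<in> S. \<psi> s \<noteq> []}}"

definition dyadic_brick :: "'s set \<Rightarrow> ('s \<Rightarrow> bool list) \<Rightarrow> 's cube_point set" where
  "dyadic_brick S \<psi> =
     {\<kappa> \<in> cantor_cube S. \<forall>s\<in>S. Omega_Words_Fun.prefix (length (\<psi> s)) (\<kappa> s) = \<psi> s}"

definition brick_homeo :: "'s set \<Rightarrow> ('s \<Rightarrow> bool list) \<Rightarrow> 's cube_point \<Rightarrow> 's cube_point" where
  "brick_homeo S \<psi> \<kappa> = (\<lambda>s\<in>S. \<psi> s \<frown> \<kappa> s)"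

definition brick_partition ::
  "'s set \<Rightarrow> nat \<Rightarrow> nat \<Rightarrow> (nat \<Rightarrow> nat \<times> ('s \<Rightarrow> bool list)) \<Rightarrow> bool" where
  "brick_partition S m r D \<longleftrightarrow>
     (\<forall>k<r. fst (D k) < m \<and> snd (D k) \<in> brick_addresses S) \<and>
     disjoint_family_on (\<lambda>k. {fst (D k)} \<times> dyadic_brick S (snd (D k))) {..<r} \<and>
     (\<Union>k<r. {fst (D k)} \<times> dyadic_brick S (snd (D k))) = cantor_copies S m"

text \<open>
  Morphisms from \<open>m\<close> to \<open>n\<close>.  Bricks are clopen and the canonical maps between them are
  homeomorphisms, so the bijections below are automatically homeomorphisms for the product
  topology, and continuity need not be demanded separately.
\<close>

definition brin_thompson :: "'s set \<Rightarrow> nat \<Rightarrow> nat \<Rightarrow> ('s copies_point \<Rightarrow> 's copies_point) set" where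
  "brin_thompson S m n =
     {f \<in> extensional (cantor_copies S m).
        1 \<le> m \<and> 1 \<le> n \<and> bij_betw f (cantor_copies S m) (cantor_copies S n) \<and>
        (\<exists>r D R. brick_partition S m r D \<and> brick_partition S n r R \<and>
           (\<forall>k<r. \<forall>\<kappa> \<in> dyadic_brick S (snd (D k)).
              f (fst (D k), \<kappa>) =
                (fst (R k),
                 brick_homeo S (snd (R k))
                   (inv_into (cantor_cube S) (brick_homeo S (snd (D k))) \<kappa>))))}"

definition bt_id :: "'s set \<Rightarrow> nat \<Rightarrow> 's copies_point \<Rightarrow> 's copies_point" where
  "bt_id S n = (\<lambda>p \<in> cantor_copies S n. p)"

definition bt_sum ::
  "'s set \<Rightarrow> nat \<Rightarrow> nat \<Rightarrow> nat \<Rightarrow>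
   ('s copies_point \<Rightarrow> 's copies_point) \<Rightarrow> ('s copies_point \<Rightarrow> 's copies_point) \<Rightarrow>
   's copies_point \<Rightarrow> 's copies_point" where
  \<comment> \<open>\<open>f\<close> goes from \<open>m\<close> to \<open>n\<close>, and \<open>f'\<close> has domain \<open>m'\<close>\<close>
  "bt_sum S m n m' f f' =
     (\<lambda>p \<in> cantor_copies S (m + m').
        if fst p < m then f p
        else (let q = f' (fst p - m, snd p) in (n + fst q, snd q)))"

definition simple_split :: "'s set \<Rightarrow> 's \<Rightarrow> 's copies_point \<Rightarrow> 's copies_point" where
  "simple_split S s =
     (\<lambda>p \<in> cantor_copies S 1.
        (if snd p s 0 then 1 else 0, (snd p)(s := Omega_Words_Fun.suffix 1 (snd p s))))"

definition copy_perm :: "'s set \<Rightarrow> nat \<Rightarrow> (nat \<Rightarrow> nat) \<Rightarrow> 's copies_point \<Rightarrow> 's copies_point" where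
  "copy_perm S n \<sigma> = (\<lambda>p \<in> cantor_copies S n. (\<sigma> (fst p), snd p))"

text \<open>
  Formal expressions in the generators: \<open>Brick m n f\<close> stands for a morphism \<open>f\<close> from \<open>m\<close> to \<open>n\<close> of
  the Brin-Thompson groupoid, and \<open>Label gs\<close> for an element of the copy of the \<open>n\<close>-fold power of
  the group based at the object \<open>n = length gs\<close>.  \<open>Comp t u\<close> is \<open>t\<close> after \<open>u\<close>.  There is no
  constructor for inverses because both families of generators are closed under inverses.
\<close>

datatype ('g, 's) sv_term =
    Brick nat nat "'s copies_point \<Rightarrow> 's copies_point"
  | Label "'g list"
  | Comp "('g, 's) sv_term" "('g, 's) sv_term"
  | Sum "('g, 's) sv_term" "('g, 's) sv_term"

inductive sv_morphism ::
  "('g, 'm) monoid_scheme \<Rightarrow> 's set \<Rightarrow> ('g, 's) sv_term \<Rightarrow> nat \<Rightarrow> nat \<Rightarrow> bool"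
  for G S where
  brick: "f \<in> brin_thompson S m n \<Longrightarrow> sv_morphism G S (Brick m n f) m n"
| label: "gs \<noteq> [] \<Longrightarrow> set gs \<subseteq> carrier G \<Longrightarrow> sv_morphism G S (Label gs) (length gs) (length gs)"
| comp: "sv_morphism G S t n p \<Longrightarrow> sv_morphism G S u m n \<Longrightarrow> sv_morphism G S (Comp t u) m p"
| sum: "sv_morphism G S t m n \<Longrightarrow> sv_morphism G S t' m' n' \<Longrightarrow>
        sv_morphism G S (Sum t t') (m + m') (n + n')"

text \<open>
  Equality of morphisms: the least congruence for composition and direct sum that makes the
  expressions a category with functorial direct sum, respects the structure of the two families of
  generators, and contains the two defining families of relations (\<open>split\<close> and \<open>perm\<close>).
  The group acts on \<open>S\<close> through \<open>\<phi>\<close>.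
\<close>

inductive sv_eq ::
  "('g, 'm) monoid_scheme \<Rightarrow> 's set \<Rightarrow> ('g \<Rightarrow> 's \<Rightarrow> 's) \<Rightarrow>
   ('g, 's) sv_term \<Rightarrow> ('g, 's) sv_term \<Rightarrow> bool"
  for G S \<phi> where
  refl: "sv_morphism G S t m n \<Longrightarrow> sv_eq G S \<phi> t t"
| sym: "sv_eq G S \<phi> t u \<Longrightarrow> sv_eq G S \<phi> u t"
| trans: "sv_eq G S \<phi> t u \<Longrightarrow> sv_eq G S \<phi> u v \<Longrightarrow> sv_eq G S \<phi> t v"
| comp_cong: "sv_morphism G S t n p \<Longrightarrow> sv_morphism G S u m n \<Longrightarrow>
    sv_eq G S \<phi> t t' \<Longrightarrow> sv_eq G S \<phi> u u' \<Longrightarrow> sv_eq G S \<phi> (Comp t u) (Comp t' u')"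
| sum_cong: "sv_eq G S \<phi> t t' \<Longrightarrow> sv_eq G S \<phi> u u' \<Longrightarrow> sv_eq G S \<phi> (Sum t u) (Sum t' u')"
| comp_assoc: "sv_morphism G S t p q \<Longrightarrow> sv_morphism G S u n p \<Longrightarrow> sv_morphism G S v m n \<Longrightarrow>
    sv_eq G S \<phi> (Comp (Comp t u) v) (Comp t (Comp u v))"
| id_left: "sv_morphism G S t m n \<Longrightarrow> sv_eq G S \<phi> (Comp (Brick n n (bt_id S n)) t) t"
| id_right: "sv_morphism G S t m n \<Longrightarrow> sv_eq G S \<phi> (Comp t (Brick m m (bt_id S m))) t"
| interchange: "sv_morphism G S t n p \<Longrightarrow> sv_morphism G S u m n \<Longrightarrow>
    sv_morphism G S t' n' p' \<Longrightarrow> sv_morphism G S u' m' n' \<Longrightarrow>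
    sv_eq G S \<phi> (Comp (Sum t t') (Sum u u')) (Sum (Comp t u) (Comp t' u'))"
| brick_comp: "f \<in> brin_thompson S m n \<Longrightarrow> f' \<in> brin_thompson S n p \<Longrightarrow>
    sv_eq G S \<phi> (Comp (Brick n p f') (Brick m n f)) (Brick m p (compose (cantor_copies S m) f' f))"
| brick_sum: "f \<in> brin_thompson S m n \<Longrightarrow> f' \<in> brin_thompson S m' n' \<Longrightarrow>
    sv_eq G S \<phi> (Sum (Brick m n f) (Brick m' n' f'))
                (Brick (m + m') (n + n') (bt_sum S m n m' f f'))"
| label_one: "n \<ge> 1 \<Longrightarrow>
    sv_eq G S \<phi> (Label (replicate n \<one>\<^bsub>G\<^esub>)) (Brick n n (bt_id S n))"
| label_comp: "gs \<noteq> [] \<Longrightarrow> length gs = length hs \<Longrightarrow>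
    set gs \<subseteq> carrier G \<Longrightarrow> set hs \<subseteq> carrier G \<Longrightarrow>
    sv_eq G S \<phi> (Comp (Label gs) (Label hs)) (Label (map2 (\<lambda>g h. g \<otimes>\<^bsub>G\<^esub> h) gs hs))"
| label_sum: "gs \<noteq> [] \<Longrightarrow> hs \<noteq> [] \<Longrightarrow> set gs \<subseteq> carrier G \<Longrightarrow> set hs \<subseteq> carrier G \<Longrightarrow>
    sv_eq G S \<phi> (Sum (Label gs) (Label hs)) (Label (gs @ hs))"
| split: "g \<in> carrier G \<Longrightarrow> s \<in> S \<Longrightarrow>
    sv_eq G S \<phi> (Comp (Brick 1 2 (simple_split S (\<phi> g s))) (Label [g]))
                (Comp (Label [g, g]) (Brick 1 2 (simple_split S s)))"
| perm: "gs \<noteq> [] \<Longrightarrow> set gs \<subseteq> carrier G \<Longrightarrow> \<sigma> permutes {..<length gs} \<Longrightarrow>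
    sv_eq G S \<phi>
      (Comp (Label gs) (Brick (length gs) (length gs) (copy_perm S (length gs) \<sigma>)))
      (Comp (Brick (length gs) (length gs) (copy_perm S (length gs) \<sigma>))
            (Label (map (\<lambda>i. gs ! \<sigma> i) [0..<length gs])))"

definition sv_class ::
  "('g, 'm) monoid_scheme \<Rightarrow> 's set \<Rightarrow> ('g \<Rightarrow> 's \<Rightarrow> 's) \<Rightarrow>
   ('g, 's) sv_term \<Rightarrow> ('g, 's) sv_term set" where
  "sv_class G S \<phi> t = {u. sv_eq G S \<phi> t u}"

definition twisted_BT ::
  "('g, 'm) monoid_scheme \<Rightarrow> 's set \<Rightarrow> ('g \<Rightarrow> 's \<Rightarrow> 's) \<Rightarrow> ('g, 's) sv_term set monoid" where
  "twisted_BT G S \<phi> =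
     \<lparr>carrier = {sv_class G S \<phi> t | t. sv_morphism G S t 1 1},
      monoid.mult = (\<lambda>A B. \<Union>t\<in>A. \<Union>u\<in>B. sv_class G S \<phi> (Comp t u)),
      one = sv_class G S \<phi> (Brick 1 1 (bt_id S 1))\<rparr>"

definition action_kernel ::
  "('g, 'm) monoid_scheme \<Rightarrow> 's set \<Rightarrow> ('g \<Rightarrow> 's \<Rightarrow> 's) \<Rightarrow> 'g set" where
  "action_kernel G S \<phi> = kernel G (BijGroup S) \<phi>"

text \<open>\<open>\<phi>\<close> is constant on the cosets of its kernel, so \<open>the_elem\<close> picks out its value there.\<close>

definition induced_action :: "('g \<Rightarrow> 's \<Rightarrow> 's) \<Rightarrow> 'g set \<Rightarrow> 's \<Rightarrow> 's" where
  "induced_action \<phi> A = the_elem (\<phi> ` A)"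

abbreviation twisted_BT_faithful ::
  "('g, 'm) monoid_scheme \<Rightarrow> 's set \<Rightarrow> ('g \<Rightarrow> 's \<Rightarrow> 's) \<Rightarrow> ('g set, 's) sv_term set monoid" where
  "twisted_BT_faithful G S \<phi> \<equiv>
     twisted_BT (G Mod action_kernel G S \<phi>) S (induced_action \<phi>)"

text \<open>
  The union is over all expressions representing the given class; their images are equal morphisms
  because the generator map \<open>g \<mapsto> gK\<close> preserves the relations.  On representatives
  \<open>T\<^sub>-\<inverse> p\<^sub>\<sigma> (g\<^sub>1, \<dots>, g\<^sub>n) T\<^sub>+\<close> only the labels change, to \<open>(g\<^sub>1K, \<dots>, g\<^sub>nK)\<close>.
\<close>

definition natural_map ::
  "('g, 'm) monoid_scheme \<Rightarrow> 's set \<Rightarrow> ('g \<Rightarrow> 's \<Rightarrow> 's) \<Rightarrow>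
   ('g, 's) sv_term set \<Rightarrow> ('g set, 's) sv_term set" where
  "natural_map G S \<phi> A =
     (\<Union>t\<in>A. sv_class (G Mod action_kernel G S \<phi>) S (induced_action \<phi>)
               (map_sv_term (\<lambda>g. action_kernel G S \<phi> #>\<^bsub>G\<^esub> g) t))"

definition twisted_BT_kernel ::
  "('g, 'm) monoid_scheme \<Rightarrow> 's set \<Rightarrow> ('g \<Rightarrow> 's \<Rightarrow> 's) \<Rightarrow> ('g, 's) sv_term set set" where
  "twisted_BT_kernel G S \<phi> =
     kernel (twisted_BT G S \<phi>) (twisted_BT_faithful G S \<phi>) (natural_map G S \<phi>)"

end

theory Submission
  imports Defs
begin

text \<open>
  Formal expressions act on \<open>C\<^sup>S(m) \<times> G\<close> (the second factor records the labels), and pushing labels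
  across forests of simple splits shows that this action is faithful, so identities in \<open>SV\<^sub>G\<close> can be
  checked pointwise. If a normal subgroup \<open>N\<close> contains an element \<open>a\<close> that moves a point of the cube,
  then \<open>a\<close> moves some brick off itself, and commutators show that modulo \<open>N\<close> any two elements
  supported in a common proper clopen half commute. Hence the class modulo \<open>N\<close> of an element
  squeezed into a half does not depend on that half, and does not change on further squeezing. The
  flip of a first letter, the maps \<open>x\<^sub>s\<^sup>-\<^sup>1 x\<^sub>t\<close> (up to a transposition) and the group elements \<open>g\<close> (up to
  \<open>x\<^sub>g\<^sub>s\<^sup>-\<^sup>1 x\<^sub>s\<close>) are all products of two squeezed copies of themselves, so each has trivial class;
  these generate, and \<open>N\<close> is everything. An element moving no point of the cube has all its labels
  in \<open>K\<close>, i.e. it lies in \<open>SK\<^sub>G\<close>.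
\<close>

section \<open>Dyadic bricks and the Brin-Thompson groupoid\<close>

text \<open>The label relations are given only across simple splits and permutations, while a
  Brin-Thompson map comes with arbitrary brick partitions; once \<open>S\<close> has three elements,
  such a partition need not be the set of leaves of a tree. Cutting further to uniform depth repairs
  this: a forest reaches every uniform grid, and two cuts to the same depths differ only in the
  order of the pieces. The factor \<open>G\<close> of the space acted on is there because labels in
  the kernel of the action move no point of the cube.

  A half is any \<open>E\<close> in \<open>BT 1 2\<close>, that is, a cut of the cube into two
  copies of itself; \<open>quot 2 E E'\<close> carries the half of \<open>E'\<close> to that of
  \<open>E\<close>. If a class \<open>x\<close> survives squeezing and the element is a product of
  two squeezed copies of itself, then \<open>x = x x\<close>, hence \<open>x = 1\<close>. Only the
  class of \<open>inside D A\<close> is known to survive squeezing, not that of \<open>A\<close>. So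
  the argument runs twice: it puts all squeezed elements into \<open>N\<close>, and then the same
  product decompositions express each generator by trivial classes.\<close>

locale brick_system =
  fixes S :: "'s set"
begin

abbreviation "cube \<equiv> cantor_cube S"
abbreviation "copies \<equiv> cantor_copies S"
abbreviation "BT \<equiv> brin_thompson S"
abbreviation "glue \<equiv> brick_homeo S"
abbreviation "sfx \<equiv> Omega_Words_Fun.suffix"
abbreviation "pfx n w \<equiv> Omega_Words_Fun.prefix n w"

section \<open>Depths, agreement up to a depth, and uniform grids\<close>

definition fin_depth :: "('s \<Rightarrow> nat) \<Rightarrow> bool" where
  "fin_depth a \<longleftrightarrow> finite {s \<in> S. a s \<noteq> 0}"

text \<open>The classes of \<open>agree a\<close> are the cells of the grid of depth
  \<open>a\<close>. For finite depths they form a basis of the product topology, so continuity is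
  later expressed through them.\<close>

definition agree :: "('s \<Rightarrow> nat) \<Rightarrow> 's cube_point \<Rightarrow> 's cube_point \<Rightarrow> bool" where
  "agree a \<kappa> \<kappa>' \<longleftrightarrow> (\<forall>s\<in>S. \<forall>j<a s. \<kappa> s j = \<kappa>' s j)"

definition strip :: "('s \<Rightarrow> nat) \<Rightarrow> 's cube_point \<Rightarrow> 's cube_point" where
  "strip a \<kappa> = (\<lambda>s\<in>S. sfx (a s) (\<kappa> s))"

definition addr :: "('s \<Rightarrow> nat) \<Rightarrow> 's cube_point \<Rightarrow> 's \<Rightarrow> bool list" where
  "addr a \<kappa> = (\<lambda>s. if s \<in> S then pfx (a s) (\<kappa> s) else [])"

text \<open>Addresses are normalised to \<open>[]\<close> off \<open>S\<close>, so that each cell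
  has exactly one address and the grid of a finite depth is a finite set.\<close>

definition grid :: "('s \<Rightarrow> nat) \<Rightarrow> ('s \<Rightarrow> bool list) set" where
  "grid a = {\<psi>. (\<forall>s\<in>S. length (\<psi> s) = a s) \<and> (\<forall>s. s \<notin> S \<longrightarrow> \<psi> s = [])}"

lemma cube_ext: "\<kappa> \<in> cube \<Longrightarrow> \<kappa>' \<in> cube \<Longrightarrow> (\<And>s. s \<in> S \<Longrightarrow> \<kappa> s = \<kappa>' s) \<Longrightarrow> \<kappa> = \<kappa>'"
  unfolding cantor_cube_def by (rule PiE_ext)

lemma glue_in_cube [simp]: "glue \<psi> \<kappa> \<in> cube"
  by (simp add: brick_homeo_def cantor_cube_def)

lemma strip_in_cube [simp]: "strip a \<kappa> \<in> cube"
  by (simp add: strip_def cantor_cube_def)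

lemma cube_nonempty: "(\<lambda>s\<in>S. w) \<in> cube"
  by (simp add: cantor_cube_def)

lemma glue_apply: "s \<in> S \<Longrightarrow> glue \<psi> \<kappa> s = \<psi> s \<frown> \<kappa> s"
  by (simp add: brick_homeo_def)

lemma strip_apply: "s \<in> S \<Longrightarrow> strip a \<kappa> s = sfx (a s) (\<kappa> s)"
  by (simp add: strip_def)

lemma strip_glue: "\<kappa> \<in> cube \<Longrightarrow> (\<And>s. s \<in> S \<Longrightarrow> length (\<psi> s) = a s) \<Longrightarrow> strip a (glue \<psi> \<kappa>) = \<kappa>"
  by (rule cube_ext) (auto simp: strip_apply glue_apply fun_eq_iff)

lemma agree_refl [simp]: "agree a \<kappa> \<kappa>"
  by (simp add: agree_def)

lemma agree_mono: "agree b \<kappa> \<kappa>' \<Longrightarrow> (\<And>s. s \<in> S \<Longrightarrow> a s \<le> b s) \<Longrightarrow> agree a \<kappa> \<kappa>'"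
  unfolding agree_def by (meson order_less_le_trans)

lemma glue_addr_strip: "\<kappa>' \<in> cube \<Longrightarrow> agree a \<kappa> \<kappa>' \<Longrightarrow> glue (addr a \<kappa>) (strip a \<kappa>') = \<kappa>'"
  by (rule cube_ext) (auto simp: strip_apply glue_apply addr_def conc_def agree_def fun_eq_iff)

lemma agree_glue: "(\<And>s. s \<in> S \<Longrightarrow> length (\<psi> s) = a s) \<Longrightarrow> agree a (glue \<psi> \<kappa>) (glue \<psi> \<kappa>')"
  by (auto simp: agree_def glue_apply)

lemma dyadic_brick_iff:
  "\<kappa> \<in> dyadic_brick S \<psi> \<longleftrightarrow> \<kappa> \<in> cube \<and> (\<forall>s\<in>S. \<forall>j<length (\<psi> s). \<kappa> s j = \<psi> s ! j)"
proof -
  have "pfx (length w) x = w \<longleftrightarrow> (\<forall>j<length w. x j = w ! j)" for w :: "bool list" and x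
  proof
    assume "pfx (length w) x = w"
    then show "\<forall>j<length w. x j = w ! j" by (metis add_0 diff_zero subsequence_nth)
  next
    assume "\<forall>j<length w. x j = w ! j"
    then show "pfx (length w) x = w" by (intro nth_equalityI) simp_all
  qed
  then show ?thesis by (simp add: dyadic_brick_def)
qed

lemma dyadic_brick_eq_image: "dyadic_brick S \<psi> = glue \<psi> ` cube"
proof safe
  fix \<kappa> assume k: "\<kappa> \<in> dyadic_brick S \<psi>"
  have "\<kappa> = glue \<psi> (strip (\<lambda>s. length (\<psi> s)) \<kappa>)"
  proof (rule cube_ext)
    fix s assume s: "s \<in> S"
    show "\<kappa> s = glue \<psi> (strip (\<lambda>s. length (\<psi> s)) \<kappa>) s"
    proof
      fix n
      show "\<kappa> s n = glue \<psi> (strip (\<lambda>s. length (\<psi> s)) \<kappa>) s n"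
        using k s by (cases "n < length (\<psi> s)") (simp_all add: dyadic_brick_iff strip_apply glue_apply)
    qed
  qed (use k in \<open>simp_all add: dyadic_brick_iff\<close>)
  then show "\<kappa> \<in> glue \<psi> ` cube" by (metis imageI strip_in_cube)
next
  fix \<kappa> show "glue \<psi> \<kappa> \<in> dyadic_brick S \<psi>" by (simp add: dyadic_brick_iff glue_apply)
qed

lemma inj_glue: "inj_on (glue \<psi>) cube"
  by (rule inj_on_inverseI[where g = "strip (\<lambda>s. length (\<psi> s))"]) (simp add: strip_glue)

lemma inv_into_glue: "\<kappa> \<in> cube \<Longrightarrow> inv_into cube (glue \<psi>) (glue \<psi> \<kappa>) = \<kappa>"
  by (rule inv_into_f_f[OF inj_glue])

lemma grid_finite:
  assumes "fin_depth a"
  shows "finite (grid a)"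
proof -
  define A where "A = {s \<in> S. a s \<noteq> 0}"
  \<comment> \<open>\<open>sum a A\<close> is a common bound for the word lengths at all coordinates
    of \<open>A\<close>.\<close>
  define B where "B = {xs :: bool list. set xs \<subseteq> UNIV \<and> length xs \<le> sum a A}"
  have A: "finite A" using assms by (simp add: fin_depth_def A_def)
  have "\<psi> s \<in> B" if "\<psi> \<in> grid a" "s \<in> A" for \<psi> s
    using that member_le_sum[OF that(2) _ A, of a] by (simp add: B_def grid_def A_def)
  moreover have "\<psi> s = []" if "\<psi> \<in> grid a" "s \<notin> A" for \<psi> s
  proof (cases "s \<in> S")
    case True
    then have "length (\<psi> s) = 0" using that by (simp add: grid_def A_def)
    then show ?thesis by simp
  qed (use that in \<open>simp add: grid_def\<close>)
  ultimately have "grid a \<subseteq> {f. \<forall>x. (x \<in> A \<longrightarrow> f x \<in> B) \<and> (x \<notin> A \<longrightarrow> f x = [])}"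
    by blast
  moreover have "finite B" unfolding B_def by (rule finite_lists_length_le) simp
  ultimately show ?thesis
    using finite_set_of_finite_funs[OF A, of B "[]"] by (meson finite_subset)
qed

lemma grid_length: "\<psi> \<in> grid a \<Longrightarrow> s \<in> S \<Longrightarrow> length (\<psi> s) = a s"
  by (simp add: grid_def)

lemma grid_address: "fin_depth a \<Longrightarrow> \<psi> \<in> grid a \<Longrightarrow> \<psi> \<in> brick_addresses S"
proof -
  assume a: "fin_depth a" and p: "\<psi> \<in> grid a"
  have "{s \<in> S. \<psi> s \<noteq> []} \<subseteq> {s \<in> S. a s \<noteq> 0}" using grid_length[OF p] by (auto simp flip: length_greater_0_conv)
  then show ?thesis using a by (auto simp: brick_addresses_def fin_depth_def intro: finite_subset)
qed

lemma addr_grid: "addr a \<kappa> \<in> grid a"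
  by (auto simp: addr_def grid_def)

text \<open>Words of equal length that begin the same infinite word are equal, so two cells of one
  grid that meet coincide. This makes a grid a partition.\<close>

lemma grid_eqI:
  assumes "\<psi> \<in> grid a" "\<psi>' \<in> grid a" "glue \<psi> \<kappa> = glue \<psi>' \<kappa>'"
  shows "\<psi> = \<psi>'"
proof
  fix s
  show "\<psi> s = \<psi>' s"
  proof (cases "s \<in> S")
    case True
    then have "\<psi> s \<frown> \<kappa> s = \<psi>' s \<frown> \<kappa>' s" "length (\<psi> s) = length (\<psi>' s)"
      using assms glue_apply by (metis, simp add: grid_length)
    then show ?thesis
      by (metis conc_fst nth_equalityI)
  next
    case False
    then show ?thesis using assms by (auto simp: grid_def)
  qed
qed

lemma fin_depth_add: "fin_depth a \<Longrightarrow> fin_depth b \<Longrightarrow> fin_depth (\<lambda>s. a s + b s)"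
  unfolding fin_depth_def by (rule finite_subset[of _ "{s \<in> S. a s \<noteq> 0} \<union> {s \<in> S. b s \<noteq> 0}"]) auto

lemma fin_depth_0 [simp]: "fin_depth (\<lambda>s. 0)"
  by (simp add: fin_depth_def)

lemma fin_depth_mono: "fin_depth b \<Longrightarrow> (\<And>s. s \<in> S \<Longrightarrow> a s \<le> b s) \<Longrightarrow> fin_depth a"
  unfolding fin_depth_def by (erule finite_subset[rotated]) fastforce

lemma fin_depth_length: "fin_depth (\<lambda>s. length (\<psi> s)) \<longleftrightarrow> \<psi> \<in> brick_addresses S"
  by (simp add: fin_depth_def brick_addresses_def)

lemma fin_depth_sum:
  "finite I \<Longrightarrow> (\<And>i. i \<in> I \<Longrightarrow> fin_depth (c i)) \<Longrightarrow> fin_depth (\<lambda>s. \<Sum>i\<in>I. c i s)"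
  by (induction I rule: finite_induct) (auto intro: fin_depth_add)

section \<open>Prefix replacement below a depth, a form of the groupoid without partitions\<close>

definition canonical_below :: "nat \<Rightarrow> ('s \<Rightarrow> nat) \<Rightarrow> ('s copies_point \<Rightarrow> 's copies_point) \<Rightarrow> bool" where
  "canonical_below m a f \<longleftrightarrow> (\<forall>i<m. \<forall>\<kappa>\<in>cube. \<exists>j \<psi>. \<psi> \<in> brick_addresses S \<and>
     (\<forall>\<kappa>'\<in>cube. agree a \<kappa> \<kappa>' \<longrightarrow> f (i, \<kappa>') = (j, glue \<psi> (strip a \<kappa>'))))"

lemma canonical_belowE:
  assumes "canonical_below m a f" "i < m" "\<kappa> \<in> cube"
  obtains \<psi> j where "\<psi> \<in> brick_addresses S"
    "\<forall>\<kappa>'\<in>cube. agree a \<kappa> \<kappa>' \<longrightarrow> f (i, \<kappa>') = (j, glue \<psi> (strip a \<kappa>'))"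
  using assms unfolding canonical_below_def by blast

lemma copies_iff [simp]: "(i, \<kappa>) \<in> copies m \<longleftrightarrow> i < m \<and> \<kappa> \<in> cube"
  by (simp add: cantor_copies_def)

lemma brick_partition_grid:
  assumes a: "fin_depth a" and e: "bij_betw e {..<r} ({..<m} \<times> grid a)"
  shows "brick_partition S m r e"
proof -
  have mem: "e k \<in> {..<m} \<times> grid a" if "k < r" for k
    using e that by (auto dest: bij_betwE)
  have "disjoint_family_on (\<lambda>k. {fst (e k)} \<times> dyadic_brick S (snd (e k))) {..<r}"
  proof (clarsimp simp: disjoint_family_on_def dyadic_brick_eq_image)
    fix k l assume *: "k < r" "l < r" "k \<noteq> l"
    show "{fst (e k)} \<times> glue (snd (e k)) ` cube \<inter> {fst (e l)} \<times> glue (snd (e l)) ` cube = {}"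
    proof (rule ccontr)
      assume "\<not> ?thesis"
      then obtain \<kappa> \<kappa>' where "fst (e k) = fst (e l)" "glue (snd (e k)) \<kappa> = glue (snd (e l)) \<kappa>'" by auto
      moreover have "snd (e k) \<in> grid a" "snd (e l) \<in> grid a" using mem *(1,2) by (auto simp: mem_Times_iff)
      ultimately have "e k = e l" using grid_eqI by (metis prod_eqI)
      with * e show False by (auto simp: bij_betw_def inj_on_def)
    qed
  qed
  moreover have "(\<Union>k<r. {fst (e k)} \<times> dyadic_brick S (snd (e k))) = copies m"
  proof safe
    fix k i \<kappa> assume "k < r" "\<kappa> \<in> dyadic_brick S (snd (e k))"
    then show "(fst (e k), \<kappa>) \<in> copies m" using mem[of k] by (auto simp: dyadic_brick_iff mem_Times_iff)
  next
    fix i \<kappa> assume "(i, \<kappa>) \<in> copies m"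
    then have i: "i < m" "\<kappa> \<in> cube" by auto
    then have "(i, addr a \<kappa>) \<in> e ` {..<r}" using e addr_grid by (auto simp: bij_betw_def)
    then obtain k where "k < r" "e k = (i, addr a \<kappa>)" by (metis imageE lessThan_iff)
    moreover have "\<kappa> \<in> dyadic_brick S (addr a \<kappa>)"
      using i glue_addr_strip[of \<kappa> a \<kappa>] by (metis agree_refl dyadic_brick_eq_image image_eqI strip_in_cube)
    ultimately show "(i, \<kappa>) \<in> (\<Union>k<r. {fst (e k)} \<times> dyadic_brick S (snd (e k)))" by force
  qed
  moreover have "fst (e k) < m \<and> snd (e k) \<in> brick_addresses S" if "k < r" for k
    using mem[OF that] grid_address[OF a] by (simp add: mem_Times_iff)
  ultimately show ?thesis
    unfolding brick_partition_def by blast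
qed

text \<open>The grid of depth \<open>a\<close> serves as domain partition and its image as range
  partition: a canonical map sends cells to bricks, and bijectivity makes these disjoint and
  covering. Together with \<open>brin_thompson_canonical\<close> this replaces the two partitions in
  \<open>brin_thompson\<close> by a single depth.\<close>

lemma brin_thompsonI:
  assumes ext: "f \<in> extensional (copies m)" and pos: "1 \<le> m" "1 \<le> n"
    and bij: "bij_betw f (copies m) (copies n)" and a: "fin_depth a" and can: "canonical_below m a f"
  shows "f \<in> BT m n"
proof -
  define r where "r = card ({..<m} \<times> grid a)"
  have "finite ({..<m} \<times> grid a)" using grid_finite[OF a] by simp
  then obtain e where e: "bij_betw e {..<r} ({..<m} \<times> grid a)"
    using ex_bij_betw_nat_finite unfolding r_def atLeast0LessThan by metis
  have mem: "e k \<in> {..<m} \<times> grid a" if "k < r" for k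
    using e that by (auto dest: bij_betwE)
  have "\<exists>R. snd R \<in> brick_addresses S \<and>
      (\<forall>\<kappa>\<in>cube. f (fst (e k), glue (snd (e k)) \<kappa>) = (fst R, glue (snd R) \<kappa>))" if k: "k < r" for k
  proof -
    \<comment> \<open>Any point of the cell \<open>e k\<close> will do; it only selects the cell in
      \<open>canonical_below\<close>.\<close>
    define \<kappa>0 where "\<kappa>0 = glue (snd (e k)) (\<lambda>s\<in>S. undefined)"
    have len: "\<And>s. s \<in> S \<Longrightarrow> length (snd (e k) s) = a s" and i: "fst (e k) < m"
      using mem[OF k] grid_length by (auto simp: mem_Times_iff)
    obtain j \<psi> where j: "\<psi> \<in> brick_addresses S"
      "\<And>\<kappa>'. \<kappa>' \<in> cube \<Longrightarrow> agree a \<kappa>0 \<kappa>' \<Longrightarrow> f (fst (e k), \<kappa>') = (j, glue \<psi> (strip a \<kappa>'))"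
      using can i unfolding canonical_below_def \<kappa>0_def by (metis glue_in_cube)
    have "f (fst (e k), glue (snd (e k)) \<kappa>) = (j, glue \<psi> \<kappa>)" if "\<kappa> \<in> cube" for \<kappa>
      using j(2)[OF glue_in_cube] agree_glue[OF len] strip_glue[OF that len] unfolding \<kappa>0_def by simp
    then show ?thesis using j(1) by (intro exI[of _ "(j, \<psi>)"]) auto
  qed
  then obtain R where R: "\<And>k. k < r \<Longrightarrow> snd (R k) \<in> brick_addresses S"
    "\<And>k \<kappa>. k < r \<Longrightarrow> \<kappa> \<in> cube \<Longrightarrow> f (fst (e k), glue (snd (e k)) \<kappa>) = (fst (R k), glue (snd (R k)) \<kappa>)"
    by metis
  have De: "brick_partition S m r e" by (rule brick_partition_grid[OF a e])
  have img: "{fst (R k)} \<times> dyadic_brick S (snd (R k)) = f ` ({fst (e k)} \<times> dyadic_brick S (snd (e k)))"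
    if "k < r" for k
    using R(2)[OF that] unfolding dyadic_brick_eq_image by (force simp: image_iff)
  have sub: "{fst (e k)} \<times> dyadic_brick S (snd (e k)) \<subseteq> copies m" if "k < r" for k
    using De that unfolding brick_partition_def by blast
  have "disjoint_family_on (\<lambda>k. {fst (R k)} \<times> dyadic_brick S (snd (R k))) {..<r}"
    unfolding disjoint_family_on_def
  proof (intro ballI impI)
    fix k l assume *: "k \<in> {..<r}" "l \<in> {..<r}" "k \<noteq> l"
    have "({fst (e k)} \<times> dyadic_brick S (snd (e k))) \<inter> ({fst (e l)} \<times> dyadic_brick S (snd (e l))) = {}"
      using De * unfolding brick_partition_def disjoint_family_on_def by blast
    then show "{fst (R k)} \<times> dyadic_brick S (snd (R k)) \<inter> {fst (R l)} \<times> dyadic_brick S (snd (R l)) = {}"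
      using * img[of k] img[of l] inj_on_image_Int[OF bij_betw_imp_inj_on[OF bij] sub sub, of k l]
      by (metis image_empty lessThan_iff)
  qed
  moreover have U: "(\<Union>k<r. {fst (R k)} \<times> dyadic_brick S (snd (R k))) = copies n"
  proof -
    have "(\<Union>k<r. {fst (R k)} \<times> dyadic_brick S (snd (R k))) = f ` (\<Union>k<r. {fst (e k)} \<times> dyadic_brick S (snd (e k)))"
      unfolding image_UN using img by simp
    also have "\<dots> = f ` copies m" using De unfolding brick_partition_def by simp
    finally show ?thesis using bij by (simp add: bij_betw_def)
  qed
  moreover have "fst (R k) < n" if "k < r" for k
  proof -
    have "(fst (R k), glue (snd (R k)) (\<lambda>s\<in>S. undefined)) \<in> copies n"
      unfolding U[symmetric] dyadic_brick_eq_image using that cube_nonempty by force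
    then show ?thesis by simp
  qed
  ultimately have "brick_partition S n r R"
    unfolding brick_partition_def using R(1) by blast
  moreover have "f (fst (e k), \<kappa>) = (fst (R k), glue (snd (R k)) (inv_into cube (glue (snd (e k))) \<kappa>))"
    if "k < r" "\<kappa> \<in> dyadic_brick S (snd (e k))" for k \<kappa>
    using that R(2) unfolding dyadic_brick_eq_image by (auto simp: inv_into_glue)
  ultimately show ?thesis
    unfolding brin_thompson_def using ext pos bij De by blast
qed

lemma brin_thompsonD:
  assumes "f \<in> BT m n"
  shows "f \<in> extensional (copies m)" "1 \<le> m" "1 \<le> n" "bij_betw f (copies m) (copies n)"
  using assms by (auto simp: brin_thompson_def)

text \<open>A point in the cell of \<open>\<kappa>\<close> starts with \<open>\<psi>\<close>,
  continues with the letters of \<open>\<kappa>\<close> from the end of \<open>\<psi>\<close> up to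
  depth \<open>a\<close>, and is free afterwards. So a cell inside a brick is reached by prolonging
  the address of the brick.\<close>

lemma glue_refine:
  assumes "\<kappa> \<in> dyadic_brick S \<psi>" "\<And>s. s \<in> S \<Longrightarrow> length (\<psi> s) \<le> a s"
    "\<kappa>' \<in> cube" "agree a \<kappa> \<kappa>'"
  shows "\<kappa>' = glue \<psi> (glue (\<lambda>s. map (\<kappa> s) [length (\<psi> s)..<a s]) (strip a \<kappa>'))"
proof (rule cube_ext)
  fix s assume s: "s \<in> S"
  show "\<kappa>' s = glue \<psi> (glue (\<lambda>s. map (\<kappa> s) [length (\<psi> s)..<a s]) (strip a \<kappa>')) s"
  proof
    fix n
    show "\<kappa>' s n = glue \<psi> (glue (\<lambda>s. map (\<kappa> s) [length (\<psi> s)..<a s]) (strip a \<kappa>')) s n"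
    proof (cases "n < length (\<psi> s)")
      case True
      then have "n < a s" using assms(2)[OF s] by simp
      then have "\<kappa>' s n = \<kappa> s n" using assms(4) s by (simp add: agree_def)
      then show ?thesis using True s assms(1) by (simp add: glue_apply dyadic_brick_iff nth_append)
    next
      case False
      show ?thesis
      proof (cases "n < a s")
        case True
        with False have "n - length (\<psi> s) < a s - length (\<psi> s)" "length (\<psi> s) + (n - length (\<psi> s)) = n"
          by simp_all
        then show ?thesis
          using False True s assms(4) by (simp add: glue_apply agree_def nth_append)
      next
        case 2: False
        with False have "\<not> n - length (\<psi> s) < a s - length (\<psi> s)"
          "a s + (n - length (\<psi> s) - (a s - length (\<psi> s))) = n"
          using assms(2)[OF s] by simp_all
        then show ?thesis
          using False s by (simp add: glue_apply strip_apply)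
      qed
    qed
  qed
qed (use assms in auto)

lemma address_append:
  "\<psi> \<in> brick_addresses S \<Longrightarrow> \<psi>' \<in> brick_addresses S \<Longrightarrow> (\<lambda>s. \<psi> s @ \<psi>' s) \<in> brick_addresses S"
  unfolding fin_depth_length[symmetric] by (simp add: fin_depth_add)

lemma glue_glue: "glue \<psi> (glue \<psi>' \<kappa>) = glue (\<lambda>s. \<psi> s @ \<psi>' s) \<kappa>"
  by (simp add: brick_homeo_def fun_eq_iff restrict_def)

lemma brin_thompson_canonical:
  assumes "f \<in> BT m n"
  obtains a where "fin_depth a" "canonical_below m a f"
proof -
  obtain r D R where D: "brick_partition S m r D" and R: "brick_partition S n r R"
    and f: "\<And>k \<kappa>. k < r \<Longrightarrow> \<kappa> \<in> dyadic_brick S (snd (D k)) \<Longrightarrow>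
              f (fst (D k), \<kappa>) = (fst (R k), glue (snd (R k)) (inv_into cube (glue (snd (D k))) \<kappa>))"
    using assms unfolding brin_thompson_def by blast
  \<comment> \<open>The sum of all address lengths dominates each of them, so every cell of depth
    \<open>a\<close> lies in one brick of the domain partition.\<close>
  define a where "a = (\<lambda>s. \<Sum>k<r. length (snd (D k) s))"
  have a: "fin_depth a"
    unfolding a_def using D by (intro fin_depth_sum) (auto simp: brick_partition_def fin_depth_length)
  have "canonical_below m a f"
    unfolding canonical_below_def
  proof (intro allI impI ballI)
    fix i \<kappa> assume "i < m" "\<kappa> \<in> cube"
    then have "(i, \<kappa>) \<in> (\<Union>k<r. {fst (D k)} \<times> dyadic_brick S (snd (D k)))"
      using D by (simp add: brick_partition_def)
    then obtain k where k: "k < r" "i = fst (D k)" "\<kappa> \<in> dyadic_brick S (snd (D k))" by auto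
    let ?v = "\<lambda>s. map (\<kappa> s) [length (snd (D k) s)..<a s]"
    have le: "length (snd (D k) s) \<le> a s" for s
      unfolding a_def using k by (intro member_le_sum) auto
    show "\<exists>j \<psi>. \<psi> \<in> brick_addresses S \<and>
           (\<forall>\<kappa>'\<in>cube. agree a \<kappa> \<kappa>' \<longrightarrow> f (i, \<kappa>') = (j, glue \<psi> (strip a \<kappa>')))"
    proof (intro exI conjI ballI impI)
      have "?v \<in> brick_addresses S"
        unfolding fin_depth_length[symmetric] by (rule fin_depth_mono[OF a]) simp
      moreover have "snd (R k) \<in> brick_addresses S" using R k by (simp add: brick_partition_def)
      ultimately show "(\<lambda>s. snd (R k) s @ ?v s) \<in> brick_addresses S" by (rule address_append[rotated])
    next
      fix \<kappa>' assume *: "\<kappa>' \<in> cube" "agree a \<kappa> \<kappa>'"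
      have eq: "\<kappa>' = glue (snd (D k)) (glue ?v (strip a \<kappa>'))"
        by (rule glue_refine[OF k(3) le *])
      have "f (i, glue (snd (D k)) \<kappa>'') = (fst (R k), glue (snd (R k)) \<kappa>'')" if "\<kappa>'' \<in> cube" for \<kappa>''
        using f[OF k(1)] k(2) that by (simp add: dyadic_brick_eq_image inv_into_glue)
      then have "f (i, \<kappa>') = (fst (R k), glue (snd (R k)) (glue ?v (strip a \<kappa>')))"
        by (subst eq) simp
      then show "f (i, \<kappa>') = (fst (R k), glue (\<lambda>s. snd (R k) s @ ?v s) (strip a \<kappa>'))"
        by (simp add: glue_glue)
    qed
  qed
  with a show thesis by (rule that)
qed

lemma brin_thompson_closed: "f \<in> BT m n \<Longrightarrow> p \<in> copies m \<Longrightarrow> f p \<in> copies n"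
  using brin_thompsonD(4) bij_betwE by blast

text \<open>Depths add: \<open>f\<close> replaces the first \<open>a s\<close> letters by a word, so
  the first \<open>b s\<close> letters of the image depend on at most \<open>a s + b s\<close>
  letters of the point.\<close>

lemma brin_thompson_compose:
  assumes f: "f \<in> BT m n" and g: "g \<in> BT n q"
  shows "compose (copies m) g f \<in> BT m q"
proof -
  obtain a where a: "fin_depth a" "canonical_below m a f" using brin_thompson_canonical[OF f] .
  obtain b where b: "fin_depth b" "canonical_below n b g" using brin_thompson_canonical[OF g] .
  have "canonical_below m (\<lambda>s. a s + b s) (compose (copies m) g f)"
    unfolding canonical_below_def
  proof (intro allI impI ballI)
    fix i \<kappa> assume i: "i < m" "\<kappa> \<in> cube"
    then obtain j \<psi> where j: "\<psi> \<in> brick_addresses S"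
      "\<And>\<kappa>'. \<kappa>' \<in> cube \<Longrightarrow> agree a \<kappa> \<kappa>' \<Longrightarrow> f (i, \<kappa>') = (j, glue \<psi> (strip a \<kappa>'))"
      using a(2) unfolding canonical_below_def by metis
    have "f (i, \<kappa>) = (j, glue \<psi> (strip a \<kappa>))" using i j by simp
    then have "j < n" using brin_thompson_closed[OF f, of "(i, \<kappa>)"] i by simp
    then obtain k \<chi> where k: "\<chi> \<in> brick_addresses S"
      "\<And>\<kappa>'. \<kappa>' \<in> cube \<Longrightarrow> agree b (glue \<psi> (strip a \<kappa>)) \<kappa>' \<Longrightarrow> g (j, \<kappa>') = (k, glue \<chi> (strip b \<kappa>'))"
      using b(2) unfolding canonical_below_def by (metis glue_in_cube)
    \<comment> \<open>What \<open>g\<close> leaves in front of the letters of the point beyond depth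
      \<open>a + b\<close>: the image under \<open>f\<close> starts with \<open>\<psi>\<close>, and
      removing \<open>b s\<close> letters from it leaves a stretch of length
      \<open>length (\<psi> s)\<close> before them.\<close>
    let ?v = "\<lambda>s. map (glue \<psi> (strip a \<kappa>) s) [b s..<b s + length (\<psi> s)]"
    show "\<exists>j \<psi>. \<psi> \<in> brick_addresses S \<and> (\<forall>\<kappa>'\<in>cube. agree (\<lambda>s. a s + b s) \<kappa> \<kappa>' \<longrightarrow>
             compose (copies m) g f (i, \<kappa>') = (j, glue \<psi> (strip (\<lambda>s. a s + b s) \<kappa>')))"
    proof (intro exI conjI ballI impI)
      have "?v \<in> brick_addresses S"
        using j(1) unfolding fin_depth_length[symmetric] by simp
      then show "(\<lambda>s. \<chi> s @ ?v s) \<in> brick_addresses S" using k(1) by (rule address_append[rotated])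
    next
      fix \<kappa>' assume *: "\<kappa>' \<in> cube" "agree (\<lambda>s. a s + b s) \<kappa> \<kappa>'"
      have "agree a \<kappa> \<kappa>'" by (rule agree_mono[OF *(2)]) simp
      then have 1: "f (i, \<kappa>') = (j, glue \<psi> (strip a \<kappa>'))" using j(2) * by simp
      have "agree b (glue \<psi> (strip a \<kappa>)) (glue \<psi> (strip a \<kappa>'))"
        using *(2) by (auto simp: agree_def glue_apply strip_apply conc_def)
      then have 2: "g (j, glue \<psi> (strip a \<kappa>')) = (k, glue \<chi> (strip b (glue \<psi> (strip a \<kappa>'))))"
        using k(2) by simp
      have "strip b (glue \<psi> (strip a \<kappa>')) = glue ?v (strip (\<lambda>s. a s + b s) \<kappa>')"
      proof (rule cube_ext)
        fix s assume s: "s \<in> S"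
        show "strip b (glue \<psi> (strip a \<kappa>')) s = glue ?v (strip (\<lambda>s. a s + b s) \<kappa>') s"
        proof
          fix x
          have "a s + (b s + x - length (\<psi> s)) < a s + b s" if "x < length (\<psi> s)" "\<not> b s + x < length (\<psi> s)"
            using that by simp
          then show "strip b (glue \<psi> (strip a \<kappa>')) s x = glue ?v (strip (\<lambda>s. a s + b s) \<kappa>') s x"
            using s *(2) by (auto simp: glue_apply strip_apply conc_def agree_def ac_simps)
        qed
      qed auto
      then show "compose (copies m) g f (i, \<kappa>') = (k, glue (\<lambda>s. \<chi> s @ ?v s) (strip (\<lambda>s. a s + b s) \<kappa>'))"
        using 1 2 i * by (simp add: compose_def glue_glue)
    qed
  qed
  then show ?thesis
    using brin_thompsonD[OF f] brin_thompsonD[OF g] fin_depth_add[OF a(1) b(1)] bij_betw_compose[of f _ _ g]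
    by (intro brin_thompsonI) (auto simp: )
qed

section \<open>Inverses, permutations, simple splits and direct sums\<close>

definition bt_inv :: "nat \<Rightarrow> ('s copies_point \<Rightarrow> 's copies_point) \<Rightarrow> nat \<Rightarrow> 's copies_point \<Rightarrow> 's copies_point" where
  "bt_inv m f n = (\<lambda>p\<in>copies n. inv_into (copies m) f p)"

text \<open>The definition by two partitions is symmetric, so \<open>D\<close> and \<open>R\<close>
  are simply exchanged; this is why the proof returns to partitions instead of using depths.\<close>

lemma bt_inv_closed:
  assumes "f \<in> BT m n"
  shows "bt_inv m f n \<in> BT n m"
proof -
  obtain r D R where D: "brick_partition S m r D" and R: "brick_partition S n r R"
    and f: "\<And>k \<kappa>. k < r \<Longrightarrow> \<kappa> \<in> dyadic_brick S (snd (D k)) \<Longrightarrow>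
              f (fst (D k), \<kappa>) = (fst (R k), glue (snd (R k)) (inv_into cube (glue (snd (D k))) \<kappa>))"
    using assms unfolding brin_thompson_def by blast
  note bij = brin_thompsonD(4)[OF assms]
  have "bt_inv m f n (fst (R k), \<kappa>) = (fst (D k), glue (snd (D k)) (inv_into cube (glue (snd (R k))) \<kappa>))"
    if k: "k < r" "\<kappa> \<in> dyadic_brick S (snd (R k))" for k \<kappa>
  proof -
    obtain \<kappa>' where \<kappa>': "\<kappa>' \<in> cube" "\<kappa> = glue (snd (R k)) \<kappa>'" using k(2) unfolding dyadic_brick_eq_image by blast
    have lt: "fst (D k) < m" "fst (R k) < n" using D R k by (auto simp: brick_partition_def)
    have "f (fst (D k), glue (snd (D k)) \<kappa>') = (fst (R k), \<kappa>)"
      using f[OF k(1), of "glue (snd (D k)) \<kappa>'"] \<kappa>' by (simp add: dyadic_brick_eq_image inv_into_glue)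
    then show ?thesis
      using lt \<kappa>' bij unfolding bt_inv_def
      by (auto simp: inv_into_glue intro!: inv_into_f_eq bij_betw_imp_inj_on)
  qed
  moreover have "bij_betw (bt_inv m f n) (copies n) (copies m)"
    using bij_betw_inv_into[OF bij] unfolding bt_inv_def by (simp cong: bij_betw_cong)
  moreover have "bt_inv m f n \<in> extensional (copies n)" by (simp add: bt_inv_def)
  ultimately show ?thesis
    unfolding brin_thompson_def using D R brin_thompsonD(2,3)[OF assms] by blast
qed

lemma bt_inv_left: "f \<in> BT m n \<Longrightarrow> p \<in> copies m \<Longrightarrow> bt_inv m f n (f p) = p"
  using brin_thompsonD(4)[of f m n] brin_thompson_closed[of f m n p]
  by (simp add: bt_inv_def bij_betw_def)

lemma bt_inv_right: "f \<in> BT m n \<Longrightarrow> p \<in> copies n \<Longrightarrow> f (bt_inv m f n p) = p"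
  using brin_thompsonD(4)[of f m n] by (simp add: bt_inv_def bij_betw_def f_inv_into_f)

lemma bt_inj: "f \<in> BT m n \<Longrightarrow> p \<in> copies m \<Longrightarrow> q \<in> copies m \<Longrightarrow> f p = f q \<Longrightarrow> p = q"
  using bt_inv_left by metis

lemma bt_ext: "f \<in> BT m n \<Longrightarrow> g \<in> BT m n' \<Longrightarrow> (\<And>p. p \<in> copies m \<Longrightarrow> f p = g p) \<Longrightarrow> f = g"
  using brin_thompsonD(1) extensionalityI by metis

lemma bt_perm:
  assumes "1 \<le> n" "\<sigma> permutes {..<n}"
  shows "copy_perm S n \<sigma> \<in> BT n n"
proof (rule brin_thompsonI[where a = "\<lambda>s. 0"])
  have \<sigma>: "bij_betw \<sigma> {..<n} {..<n}" using assms permutes_imp_bij by blast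
  have *: "bij_betw (map_prod \<sigma> (\<lambda>x. x)) ({..<n} \<times> cube) ({..<n} \<times> cube)"
    by (rule bij_betw_map_prod) (use \<sigma> in \<open>auto simp: bij_betw_def\<close>)
  show "bij_betw (copy_perm S n \<sigma>) (copies n) (copies n)"
    unfolding cantor_copies_def copy_perm_def
    by (rule bij_betw_cong[THEN iffD2, OF _ *]) auto
  show "canonical_below n (\<lambda>s. 0) (copy_perm S n \<sigma>)"
    unfolding canonical_below_def copy_perm_def
  proof (intro allI impI ballI)
    fix i \<kappa> assume "i < n" "\<kappa> \<in> cube"
    then show "\<exists>j \<psi>. \<psi> \<in> brick_addresses S \<and> (\<forall>\<kappa>'\<in>cube. agree (\<lambda>s. 0) \<kappa> \<kappa>' \<longrightarrow>
       (\<lambda>p\<in>copies n. (\<sigma> (fst p), snd p)) (i, \<kappa>') = (j, glue \<psi> (strip (\<lambda>s. 0) \<kappa>')))"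
      by (intro exI[of _ "\<sigma> i"] exI[of _ "\<lambda>s. []"])
         (auto simp: brick_addresses_def intro!: cube_ext simp: glue_apply strip_apply)
  qed
qed (use assms in \<open>auto simp: copy_perm_def\<close>)

lemma bt_id_perm: "bt_id S n = copy_perm S n id"
  by (simp add: bt_id_def copy_perm_def)

lemma bt_id_closed: "1 \<le> n \<Longrightarrow> bt_id S n \<in> BT n n"
  using bt_perm[OF _ permutes_id] by (simp add: bt_id_perm)

lemma bt_id_apply [simp]: "p \<in> copies n \<Longrightarrow> bt_id S n p = p"
  by (simp add: bt_id_def)

text \<open>Inverse to the two branches of the simple split at \<open>s\<close>. Writing points in
  this form lets splits, flips and labels be computed without suffixes.\<close>

definition scons :: "'s \<Rightarrow> bool \<Rightarrow> 's cube_point \<Rightarrow> 's cube_point" where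
  "scons s b \<kappa> = \<kappa>(s := [b] \<frown> \<kappa> s)"

lemma scons_cube: "s \<in> S \<Longrightarrow> \<kappa> \<in> cube \<Longrightarrow> scons s b \<kappa> \<in> cube"
  by (auto simp: scons_def cantor_cube_def PiE_def extensional_def)

lemma scons_cases:
  assumes "s \<in> S" "\<kappa> \<in> cube"
  obtains \<kappa>' where "\<kappa>' \<in> cube" "\<kappa> = scons s (\<kappa> s 0) \<kappa>'"
proof
  show "\<kappa>(s := sfx 1 (\<kappa> s)) \<in> cube"
    using assms by (auto simp: cantor_cube_def PiE_def extensional_def)
  show "\<kappa> = scons s (\<kappa> s 0) (\<kappa>(s := sfx 1 (\<kappa> s)))"
    by (auto simp: scons_def conc_def fun_eq_iff)
qed

lemma scons_inject: "scons s b \<kappa> = scons s b' \<kappa>' \<Longrightarrow> b = b' \<and> \<kappa> = \<kappa>'"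
proof -
  assume eq: "scons s b \<kappa> = scons s b' \<kappa>'"
  have b: "([b] \<frown> \<kappa> s) = ([b'] \<frown> \<kappa>' s)" using eq by (metis scons_def fun_upd_same)
  have "b = b'" using fun_cong[OF b, of 0] by simp
  moreover have "\<kappa> t = \<kappa>' t" for t
  proof (cases "t = s")
    case True
    have "\<kappa> s n = \<kappa>' s n" for n using fun_cong[OF b, of "Suc n"] by simp
    then show ?thesis using True by auto
  next
    case False
    then show ?thesis using eq by (metis scons_def fun_upd_other)
  qed
  ultimately show ?thesis by auto
qed

lemma simple_split_scons:
  "s \<in> S \<Longrightarrow> \<kappa> \<in> cube \<Longrightarrow> simple_split S s (0, scons s b \<kappa>) = (if b then 1 else 0, \<kappa>)"
  using scons_cube[of s \<kappa> b] by (auto simp: simple_split_def scons_def fun_eq_iff)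

lemma bt_split:
  assumes s: "s \<in> S"
  shows "simple_split S s \<in> BT 1 2"
proof (rule brin_thompsonI[where a = "(\<lambda>t. 0)(s := 1)"])
  show "bij_betw (simple_split S s) (copies 1) (copies 2)"
  proof (rule bij_betwI[where g = "\<lambda>(i, \<kappa>). (0, scons s (i = 1) \<kappa>)"])
    show "simple_split S s \<in> copies 1 \<rightarrow> copies 2"
    proof clarsimp
      fix \<kappa> assume "\<kappa> \<in> cube"
      then obtain \<kappa>' where "\<kappa>' \<in> cube" "\<kappa> = scons s (\<kappa> s 0) \<kappa>'" using scons_cases[OF s] by metis
      then show "simple_split S s (0, \<kappa>) \<in> copies 2" by (metis copies_iff simple_split_scons[OF s] one_less_numeral_iff pos2 semiring_norm(76))
    qed
    show "(case simple_split S s p of (i, \<kappa>) \<Rightarrow> (0, scons s (i = 1) \<kappa>)) = p" if p: "p \<in> copies 1" for p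
    proof -
      obtain \<kappa> where k: "p = (0, \<kappa>)" "\<kappa> \<in> cube" using p by (cases p) auto
      then obtain b \<kappa>' where "\<kappa>' \<in> cube" "\<kappa> = scons s b \<kappa>'" using scons_cases[OF s] by metis
      then show ?thesis using k(1) by (simp add: simple_split_scons[OF s])
    qed
  qed (use s in \<open>auto simp: scons_cube simple_split_scons\<close>)
  show "canonical_below 1 ((\<lambda>t. 0)(s := 1)) (simple_split S s)"
    unfolding canonical_below_def
  proof (intro allI impI ballI)
    fix i \<kappa> assume i: "i < (1::nat)" "\<kappa> \<in> cube"
    have "simple_split S s (i, \<kappa>') = (if \<kappa> s 0 then 1 else 0, glue (\<lambda>s. []) (strip ((\<lambda>t. 0)(s := 1)) \<kappa>'))"
      if *: "\<kappa>' \<in> cube" "agree ((\<lambda>t. 0)(s := 1)) \<kappa> \<kappa>'" for \<kappa>'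
    proof -
      have "\<kappa>' s 0 = \<kappa> s 0" using *(2) s by (auto simp: agree_def)
      moreover have "\<kappa>'(s := sfx 1 (\<kappa>' s)) = glue (\<lambda>s. []) (strip ((\<lambda>t. 0)(s := 1)) \<kappa>')"
        using * s by (intro cube_ext) (auto simp: cantor_cube_def PiE_def extensional_def brick_homeo_def strip_def)
      ultimately show ?thesis using i * by (simp add: simple_split_def)
    qed
    then show "\<exists>j \<psi>. \<psi> \<in> brick_addresses S \<and> (\<forall>\<kappa>'\<in>cube. agree ((\<lambda>t. 0)(s := 1)) \<kappa> \<kappa>' \<longrightarrow>
       simple_split S s (i, \<kappa>') = (j, glue \<psi> (strip ((\<lambda>t. 0)(s := 1)) \<kappa>')))"
      by (intro exI[of _ "if \<kappa> s 0 then 1 else 0"] exI[of _ "\<lambda>s. []"]) (auto simp: brick_addresses_def)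
  qed
  show "fin_depth ((\<lambda>t. 0)(s := 1))" by (simp add: fin_depth_def)
qed (use s in \<open>auto simp: simple_split_def\<close>)

text \<open>A finer cell lies in one coarser cell, and the extra letters are appended to the target
  address. Direct sums use this to give both summands one depth.\<close>

lemma canonical_below_refine:
  assumes a: "canonical_below m a f" and b: "fin_depth b" "\<And>s. s \<in> S \<Longrightarrow> a s \<le> b s"
  shows "canonical_below m b f"
  unfolding canonical_below_def
proof (intro allI impI ballI)
  fix i \<kappa> assume i: "i < m" "\<kappa> \<in> cube"
  then obtain j \<psi> where j: "\<psi> \<in> brick_addresses S"
    "\<And>\<kappa>'. \<kappa>' \<in> cube \<Longrightarrow> agree a \<kappa> \<kappa>' \<Longrightarrow> f (i, \<kappa>') = (j, glue \<psi> (strip a \<kappa>'))"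
    using a unfolding canonical_below_def by metis
  let ?v = "\<lambda>s. map (\<kappa> s) [a s..<b s]"
  show "\<exists>j \<psi>. \<psi> \<in> brick_addresses S \<and>
         (\<forall>\<kappa>'\<in>cube. agree b \<kappa> \<kappa>' \<longrightarrow> f (i, \<kappa>') = (j, glue \<psi> (strip b \<kappa>')))"
  proof (intro exI conjI ballI impI)
    have "?v \<in> brick_addresses S"
      unfolding fin_depth_length[symmetric] by (rule fin_depth_mono[OF b(1)]) simp
    then show "(\<lambda>s. \<psi> s @ ?v s) \<in> brick_addresses S" using j(1) by (rule address_append[rotated])
  next
    fix \<kappa>' assume *: "\<kappa>' \<in> cube" "agree b \<kappa> \<kappa>'"
    have "agree a \<kappa> \<kappa>'" by (rule agree_mono[OF *(2) b(2)])
    then have "f (i, \<kappa>') = (j, glue \<psi> (strip a \<kappa>'))" using j(2) * by simp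
    moreover have "strip a \<kappa>' = glue ?v (strip b \<kappa>')"
    proof (rule cube_ext)
      fix s assume s: "s \<in> S"
      show "strip a \<kappa>' s = glue ?v (strip b \<kappa>') s"
      proof
        fix n
        show "strip a \<kappa>' s n = glue ?v (strip b \<kappa>') s n"
        proof (cases "n < b s - a s")
          case True
          then have "a s + n < b s" by simp
          then show ?thesis using True s *(2) by (simp add: glue_apply strip_apply agree_def)
        next
          case False
          then have "b s + (n - (b s - a s)) = a s + n" using b(2)[OF s] by simp
          then show ?thesis using False s by (simp add: glue_apply strip_apply add.commute)
        qed
      qed
    qed simp_all
    ultimately show "f (i, \<kappa>') = (j, glue (\<lambda>s. \<psi> s @ ?v s) (strip b \<kappa>'))"
      by (simp add: glue_glue)
  qed
qed

lemma bt_sum_left: "i < m \<Longrightarrow> \<kappa> \<in> cube \<Longrightarrow> bt_sum S m n m' f f' (i, \<kappa>) = f (i, \<kappa>)"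
  by (simp add: bt_sum_def)

lemma bt_sum_right:
  "i < m' \<Longrightarrow> \<kappa> \<in> cube \<Longrightarrow> bt_sum S m n m' f f' (m + i, \<kappa>) = (n + fst (f' (i, \<kappa>)), snd (f' (i, \<kappa>)))"
  by (simp add: bt_sum_def Let_def)

lemma copies_add_cases:
  assumes "(i, \<kappa>) \<in> copies (m + m')"
  obtains "i < m" "\<kappa> \<in> cube" | i' where "i = m + i'" "i' < m'" "\<kappa> \<in> cube"
  using assms by (metis add_less_cancel_left copies_iff le_add_diff_inverse not_less)

lemma bt_sum_closed:
  assumes f: "f \<in> BT m n" and g: "g \<in> BT m' n'"
  shows "bt_sum S m n m' f g \<in> BT (m + m') (n + n')"
proof -
  obtain a where a: "fin_depth a" "canonical_below m a f" using brin_thompson_canonical[OF f] .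
  obtain b where b: "fin_depth b" "canonical_below m' b g" using brin_thompson_canonical[OF g] .
  let ?c = "\<lambda>s. a s + b s"
  have c: "fin_depth ?c" using a b fin_depth_add by simp
  have ac: "canonical_below m ?c f" and bc: "canonical_below m' ?c g"
    using canonical_below_refine[OF a(2) c] canonical_below_refine[OF b(2) c] by simp_all
  have "canonical_below (m + m') ?c (bt_sum S m n m' f g)"
    unfolding canonical_below_def
  proof (intro allI impI ballI)
    fix i \<kappa> assume i: "i < m + m'" "\<kappa> \<in> cube"
    then have "(i, \<kappa>) \<in> copies (m + m')" by simp
    then show "\<exists>j \<psi>. \<psi> \<in> brick_addresses S \<and> (\<forall>\<kappa>'\<in>cube. agree ?c \<kappa> \<kappa>' \<longrightarrow>
       bt_sum S m n m' f g (i, \<kappa>') = (j, glue \<psi> (strip ?c \<kappa>')))"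
    proof (cases rule: copies_add_cases)
      case 1
      then obtain j \<psi> where "\<psi> \<in> brick_addresses S"
        "\<forall>\<kappa>'\<in>cube. agree ?c \<kappa> \<kappa>' \<longrightarrow> f (i, \<kappa>') = (j, glue \<psi> (strip ?c \<kappa>'))"
        by (rule canonical_belowE[OF ac])
      then show ?thesis using 1 by (intro exI[of _ j] exI[of _ \<psi>]) (simp add: bt_sum_left)
    next
      case (2 i')
      from 2(2,3) obtain j \<psi> where "\<psi> \<in> brick_addresses S"
        "\<forall>\<kappa>'\<in>cube. agree ?c \<kappa> \<kappa>' \<longrightarrow> g (i', \<kappa>') = (j, glue \<psi> (strip ?c \<kappa>'))"
        by (rule canonical_belowE[OF bc])
      then show ?thesis using 2 by (intro exI[of _ "n + j"] exI[of _ \<psi>]) (simp add: bt_sum_right)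
    qed
  qed
  moreover have "bij_betw (bt_sum S m n m' f g) (copies (m + m')) (copies (n + n'))"
  proof -
    let ?R = "\<lambda>k q. (k + fst q, snd q)"
    have dec: "copies (k + k') = copies k \<union> ?R k ` copies k'" for k k'
    proof (rule equalityI; rule subsetI)
      fix p assume "p \<in> copies (k + k')"
      then have "(fst p, snd p) \<in> copies (k + k')" by simp
      then show "p \<in> copies k \<union> ?R k ` copies k'"
      proof (cases rule: copies_add_cases)
        case 1
        then show ?thesis by (cases p) simp
      next
        case (2 i')
        then show ?thesis by (cases p) (auto intro!: image_eqI[of _ _ "(i', snd p)"])
      qed
    qed auto
    have 1: "bij_betw (bt_sum S m n m' f g) (copies m) (copies n)"
      using brin_thompsonD(4)[OF f]
      by (rule bij_betw_cong[THEN iffD1, rotated]) (auto simp: bt_sum_left)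
    have R: "bij_betw (?R k) (copies k') (?R k ` copies k')" for k k'
      by (auto simp: bij_betw_def inj_on_def)
    have "bij_betw (?R n \<circ> g \<circ> inv_into (copies m') (?R m)) (?R m ` copies m') (?R n ` copies n')"
      by (intro bij_betw_trans[OF bij_betw_inv_into[OF R]] bij_betw_trans[OF brin_thompsonD(4)[OF g]] R)
    moreover have "(?R n \<circ> g \<circ> inv_into (copies m') (?R m)) p = bt_sum S m n m' f g p" if "p \<in> ?R m ` copies m'" for p
    proof -
      from that obtain q where q: "p = ?R m q" "q \<in> copies m'" by (rule imageE)
      then have "inv_into (copies m') (?R m) p = q" using inv_into_f_f[OF bij_betw_imp_inj_on[OF R[of m m']] q(2)] by simp
      moreover have "bt_sum S m n m' f g p = ?R n (g q)"
        using q by (cases q) (simp add: bt_sum_right split: prod.split)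
      ultimately show ?thesis by simp
    qed
    ultimately have 2: "bij_betw (bt_sum S m n m' f g) (?R m ` copies m') (?R n ` copies n')"
      by (simp cong: bij_betw_cong)
    show ?thesis unfolding dec by (rule bij_betw_combine[OF 1 2]) auto
  qed
  ultimately show ?thesis
    using brin_thompsonD[OF f] brin_thompsonD[OF g] c
    by (intro brin_thompsonI) (auto simp: bt_sum_def)
qed

end

section \<open>Forests of simple splits\<close>

context brick_system
begin

lemma copy_perm_apply [simp]: "i < n \<Longrightarrow> \<kappa> \<in> cube \<Longrightarrow> copy_perm S n \<sigma> (i, \<kappa>) = (\<sigma> i, \<kappa>)"
  by (simp add: copy_perm_def)

text \<open>Splitting the front copy is enough, because \<open>forest\<close> also permutes the
  copies. For \<open>n = 1\<close> the second summand is \<open>bt_id S 0\<close>, which is no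
  morphism; \<open>split0_one\<close> takes care of that case.\<close>

definition split0 :: "nat \<Rightarrow> 's \<Rightarrow> 's copies_point \<Rightarrow> 's copies_point" where
  "split0 n s = bt_sum S 1 2 (n - 1) (simple_split S s) (bt_id S (n - 1))"

lemma split0_scons:
  assumes "1 \<le> n" "s \<in> S" "\<kappa> \<in> cube"
  shows "split0 n s (0, scons s b \<kappa>) = (if b then 1 else 0, \<kappa>)"
  using assms by (simp add: split0_def bt_sum_def scons_cube simple_split_scons)

lemma split0_Suc: "Suc i < n \<Longrightarrow> \<kappa> \<in> cube \<Longrightarrow> split0 n s (Suc i, \<kappa>) = (Suc (Suc i), \<kappa>)"
  using bt_sum_right[of i "n - 1" \<kappa> 1 2 "simple_split S s" "bt_id S (n - 1)"] by (simp add: split0_def)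

lemma split0_one: "split0 1 s = simple_split S s"
  by (auto simp: split0_def bt_sum_def simple_split_def fun_eq_iff)

lemma bt_split0: "1 \<le> n \<Longrightarrow> s \<in> S \<Longrightarrow> split0 n s \<in> BT n (Suc n)"
proof (cases "n = 1")
  case True
  assume "s \<in> S"
  then show ?thesis using True bt_split split0_one by (simp add: numeral_2_eq_2)
next
  case False
  assume "1 \<le> n" "s \<in> S"
  then show ?thesis
    using False bt_sum_closed[OF bt_split bt_id_closed, of s "n - 1"] by (simp add: split0_def)
qed

text \<open>Unlike multicolored forests, these may permute the copies. The order of the leaves thus
  never matters, and each step is a move across which labels can be pushed by the defining
  relations.\<close>

inductive forest :: "nat \<Rightarrow> nat \<Rightarrow> ('s copies_point \<Rightarrow> 's copies_point) \<Rightarrow> bool" where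
  forest_id: "1 \<le> m \<Longrightarrow> forest m m (bt_id S m)"
| forest_perm: "forest m n f \<Longrightarrow> \<sigma> permutes {..<n} \<Longrightarrow>
    forest m n (compose (copies m) (copy_perm S n \<sigma>) f)"
| forest_split: "forest m n f \<Longrightarrow> s \<in> S \<Longrightarrow> forest m (Suc n) (compose (copies m) (split0 n s) f)"

lemma forest_BT: "forest m n f \<Longrightarrow> f \<in> BT m n"
proof (induction rule: forest.induct)
  case (forest_id m)
  then show ?case by (rule bt_id_closed)
next
  case (forest_perm m n f \<sigma>)
  then show ?case using brin_thompson_compose bt_perm brin_thompsonD(3) by blast
next
  case (forest_split m n f s)
  then show ?case using brin_thompson_compose bt_split0 brin_thompsonD(3) by blast
qed

lemma compose_BT_assoc:
  assumes "f \<in> BT m n"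
  shows "compose (copies m) (compose (copies n) h g) f = compose (copies m) h (compose (copies m) g f)"
  using brin_thompson_closed[OF assms] by (auto simp: compose_def fun_eq_iff)

lemma compose_BT_id: "f \<in> BT m n \<Longrightarrow> compose (copies m) (bt_id S n) f = f"
  using brin_thompson_closed[of f m n] brin_thompsonD(1)[of f m n]
  by (auto simp: compose_def fun_eq_iff extensional_def)

lemma forest_compose: "forest n q g \<Longrightarrow> forest m n f \<Longrightarrow> forest m q (compose (copies m) g f)"
proof (induction rule: forest.induct)
  case (forest_id m)
  then show ?case using compose_BT_id forest_BT by metis
next
  case (forest_perm n q g \<sigma>)
  then show ?case using forest.forest_perm compose_BT_assoc forest_BT by metis
next
  case (forest_split n q g s)
  then show ?case using forest.forest_split compose_BT_assoc forest_BT by metis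
qed

lemma copy_perm_compose:
  assumes "\<tau> permutes {..<n}"
  shows "compose (copies n) (copy_perm S n \<sigma>) (copy_perm S n \<tau>) = copy_perm S n (\<sigma> \<circ> \<tau>)"
  using permutes_in_image[OF assms] by (auto simp: copy_perm_def compose_def fun_eq_iff)

text \<open>Successive permutations merge into one, and the identity is inserted where none follows
  the last split. So that split can be peeled off, as the induction in \<open>\<theta>_trees\<close>
  requires.\<close>

lemma tree_cases:
  assumes "forest m n f" "m = 1"
  shows "n = 1 \<and> f = bt_id S 1 \<or> (\<exists>n' \<sigma> s f'. n = Suc n' \<and> 1 \<le> n' \<and> \<sigma> permutes {..<n} \<and> s \<in> S \<and> forest 1 n' f' \<and>
           f = compose (copies 1) (copy_perm S n \<sigma>) (compose (copies 1) (split0 n' s) f'))"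
  using assms
proof (induction rule: forest.induct)
  case (forest_id m)
  then show ?case by simp
next
  case (forest_perm m n f \<sigma>)
  from forest_perm.IH[OF forest_perm.prems] show ?case
  proof (elim disjE exE conjE)
    assume n: "n = 1" "f = bt_id S 1"
    then have "\<sigma> = id" using forest_perm.hyps(2) by (simp add: lessThan_Suc permutes_sing)
    then show ?thesis using n forest_perm.prems bt_id_closed[of 1] compose_BT_id[of "bt_id S 1" 1 1]
      by (simp add: bt_id_perm)
  next
    fix n' \<tau> s f'
    assume n: "n = Suc n'" "1 \<le> n'" "\<tau> permutes {..<n}" "s \<in> S" "forest 1 n' f'"
      "f = compose (copies 1) (copy_perm S n \<tau>) (compose (copies 1) (split0 n' s) f')"
    have "compose (copies 1) (split0 n' s) f' \<in> BT 1 n"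
      using n brin_thompson_compose bt_split0 forest_BT by metis
    then have "compose (copies m) (copy_perm S n \<sigma>) f =
        compose (copies 1) (copy_perm S n (\<sigma> \<circ> \<tau>)) (compose (copies 1) (split0 n' s) f')"
      using compose_BT_assoc copy_perm_compose[OF n(3)] n(6) forest_perm.prems by metis
    moreover have "(\<sigma> \<circ> \<tau>) permutes {..<n}" using n(3) forest_perm.hyps(2) by (rule permutes_compose)
    ultimately show ?thesis using n by metis
  qed
next
  case (forest_split m n f s)
  have 1: "1 \<le> n" using brin_thompsonD(3)[OF forest_BT[OF forest_split.hyps(1)]] .
  have "compose (copies 1) (split0 n s) f \<in> BT 1 (Suc n)"
    using forest_split 1 brin_thompson_compose bt_split0 forest_BT by metis
  then have "compose (copies 1) (copy_perm S (Suc n) id) (compose (copies 1) (split0 n s) f) =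
      compose (copies 1) (split0 n s) f"
    using compose_BT_id by (metis bt_id_perm)
  then show ?case using forest_split 1 permutes_id by metis
qed

text \<open>Copy \<open>k\<close> is cut uniformly to its own depth \<open>a k\<close>: for a
  bijection \<open>W\<close>, the pieces in copy \<open>k\<close> are exactly the cells of that
  depth.\<close>

definition shape :: "nat \<Rightarrow> nat \<Rightarrow> (nat \<Rightarrow> 's \<Rightarrow> nat) \<Rightarrow> ('s copies_point \<Rightarrow> 's copies_point) \<Rightarrow> bool" where
  "shape r q a W \<longleftrightarrow> (\<forall>p<q. \<exists>k<r. \<exists>\<psi>. (\<forall>s\<in>S. length (\<psi> s) = a k s) \<and>
     (\<forall>\<kappa>\<in>cube. W (k, glue \<psi> \<kappa>) = (p, \<kappa>)))"

definition depth :: "('s \<Rightarrow> nat) \<Rightarrow> nat" where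
  "depth a = (\<Sum>s | s \<in> S \<and> a s \<noteq> 0. a s)"

lemma depth_decr:
  assumes b: "fin_depth b" and s: "s \<in> S" "0 < b s"
  shows "depth b = Suc (depth (b(s := b s - 1)))"
proof -
  let ?A = "{s \<in> S. b s \<noteq> 0}"
  have A: "finite ?A" using b by (simp add: fin_depth_def)
  have "depth (b(s := b s - 1)) = sum (b(s := b s - 1)) ?A"
    unfolding depth_def using A s by (intro sum.mono_neutral_left) (auto split: if_splits)
  also have "\<dots> = (b s - 1) + sum (b(s := b s - 1)) (?A - {s})"
    using A s by (subst sum.remove[of _ s]) auto
  also have "sum (b(s := b s - 1)) (?A - {s}) = sum b (?A - {s})" by (rule sum.cong) auto
  finally show ?thesis
    unfolding depth_def using A s by (subst sum.remove[of _ s]) auto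
qed

lemma glue_scons:
  "s \<in> S \<Longrightarrow> \<kappa> \<in> cube \<Longrightarrow> glue (\<psi>(s := b # \<psi> s)) \<kappa> = scons s b (glue \<psi> \<kappa>)"
  by (auto simp: brick_homeo_def scons_def fun_eq_iff)

lemma glue_Nil: "\<kappa> \<in> cube \<Longrightarrow> glue (\<lambda>s. []) \<kappa> = \<kappa>"
  by (rule cube_ext) (simp_all add: glue_apply)

text \<open>Splitting a copy of total depth \<open>d\<close> leaves two of depth
  \<open>d - 1\<close>. The measure uses powers of 3 because \<open>2 * 3 ^ (d - 1) < 3 ^ d\<close>;
  with base 2 it would not decrease.\<close>

lemma forest_of_shape:
  assumes "1 \<le> r" "\<And>k. k < r \<Longrightarrow> fin_depth (a k)"
  shows "\<exists>q W. forest r q W \<and> shape r q a W"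
  using assms
proof (induction "\<Sum>k<r. 3 ^ depth (a k) :: nat" arbitrary: r a rule: less_induct)
  case less
  show ?case
  proof (cases "\<exists>k<r. \<exists>s\<in>S. a k s \<noteq> 0")
    case False
    have "shape r r a (bt_id S r)"
      unfolding shape_def
    proof (intro allI impI)
      fix p assume p: "p < r"
      show "\<exists>k<r. \<exists>\<psi>. (\<forall>s\<in>S. length (\<psi> s) = a k s) \<and> (\<forall>\<kappa>\<in>cube. bt_id S r (k, glue \<psi> \<kappa>) = (p, \<kappa>))"
        using False p by (intro exI[of _ p] exI[of _ "\<lambda>s. []"] conjI) (simp_all add: glue_Nil)
    qed
    then show ?thesis using forest_id[OF less.prems(1)] by blast
  next
    case True
    then obtain k s where k: "k < r" "s \<in> S" "0 < a k s" by auto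
    \<comment> \<open>Brings the copy to be split to the front, where \<open>split0\<close>
      acts.\<close>
    define \<tau> where "\<tau> = Transposition.transpose 0 k"
    have \<tau>: "\<tau> permutes {..<r}" unfolding \<tau>_def using k by (intro permutes_swap_id) auto
    have \<tau>\<tau>: "\<tau> (\<tau> j) = j" "\<tau> 0 = k" "\<tau> k = 0" for j by (simp_all add: \<tau>_def)
    have \<tau>lt: "\<tau> j < r \<longleftrightarrow> j < r" for j using permutes_in_image[OF \<tau>, of j] by simp
    define b where "b = a \<circ> \<tau>"
    \<comment> \<open>After the split, copies 0 and 1 are the halves of the old copy 0 and need one
      letter less at \<open>s\<close>; copy \<open>j > 1\<close> is the old copy
      \<open>j - 1\<close>.\<close>
    define a' where "a' = (\<lambda>j. if j \<le> 1 then (b 0)(s := b 0 s - 1) else b (j - 1))"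
    have fb: "fin_depth (b j)" if "j < r" for j using less.prems(2) \<tau>lt that by (simp add: b_def)
    have fa': "fin_depth (a' j)" if "j < Suc r" for j
    proof (cases "j \<le> 1")
      case True
      have "fin_depth (b 0)" using fb k(1) by simp
      then have "fin_depth ((b 0)(s := b 0 s - 1))" by (rule fin_depth_mono) auto
      then show ?thesis using True by (simp add: a'_def)
    qed (use fb that in \<open>simp add: a'_def\<close>)
    obtain r' where r': "r = Suc r'" using k(1) by (cases r) auto
    have "(\<Sum>j<r. 3 ^ depth (a j) :: nat) = (\<Sum>j<r. 3 ^ depth (b j))"
      unfolding b_def using sum.permute[OF \<tau>, of "\<lambda>j. 3 ^ depth (a j)"] by (simp add: comp_def)
    also have "\<dots> = 3 ^ depth (b 0) + (\<Sum>j<r'. 3 ^ depth (b (Suc j)))"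
      unfolding r' by (rule sum.lessThan_Suc_shift)
    finally have 1: "(\<Sum>j<r. 3 ^ depth (a j) :: nat) = 3 ^ depth (b 0) + (\<Sum>j<r'. 3 ^ depth (b (Suc j)))" .
    have "(\<Sum>j<Suc r. 3 ^ depth (a' j) :: nat) = 2 * 3 ^ depth ((b 0)(s := b 0 s - 1)) + (\<Sum>j<r'. 3 ^ depth (b (Suc j)))"
      unfolding r' by (simp add: sum.lessThan_Suc_shift a'_def del: sum.lessThan_Suc)
    moreover have "depth (b 0) = Suc (depth ((b 0)(s := b 0 s - 1)))"
      using k fb[of 0] by (intro depth_decr) (auto simp: b_def \<tau>\<tau>)
    ultimately have "(\<Sum>j<Suc r. 3 ^ depth (a' j) :: nat) < (\<Sum>j<r. 3 ^ depth (a j))"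
      using 1 by simp
    then obtain q W' where W': "forest (Suc r) q W'" "shape (Suc r) q a' W'"
      using less.hyps[of a' "Suc r"] fa' by auto
    define W where "W = compose (copies r) W' (compose (copies r) (split0 r s) (copy_perm S r \<tau>))"
    have P: "compose (copies r) (copy_perm S r \<tau>) (bt_id S r) = copy_perm S r \<tau>"
      by (auto simp: compose_def copy_perm_def fun_eq_iff)
    have "forest r q W"
      unfolding W_def
      using forest_compose[OF W'(1) forest_split[OF forest_perm[OF forest_id[OF less.prems(1)] \<tau>] k(2)]] P
      by simp
    moreover have "shape r q a W"
      unfolding shape_def
    proof (intro allI impI)
      fix p assume "p < q"
      then obtain k' \<psi> where k': "k' < Suc r" and \<psi>: "\<And>t. t \<in> S \<Longrightarrow> length (\<psi> t) = a' k' t"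
        and Wp: "\<And>\<kappa>. \<kappa> \<in> cube \<Longrightarrow> W' (k', glue \<psi> \<kappa>) = (p, \<kappa>)"
        using W'(2) unfolding shape_def by blast
      show "\<exists>k<r. \<exists>\<psi>. (\<forall>s\<in>S. length (\<psi> s) = a k s) \<and> (\<forall>\<kappa>\<in>cube. W (k, glue \<psi> \<kappa>) = (p, \<kappa>))"
      proof (cases "k' \<le> 1")
        case True
        let ?\<psi> = "\<psi>(s := (k' = 1) # \<psi> s)"
        have "W (k, glue ?\<psi> \<kappa>) = (p, \<kappa>)" if c: "\<kappa> \<in> cube" for \<kappa>
        proof -
          have "copy_perm S r \<tau> (k, glue ?\<psi> \<kappa>) = (0, scons s (k' = 1) (glue \<psi> \<kappa>))"
            using k c by (simp add: \<tau>\<tau> glue_scons scons_cube)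
          moreover have "split0 r s (0, scons s (k' = 1) (glue \<psi> \<kappa>)) = (k', glue \<psi> \<kappa>)"
            using split0_scons[OF less.prems(1) k(2) glue_in_cube] True by auto
          ultimately show ?thesis using Wp[OF c] k c by (simp add: W_def compose_def glue_scons scons_cube)
        qed
        moreover have "length (?\<psi> t) = a k t" if "t \<in> S" for t
          using \<psi>[OF that] True k by (auto simp: a'_def b_def \<tau>\<tau>)
        ultimately show ?thesis using k(1) by blast
      next
        case False
        then obtain j where j: "k' = Suc (Suc j)" by (metis One_nat_def not_less_eq_eq old.nat.exhaust zero_le)
        have jr: "Suc j < r" using k' j by simp
        have "W (\<tau> (Suc j), glue \<psi> \<kappa>) = (p, \<kappa>)" if c: "\<kappa> \<in> cube" for \<kappa>
          using Wp[OF c] jr j by (simp add: W_def compose_def \<tau>lt \<tau>\<tau> split0_Suc)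
        moreover have "length (\<psi> t) = a (\<tau> (Suc j)) t" if "t \<in> S" for t
          using \<psi>[OF that] j by (simp add: a'_def b_def)
        ultimately show ?thesis using jr \<tau>lt by blast
      qed
    qed
    ultimately show ?thesis by blast
  qed
qed

lemma conc_eq_append:
  "u \<frown> x = v \<frown> y \<Longrightarrow> length v \<le> length u \<Longrightarrow> u = v @ drop (length v) u"
proof -
  assume eq: "u \<frown> x = v \<frown> y" and le: "length v \<le> length u"
  have "u ! i = v ! i" if "i < length v" for i
    using fun_cong[OF eq, of i] that le by simp
  then have "take (length v) u = v" using le by (intro nth_equalityI) auto
  then show ?thesis by (metis append_take_drop_id)
qed

text \<open>Bricks of equal depth that meet are equal, so both maps cut each copy into the same
  bricks with the same coordinates; only the numbering of the pieces can differ.\<close>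

lemma shape_unique:
  assumes W: "bij_betw W (copies r) (copies q)" "shape r q a W"
    and W': "bij_betw W' (copies r) (copies q')" "shape r q' a W'"
  shows "q = q' \<and> (\<exists>\<sigma>. \<sigma> permutes {..<q} \<and> (\<forall>x\<in>copies r. W x = copy_perm S q \<sigma> (W' x)))"
proof -
  define \<kappa>0 where "\<kappa>0 = (\<lambda>s\<in>S. undefined :: bool word)"
  have \<kappa>0: "\<kappa>0 \<in> cube" unfolding \<kappa>0_def by (rule cube_nonempty)
  have inj: "W x = W y \<Longrightarrow> x \<in> copies r \<Longrightarrow> y \<in> copies r \<Longrightarrow> x = y"
    and inj': "W' x = W' y \<Longrightarrow> x \<in> copies r \<Longrightarrow> y \<in> copies r \<Longrightarrow> x = y" for x y
    using W(1) W'(1) by (auto simp: bij_betw_def inj_on_def)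
  have "\<exists>p<q. \<forall>\<kappa>. \<forall>x\<in>copies r. W' x = (p', \<kappa>) \<longrightarrow> W x = (p, \<kappa>)" if p': "p' < q'" for p'
  proof -
    obtain k \<psi> where k: "k < r" "\<And>s. s \<in> S \<Longrightarrow> length (\<psi> s) = a k s"
      "\<And>\<kappa>. \<kappa> \<in> cube \<Longrightarrow> W' (k, glue \<psi> \<kappa>) = (p', \<kappa>)"
      using W'(2) p' unfolding shape_def by blast
    obtain p \<kappa>1 where p: "W (k, glue \<psi> \<kappa>0) = (p, \<kappa>1)" by (cases "W (k, glue \<psi> \<kappa>0)")
    have "(p, \<kappa>1) \<in> copies q" using bij_betwE[OF W(1)] k(1) p by (metis copies_iff glue_in_cube)
    then have pq: "p < q" "\<kappa>1 \<in> cube" by simp_all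
    then obtain k2 \<psi>2 where k2: "k2 < r" "\<And>s. s \<in> S \<Longrightarrow> length (\<psi>2 s) = a k2 s"
      "\<And>\<kappa>. \<kappa> \<in> cube \<Longrightarrow> W (k2, glue \<psi>2 \<kappa>) = (p, \<kappa>)"
      using W(2) unfolding shape_def by blast
    have "(k2, glue \<psi>2 \<kappa>1) = (k, glue \<psi> \<kappa>0)"
      by (rule inj) (use p k2 k pq in auto)
    then have eq: "k2 = k" "glue \<psi>2 \<kappa>1 = glue \<psi> \<kappa>0" by auto
    have "\<psi>2 s = \<psi> s" if "s \<in> S" for s
    proof -
      have "\<psi>2 s \<frown> \<kappa>1 s = \<psi> s \<frown> \<kappa>0 s" using fun_cong[OF eq(2), of s] that by (simp add: glue_apply)
      moreover have "length (\<psi>2 s) = length (\<psi> s)" using k(2) k2(2) eq(1) that by simp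
      ultimately show ?thesis using conc_eq_append by fastforce
    qed
    then have "glue \<psi>2 \<kappa> = glue \<psi> \<kappa>" for \<kappa> by (auto simp: brick_homeo_def)
    then have Wk: "W (k, glue \<psi> \<kappa>) = (p, \<kappa>)" if "\<kappa> \<in> cube" for \<kappa> using k2(3)[OF that] eq by simp
    have "W x = (p, \<kappa>)" if x: "x \<in> copies r" "W' x = (p', \<kappa>)" for x \<kappa>
    proof -
      have "(p', \<kappa>) \<in> copies q'" using bij_betwE[OF W'(1)] x by metis
      then have c: "\<kappa> \<in> cube" by simp
      then have "x = (k, glue \<psi> \<kappa>)" using inj'[of x "(k, glue \<psi> \<kappa>)"] x k by simp
      then show ?thesis using Wk[OF c] by simp
    qed
    then show ?thesis using pq by blast
  qed
  then obtain \<sigma> where \<sigma>: "\<And>p'. p' < q' \<Longrightarrow> \<sigma> p' < q"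
    "\<And>p' \<kappa> x. p' < q' \<Longrightarrow> x \<in> copies r \<Longrightarrow> W' x = (p', \<kappa>) \<Longrightarrow> W x = (\<sigma> p', \<kappa>)"
    by metis
  have surj': "\<exists>x\<in>copies r. W' x = (p, \<kappa>0)" if "p < q'" for p
    using W'(1) that \<kappa>0 by (metis bij_betw_imp_surj_on copies_iff imageE)
  have "inj_on \<sigma> {..<q'}"
  proof (rule inj_onI)
    fix p1 p2 assume "p1 \<in> {..<q'}" "p2 \<in> {..<q'}" "\<sigma> p1 = \<sigma> p2"
    moreover then obtain x1 x2 where "x1 \<in> copies r" "W' x1 = (p1, \<kappa>0)" "x2 \<in> copies r" "W' x2 = (p2, \<kappa>0)"
      using surj' by (metis lessThan_iff)
    ultimately show "p1 = p2" using \<sigma>(2) inj by (metis fst_conv lessThan_iff)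
  qed
  moreover have "\<sigma> ` {..<q'} = {..<q}"
  proof (rule equalityI; rule subsetI)
    fix p assume "p \<in> {..<q}"
    then obtain x where x: "x \<in> copies r" "W x = (p, \<kappa>0)"
      using W(1) \<kappa>0 by (metis bij_betw_imp_surj_on copies_iff imageE lessThan_iff)
    obtain p' \<kappa> where p': "W' x = (p', \<kappa>)" by (cases "W' x")
    have "(p', \<kappa>) \<in> copies q'" using bij_betwE[OF W'(1)] x p' by metis
    then have "p' < q'" by simp
    moreover have "\<sigma> p' = p" using \<sigma>(2)[OF _ x(1) p'] calculation x(2) by simp
    ultimately show "p \<in> \<sigma> ` {..<q'}" by blast
  qed (use \<sigma>(1) in auto)
  ultimately have bij: "bij_betw \<sigma> {..<q'} {..<q}" by (simp add: bij_betw_def)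
  then have q: "q = q'" using bij_betw_same_card by fastforce
  define \<sigma>' where "\<sigma>' = (\<lambda>i. if i < q then \<sigma> i else i)"
  have "bij_betw \<sigma>' {..<q} {..<q} = bij_betw \<sigma> {..<q} {..<q}"
    by (rule bij_betw_cong) (simp add: \<sigma>'_def)
  then have "bij_betw \<sigma>' {..<q} {..<q}" using bij q by simp
  then have "\<sigma>' permutes {..<q}" by (rule bij_imp_permutes) (simp add: \<sigma>'_def)
  moreover have "W x = copy_perm S q \<sigma>' (W' x)" if x: "x \<in> copies r" for x
  proof -
    obtain p' \<kappa> where p': "W' x = (p', \<kappa>)" by (cases "W' x")
    have "(p', \<kappa>) \<in> copies q'" using bij_betwE[OF W'(1)] x p' by metis
    then show ?thesis using \<sigma>(2)[OF _ x p'] p' q by (simp add: \<sigma>'_def)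
  qed
  ultimately show ?thesis using q by blast
qed

text \<open>By \<open>forest_of_shape\<close> some forest has the same shape, \<open>W\<close>
  differs from it by a permutation of the pieces, and forests absorb permutations.\<close>

lemma shape_forest:
  assumes W: "W \<in> BT r q" "shape r q a W" and a: "\<And>k. k < r \<Longrightarrow> fin_depth (a k)"
  shows "forest r q W"
proof -
  obtain q' W' where W': "forest r q' W'" "shape r q' a W'"
    using forest_of_shape[of r a] brin_thompsonD(2)[OF W(1)] a by blast
  from shape_unique[OF brin_thompsonD(4)[OF W(1)] W(2) brin_thompsonD(4)[OF forest_BT[OF W'(1)]] W'(2)]
  obtain \<sigma> where q: "q = q'" and \<sigma>: "\<sigma> permutes {..<q}" "\<And>x. x \<in> copies r \<Longrightarrow> W x = copy_perm S q \<sigma> (W' x)"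
    by blast
  have F: "forest r q (compose (copies r) (copy_perm S q \<sigma>) W')"
    using forest_perm[OF W'(1)] \<sigma>(1) q by simp
  moreover have "W = compose (copies r) (copy_perm S q \<sigma>) W'"
    by (rule bt_ext[OF W(1) forest_BT[OF F]]) (simp add: \<sigma>(2) compose_def)
  ultimately show ?thesis by simp
qed

text \<open>The given partitions may not come from forests, so both sides are cut uniformly: the
  domain by \<open>T\<close> to a depth where \<open>f\<close> is canonical, the range by
  \<open>U\<close> to a depth beyond all image bricks. Then \<open>U f T^-1\<close> cuts each image
  brick uniformly and is itself a forest, so that \<open>A\<close> is this forest after
  \<open>T\<close>, and \<open>B\<close> is \<open>U\<close>.\<close>

theorem brin_thompson_forests:
  assumes f: "f \<in> BT m n"
  obtains q A B where "forest m q A" "forest n q B" "\<And>p. p \<in> copies m \<Longrightarrow> B (f p) = A p"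
proof -
  obtain a where a: "fin_depth a" "canonical_below m a f" using brin_thompson_canonical[OF f] .
  define \<kappa>0 where "\<kappa>0 = (\<lambda>s\<in>S. undefined :: bool word)"
  have \<kappa>0: "\<kappa>0 \<in> cube" unfolding \<kappa>0_def by (rule cube_nonempty)
  obtain r T where T: "forest m r T" "shape m r (\<lambda>_. a) T"
    using forest_of_shape[OF brin_thompsonD(2)[OF f], of "\<lambda>_. a"] a(1) by blast
  note TB = forest_BT[OF T(1)]
  have "\<exists>\<phi> j. \<phi> \<in> brick_addresses S \<and> j < n \<and>
      (\<forall>\<kappa>. \<forall>x\<in>copies m. T x = (k, \<kappa>) \<longrightarrow> f x = (j, glue \<phi> \<kappa>))" if k: "k < r" for k
  proof -
    obtain i \<psi> where i: "i < m" "\<And>s. s \<in> S \<Longrightarrow> length (\<psi> s) = a s"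
      "\<And>\<kappa>. \<kappa> \<in> cube \<Longrightarrow> T (i, glue \<psi> \<kappa>) = (k, \<kappa>)"
      using T(2) k unfolding shape_def by blast
    obtain \<phi> j where \<phi>: "\<phi> \<in> brick_addresses S"
      "\<forall>\<kappa>'\<in>cube. agree a (glue \<psi> \<kappa>0) \<kappa>' \<longrightarrow> f (i, \<kappa>') = (j, glue \<phi> (strip a \<kappa>'))"
      by (rule canonical_belowE[OF a(2) i(1) glue_in_cube])
    have fg: "f (i, glue \<psi> \<kappa>) = (j, glue \<phi> \<kappa>)" if "\<kappa> \<in> cube" for \<kappa>
      using \<phi>(2) agree_glue[of \<psi> a \<kappa>0 \<kappa>] strip_glue[OF that, of \<psi> a] i(2) by simp
    have "f x = (j, glue \<phi> \<kappa>)" if x: "x \<in> copies m" "T x = (k, \<kappa>)" for x \<kappa>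
    proof -
      have c: "\<kappa> \<in> cube" using brin_thompson_closed[OF TB x(1)] x(2) by simp
      then have "x = (i, glue \<psi> \<kappa>)" using bt_inj[OF TB x(1), of "(i, glue \<psi> \<kappa>)"] x(2) i by simp
      then show ?thesis using fg[OF c] by simp
    qed
    moreover have "j < n" using brin_thompson_closed[OF f, of "(i, glue \<psi> \<kappa>0)"] fg[OF \<kappa>0] i(1) by simp
    ultimately show ?thesis using \<phi>(1) by blast
  qed
  then obtain \<phi> j where \<phi>: "\<And>k. k < r \<Longrightarrow> \<phi> k \<in> brick_addresses S" "\<And>k. k < r \<Longrightarrow> j k < n"
    "\<And>k \<kappa> x. k < r \<Longrightarrow> x \<in> copies m \<Longrightarrow> T x = (k, \<kappa>) \<Longrightarrow> f x = (j k, glue (\<phi> k) \<kappa>)"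
    by metis
  define b where "b = (\<lambda>s. \<Sum>k<r. length (\<phi> k s))"
  have b: "fin_depth b" unfolding b_def using \<phi>(1) by (intro fin_depth_sum) (auto simp: fin_depth_length)
  have ble: "length (\<phi> k s) \<le> b s" if "k < r" for k s
    unfolding b_def using that by (intro member_le_sum) auto
  obtain q U where U: "forest n q U" "shape n q (\<lambda>_. b) U"
    using forest_of_shape[OF brin_thompsonD(3)[OF f], of "\<lambda>_. b"] b by blast
  define W where "W = compose (copies r) (compose (copies m) U f) (bt_inv m T r)"
  have WB: "W \<in> BT r q"
    unfolding W_def
    by (intro brin_thompson_compose[OF bt_inv_closed[OF TB]] brin_thompson_compose[OF f] forest_BT U)
  have WT: "W (T x) = U (f x)" if "x \<in> copies m" for x
    using that brin_thompson_closed[OF TB that] by (simp add: W_def compose_def bt_inv_left[OF TB])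
  \<comment> \<open>Leaf \<open>k\<close> of \<open>T\<close> goes to the brick with address
    \<open>\<phi> k\<close>, which already has depth \<open>length (\<phi> k s)\<close> at
    \<open>s\<close>; \<open>U\<close> cuts it by the remaining difference.\<close>
  have "shape r q (\<lambda>k s. b s - length (\<phi> k s)) W"
    unfolding shape_def
  proof (intro allI impI)
    fix p assume "p < q"
    then obtain j' \<psi> where j': "j' < n" "\<And>s. s \<in> S \<Longrightarrow> length (\<psi> s) = b s"
      "\<And>\<kappa>. \<kappa> \<in> cube \<Longrightarrow> U (j', glue \<psi> \<kappa>) = (p, \<kappa>)"
      using U(2) unfolding shape_def by blast
    define x0 where "x0 = bt_inv m f n (j', glue \<psi> \<kappa>0)"
    have x0: "x0 \<in> copies m" "f x0 = (j', glue \<psi> \<kappa>0)"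
      using brin_thompson_closed[OF bt_inv_closed[OF f]] bt_inv_right[OF f] j'(1) by (auto simp: x0_def)
    obtain k \<kappa>1 where k: "T x0 = (k, \<kappa>1)" by (cases "T x0")
    have kr: "k < r" "\<kappa>1 \<in> cube" using brin_thompson_closed[OF TB x0(1)] k by simp_all
    have "f x0 = (j k, glue (\<phi> k) \<kappa>1)" by (rule \<phi>(3)[OF kr(1) x0(1) k])
    then have eq: "j' = j k" "glue \<psi> \<kappa>0 = glue (\<phi> k) \<kappa>1" using x0(2) by auto
    let ?\<chi> = "\<lambda>s. drop (length (\<phi> k s)) (\<psi> s)"
    have "\<psi> s = \<phi> k s @ ?\<chi> s" if s: "s \<in> S" for s
    proof (rule conc_eq_append)
      show "\<psi> s \<frown> \<kappa>0 s = \<phi> k s \<frown> \<kappa>1 s" using fun_cong[OF eq(2), of s] s by (simp add: glue_apply)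
      show "length (\<phi> k s) \<le> length (\<psi> s)" using ble[OF kr(1)] j'(2)[OF s] by simp
    qed
    then have gl: "glue (\<phi> k) (glue ?\<chi> \<kappa>) = glue \<psi> \<kappa>" for \<kappa>
      unfolding glue_glue by (auto simp: brick_homeo_def fun_eq_iff)
    have "W (k, glue ?\<chi> \<kappa>) = (p, \<kappa>)" if c: "\<kappa> \<in> cube" for \<kappa>
    proof -
      define x where "x = bt_inv m T r (k, glue ?\<chi> \<kappa>)"
      have x: "x \<in> copies m" "T x = (k, glue ?\<chi> \<kappa>)"
        using brin_thompson_closed[OF bt_inv_closed[OF TB]] bt_inv_right[OF TB] kr(1) by (auto simp: x_def)
      have "f x = (j', glue \<psi> \<kappa>)" using \<phi>(3)[OF kr(1) x] eq(1) gl by simp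
      then show ?thesis using WT[OF x(1)] x(2) j'(3)[OF c] by simp
    qed
    moreover have "length (?\<chi> s) = b s - length (\<phi> k s)" if "s \<in> S" for s using j'(2)[OF that] by simp
    ultimately show "\<exists>k<r. \<exists>\<psi>. (\<forall>s\<in>S. length (\<psi> s) = b s - length (\<phi> k s)) \<and>
        (\<forall>\<kappa>\<in>cube. W (k, glue \<psi> \<kappa>) = (p, \<kappa>))"
      using kr(1) by (intro exI[of _ k] exI[of _ ?\<chi>] conjI) auto
  qed
  then have "forest r q W"
    by (rule shape_forest[OF WB]) (rule fin_depth_mono[OF b], simp)
  then have "forest m q (compose (copies m) W T)" using forest_compose T(1) by blast
  moreover have "U (f p) = compose (copies m) W T p" if "p \<in> copies m" for p
    using WT[OF that] that by (simp add: compose_def)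
  ultimately show thesis using that U(1) by blast
qed

end

section \<open>Interpretation of formal expressions\<close>

locale twisted = group_action G S \<phi> + brick_system S
  for G :: "('g, 'm) monoid_scheme" (structure) and S :: "'s set" and \<phi> :: "'g \<Rightarrow> 's \<Rightarrow> 's" +
  assumes S_nonempty: "S \<noteq> {}"
begin

sublocale group G
  using group_hom group_hom.axioms(1) by blast

section \<open>Typing of expressions and their action on points\<close>

abbreviation mor :: "('g, 's) sv_term \<Rightarrow> nat \<Rightarrow> nat \<Rightarrow> bool" where
  "mor \<equiv> sv_morphism G S"

abbreviation equ :: "('g, 's) sv_term \<Rightarrow> ('g, 's) sv_term \<Rightarrow> bool" (infix "\<approx>" 50) where
  "t \<approx> u \<equiv> sv_eq G S \<phi> t u"

abbreviation cls :: "('g, 's) sv_term \<Rightarrow> ('g, 's) sv_term set" where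
  "cls \<equiv> sv_class G S \<phi>"

inductive_cases mor_BrickE: "mor (Brick m n f) m' n'"
inductive_cases mor_LabelE: "mor (Label gs) m' n'"
inductive_cases mor_CompE: "mor (Comp t u) m' n'"
inductive_cases mor_SumE: "mor (Sum t u) m' n'"

lemma mor_unique: "mor t m n \<Longrightarrow> mor t m' n' \<Longrightarrow> m = m' \<and> n = n'"
proof (induction arbitrary: m' n' rule: sv_morphism.induct)
  case (brick f m n)
  then show ?case by (auto elim: mor_BrickE)
next
  case (label gs)
  then show ?case by (auto elim: mor_LabelE)
next
  case (comp t n p u m)
  from comp.prems show ?case by (rule mor_CompE) (use comp.IH in blast)
next
  case (sum t m n t' m' n')
  from sum.prems show ?case by (rule mor_SumE) (use sum.IH in blast)
qed

lemma mor_pos: "mor t m n \<Longrightarrow> 1 \<le> m \<and> 1 \<le> n"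
  by (induction rule: sv_morphism.induct) (auto simp: Suc_le_eq dest: brin_thompsonD)

text \<open>On a direct sum, \<open>interp\<close> must know where the first summand ends. The
  objects are therefore computed from the expression; \<open>mor_src_tgt\<close> shows that they
  agree with its type.\<close>

primrec src :: "('g, 's) sv_term \<Rightarrow> nat" where
  "src (Brick m n f) = m"
| "src (Label gs) = length gs"
| "src (Comp t u) = src u"
| "src (Sum t u) = src t + src u"

primrec tgt :: "('g, 's) sv_term \<Rightarrow> nat" where
  "tgt (Brick m n f) = n"
| "tgt (Label gs) = length gs"
| "tgt (Comp t u) = tgt t"
| "tgt (Sum t u) = tgt t + tgt u"

lemma mor_src_tgt: "mor t m n \<Longrightarrow> src t = m \<and> tgt t = n"
  by (induction rule: sv_morphism.induct) auto

text \<open>The inverse makes this a left action: what stands at coordinate \<open>s\<close> moves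
  to coordinate \<open>\<phi> g s\<close>.\<close>

definition act :: "'g \<Rightarrow> 's cube_point \<Rightarrow> 's cube_point" where
  "act g \<kappa> = (\<lambda>s\<in>S. \<kappa> (\<phi> (inv g) s))"

text \<open>A label also multiplies a second coordinate in \<open>G\<close>, which records the cocycle \<open>\<gamma>\<close>.\<close>

primrec interp :: "('g, 's) sv_term \<Rightarrow> 's copies_point \<times> 'g \<Rightarrow> 's copies_point \<times> 'g" where
  "interp (Brick m n f) = (\<lambda>(p, x). (f p, x))"
| "interp (Label gs) = (\<lambda>(p, x). ((fst p, act (gs ! fst p) (snd p)), gs ! fst p \<otimes> x))"
| "interp (Comp t u) = (\<lambda>z. interp t (interp u z))"
| "interp (Sum t u) = (\<lambda>(p, x). if fst p < src t then interp t (p, x)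
     else (let z = interp u ((fst p - src t, snd p), x) in ((tgt t + fst (fst z), snd (fst z)), snd z)))"

abbreviation pts :: "nat \<Rightarrow> ('s copies_point \<times> 'g) set" where
  "pts m \<equiv> copies m \<times> carrier G"

lemma act_cube [simp]: "act g \<kappa> \<in> cube"
  by (simp add: act_def cantor_cube_def)

lemma phi_closed [simp]: "g \<in> carrier G \<Longrightarrow> s \<in> S \<Longrightarrow> \<phi> g s \<in> S"
  using element_image by blast

lemma phi_inv [simp]:
  assumes "g \<in> carrier G" "s \<in> S"
  shows "\<phi> (inv g) (\<phi> g s) = s" "\<phi> g (\<phi> (inv g) s) = s"
proof -
  have 1: "\<phi> (inv h) (\<phi> h t) = t" if "h \<in> carrier G" "t \<in> S" for h t
    using orbit_sym_aux[OF that HOL.refl] .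
  show "\<phi> (inv g) (\<phi> g s) = s" using 1 assms by blast
  show "\<phi> g (\<phi> (inv g) s) = s" using 1[of "inv g" s] assms by simp
qed

lemma act_one: "\<kappa> \<in> cube \<Longrightarrow> act \<one> \<kappa> = \<kappa>"
  by (rule cube_ext[OF act_cube]) (simp_all add: act_def id_eq_one[symmetric])

lemma act_mult:
  assumes "g \<in> carrier G" "h \<in> carrier G"
  shows "act g (act h \<kappa>) = act (g \<otimes> h) \<kappa>"
proof
  fix s
  show "act g (act h \<kappa>) s = act (g \<otimes> h) \<kappa> s"
  proof (cases "s \<in> S")
    case True
    then have "\<phi> (inv (g \<otimes> h)) s = \<phi> (inv h) (\<phi> (inv g) s)"
      using assms by (simp add: inv_mult_group composition_rule)
    then show ?thesis using True assms by (simp add: act_def)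
  qed (simp add: act_def)
qed

lemma act_scons:
  assumes g: "g \<in> carrier G" "s \<in> S"
  shows "act g (scons s b \<kappa>) = scons (\<phi> g s) b (act g \<kappa>)"
proof
  fix t
  show "act g (scons s b \<kappa>) t = scons (\<phi> g s) b (act g \<kappa>) t"
  proof (cases "t \<in> S")
    case True
    then have "\<phi> (inv g) t = s \<longleftrightarrow> t = \<phi> g s" using g by auto
    then show ?thesis using True g by (auto simp: act_def scons_def)
  next
    case False
    then have "t \<noteq> \<phi> g s" using g by auto
    then show ?thesis using False by (simp add: act_def scons_def)
  qed
qed

lemma interp_Sum_left: "mor t m n \<Longrightarrow> i < m \<Longrightarrow> interp (Sum t u) ((i, \<kappa>), x) = interp t ((i, \<kappa>), x)"
  using mor_src_tgt[of t m n] by simp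

lemma interp_Sum_right:
  "mor t m n \<Longrightarrow> interp (Sum t u) ((m + i, \<kappa>), x) =
     (let z = interp u ((i, \<kappa>), x) in ((n + fst (fst z), snd (fst z)), snd z))"
  using mor_src_tgt[of t m n] by simp

lemma pts_cases:
  assumes "z \<in> pts m"
  obtains i \<kappa> x where "z = ((i, \<kappa>), x)" "i < m" "\<kappa> \<in> cube" "x \<in> carrier G"
  using assms by (metis SigmaE copies_iff surj_pair)

lemma pts_add_cases:
  assumes "z \<in> pts (m + m')"
  obtains i \<kappa> x where "z = ((i, \<kappa>), x)" "i < m" "\<kappa> \<in> cube" "x \<in> carrier G"
  | i \<kappa> x where "z = ((m + i, \<kappa>), x)" "i < m'" "\<kappa> \<in> cube" "x \<in> carrier G"
proof -
  obtain j \<kappa> x where z: "z = ((j, \<kappa>), x)" "j < m + m'" "\<kappa> \<in> cube" "x \<in> carrier G"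
    using pts_cases[OF assms] by metis
  show thesis
  proof (cases "j < m")
    case False
    then have "z = ((m + (j - m), \<kappa>), x)" "j - m < m'" using z by auto
    then show thesis using that(2) z by blast
  qed (use that(1) z in blast)
qed

lemma interp_closed: "mor t m n \<Longrightarrow> z \<in> pts m \<Longrightarrow> interp t z \<in> pts n"
proof (induction arbitrary: z rule: sv_morphism.induct)
  case (brick f m n)
  then show ?case using brin_thompson_closed[OF brick(1)] by auto
next
  case (label gs)
  from label(3) show ?case
  proof (rule pts_cases)
    fix i \<kappa> x assume z: "z = ((i, \<kappa>), x)" "i < length gs" "\<kappa> \<in> cube" "x \<in> carrier G"
    have "gs ! i \<in> carrier G" using label(2) nth_mem[OF z(2)] by blast
    then show ?thesis using z by simp
  qed
next
  case (comp t n p u m)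
  then show ?case by simp
next
  case (sum t m n t' m' n')
  from sum.prems show ?case
  proof (cases rule: pts_add_cases)
    case (1 i \<kappa> x)
    then have "interp t z \<in> pts n" using sum.IH(1)[of z] by simp
    then show ?thesis using 1 interp_Sum_left[OF sum.hyps(1)] by (auto simp: cantor_copies_def)
  next
    case (2 i \<kappa> x)
    then have "interp t' ((i, \<kappa>), x) \<in> pts n'" using sum.IH(2) by simp
    then show ?thesis using 2 interp_Sum_right[OF sum.hyps(1)]
      by (auto simp: cantor_copies_def Let_def mem_Times_iff)
  qed
qed

lemma mor_label: "length gs = n \<Longrightarrow> 1 \<le> n \<Longrightarrow> set gs \<subseteq> carrier G \<Longrightarrow> mor (Label gs) n n"
  using sv_morphism.label[of gs G S] by (cases gs) auto

text \<open>Typing is part of the relation, so soundness also shows that \<open>\<approx>\<close>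
  preserves source and target. The congruence cases of \<open>sound\<close> depend on this.\<close>

definition same :: "('g, 's) sv_term \<Rightarrow> ('g, 's) sv_term \<Rightarrow> bool" where
  "same t u \<longleftrightarrow> (\<exists>m n. mor t m n \<and> mor u m n \<and> (\<forall>z\<in>pts m. interp t z = interp u z))"

lemma sameI: "mor t m n \<Longrightarrow> mor u m n \<Longrightarrow> (\<And>z. z \<in> pts m \<Longrightarrow> interp t z = interp u z) \<Longrightarrow> same t u"
  unfolding same_def by blast

lemma sameD:
  assumes "same t u" "mor t m n"
  shows "mor u m n" "\<And>z. z \<in> pts m \<Longrightarrow> interp t z = interp u z"
proof -
  obtain m' n' where *: "mor t m' n'" "mor u m' n'" "\<forall>z\<in>pts m'. interp t z = interp u z"
    using assms(1) unfolding same_def by blast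
  have mn: "m' = m" "n' = n" using mor_unique[OF *(1) assms(2)] by simp_all
  show "mor u m n" using *(2) mn by simp
  show "interp t z = interp u z" if "z \<in> pts m" for z using *(3) mn that by blast
qed

lemma sound: "t \<approx> u \<Longrightarrow> same t u"
proof (induction rule: sv_eq.induct)
  case (refl t m n)
  then show ?case unfolding same_def by blast
next
  case (sym t u)
  then show ?case unfolding same_def by metis
next
  case (trans t u v)
  then obtain m n where t: "mor t m n" unfolding same_def by blast
  note u = sameD[OF trans.IH(1) t]
  note v = sameD[OF trans.IH(2) u(1)]
  show ?case by (rule sameI[OF t v(1)]) (simp add: u v)
next
  case (comp_cong t n p u m t' u')
  note t = sameD[OF comp_cong.IH(1) comp_cong.hyps(1)]
  note u = sameD[OF comp_cong.IH(2) comp_cong.hyps(2)]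
  show ?case
    by (rule sameI[OF sv_morphism.comp[OF comp_cong.hyps(1,2)] sv_morphism.comp[OF t(1) u(1)]])
       (use t u interp_closed[OF u(1)] in auto)
next
  case (sum_cong t t' u u')
  obtain m n where t: "mor t m n" using sum_cong.IH(1) unfolding same_def by blast
  obtain m' n' where u: "mor u m' n'" using sum_cong.IH(2) unfolding same_def by blast
  note t' = sameD[OF sum_cong.IH(1) t]
  note u' = sameD[OF sum_cong.IH(2) u]
  show ?case
  proof (rule sameI[OF sv_morphism.sum[OF t u] sv_morphism.sum[OF t'(1) u'(1)]])
    fix z assume "z \<in> pts (m + m')"
    then show "interp (Sum t u) z = interp (Sum t' u') z"
    proof (cases rule: pts_add_cases)
      case (1 i \<kappa> x)
      then show ?thesis using t'(2)[of z] by (simp only: interp_Sum_left[OF t] interp_Sum_left[OF t'(1)]) simp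
    next
      case (2 i \<kappa> x)
      then show ?thesis using u'(2)[of "((i, \<kappa>), x)"]
        by (simp only: interp_Sum_right[OF t] interp_Sum_right[OF t'(1)]) simp
    qed
  qed
next
  case (comp_assoc t p q u n v m)
  then show ?case by (intro sameI[of _ m q]) (auto intro: sv_morphism.intros)
next
  case (id_left t m n)
  show ?case
  proof (rule sameI[OF _ id_left])
    show "mor (Comp (Brick n n (bt_id S n)) t) m n"
      using id_left mor_pos[OF id_left] bt_id_closed by (blast intro: sv_morphism.intros)
    fix z assume "z \<in> pts m"
    then show "interp (Comp (Brick n n (bt_id S n)) t) z = interp t z"
      using interp_closed[OF id_left] by (auto simp: split_beta mem_Times_iff)
  qed
next
  case (id_right t m n)
  show ?case
  proof (rule sameI[OF _ id_right])
    show "mor (Comp t (Brick m m (bt_id S m))) m n"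
      using id_right mor_pos[OF id_right] bt_id_closed by (blast intro: sv_morphism.intros)
  qed (auto simp: split_beta mem_Times_iff)
next
  case (interchange t n p u m t' n' p' u' m')
  note t = interchange(1) and u = interchange(2) and t' = interchange(3) and u' = interchange(4)
  show ?case
  proof (rule sameI[of _ "m + m'" "p + p'"])
    fix z assume z: "z \<in> pts (m + m')"
    from z show "interp (Comp (Sum t t') (Sum u u')) z = interp (Sum (Comp t u) (Comp t' u')) z"
    proof (cases rule: pts_add_cases)
      case (1 i \<kappa> x)
      then have "interp u z \<in> pts n" using interp_closed[OF u] by simp
      then obtain j \<kappa>' x' where "interp u z = ((j, \<kappa>'), x')" "j < n" by (rule pts_cases)
      then show ?thesis
        using 1 interp_Sum_left[OF u] interp_Sum_left[OF t] interp_Sum_left[OF sv_morphism.comp[OF t u]]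
        by (simp del: interp.simps(4))
    next
      case (2 i \<kappa> x)
      then have "interp u' ((i, \<kappa>), x) \<in> pts n'" using interp_closed[OF u'] by simp
      then obtain j \<kappa>' x' where "interp u' ((i, \<kappa>), x) = ((j, \<kappa>'), x')" "j < n'" by (rule pts_cases)
      then show ?thesis
        using 2 interp_Sum_right[OF u] interp_Sum_right[OF t] interp_Sum_right[OF sv_morphism.comp[OF t u]]
        by (simp del: interp.simps(4))
    qed
  next
    show "mor (Comp (Sum t t') (Sum u u')) (m + m') (p + p')"
      by (rule sv_morphism.comp[OF sv_morphism.sum[OF t t'] sv_morphism.sum[OF u u']])
    show "mor (Sum (Comp t u) (Comp t' u')) (m + m') (p + p')"
      by (rule sv_morphism.sum[OF sv_morphism.comp[OF t u] sv_morphism.comp[OF t' u']])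
  qed
next
  case (brick_comp f m n f' p)
  then show ?case
    by (intro sameI[OF sv_morphism.comp[OF sv_morphism.brick sv_morphism.brick]
          sv_morphism.brick[OF brin_thompson_compose]])
       (auto simp: compose_def)
next
  case (brick_sum f m n f' m' n')
  show ?case
  proof (rule sameI[of _ "m + m'" "n + n'"])
    fix z assume "z \<in> pts (m + m')"
    then show "interp (Sum (Brick m n f) (Brick m' n' f')) z =
        interp (Brick (m + m') (n + n') (bt_sum S m n m' f f')) z"
      by (cases rule: pts_add_cases) (simp_all add: bt_sum_left bt_sum_right)
  next
    show "mor (Sum (Brick m n f) (Brick m' n' f')) (m + m') (n + n')"
      by (rule sv_morphism.sum[OF sv_morphism.brick[OF brick_sum(1)] sv_morphism.brick[OF brick_sum(2)]])
    show "mor (Brick (m + m') (n + n') (bt_sum S m n m' f f')) (m + m') (n + n')"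
      by (rule sv_morphism.brick[OF bt_sum_closed[OF brick_sum]])
  qed
next
  case (label_one n)
  show ?case
  proof (rule sameI[of _ n n])
    fix z assume "z \<in> pts n"
    then show "interp (Label (replicate n \<one>)) z = interp (Brick n n (bt_id S n)) z"
      by (cases rule: pts_cases) (simp add: act_one)
  qed (use label_one bt_id_closed in \<open>auto intro!: mor_label sv_morphism.brick\<close>)
next
  case (label_comp gs hs)
  have c: "gs ! i \<in> carrier G" "hs ! i \<in> carrier G" if "i < length gs" for i
    using label_comp(2-4) that nth_mem[of i gs] nth_mem[of i hs] by auto
  show ?case
  proof (rule sameI[of _ "length gs" "length gs"])
    show "mor (Comp (Label gs) (Label hs)) (length gs) (length gs)"
      using label_comp by (intro sv_morphism.comp[of _ _ _ "length gs"] mor_label) (auto simp: Suc_le_eq)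
    have "set (map2 (\<otimes>) gs hs) \<subseteq> carrier G"
      using c label_comp(2) by (auto simp: set_zip)
    then show "mor (Label (map2 (\<otimes>) gs hs)) (length gs) (length gs)"
      using label_comp by (intro mor_label) (auto simp: Suc_le_eq)
    fix z assume "z \<in> pts (length gs)"
    then show "interp (Comp (Label gs) (Label hs)) z = interp (Label (map2 (\<otimes>) gs hs)) z"
      using label_comp(2) c by (cases rule: pts_cases) (simp add: act_mult m_assoc)
  qed
next
  case (label_sum gs hs)
  have m: "mor (Label gs) (length gs) (length gs)" "mor (Label hs) (length hs) (length hs)"
    using label_sum by (auto intro: sv_morphism.label)
  show ?case
  proof (rule sameI[of _ "length gs + length hs" "length gs + length hs"])
    show "mor (Label (gs @ hs)) (length gs + length hs) (length gs + length hs)"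
      using label_sum by (intro mor_label) (auto simp: Suc_le_eq)
    fix z assume "z \<in> pts (length gs + length hs)"
    then show "interp (Sum (Label gs) (Label hs)) z = interp (Label (gs @ hs)) z"
      by (cases rule: pts_add_cases) (simp_all add: nth_append)
  qed (rule sv_morphism.sum[OF m])
next
  case (split g s)
  show ?case
  proof (rule sameI[of _ 1 2])
    show "mor (Comp (Brick 1 2 (simple_split S (\<phi> g s))) (Label [g])) 1 2"
      using split by (intro sv_morphism.comp[of _ _ _ 1] sv_morphism.brick bt_split mor_label) auto
    show "mor (Comp (Label [g, g]) (Brick 1 2 (simple_split S s))) 1 2"
      using split by (intro sv_morphism.comp[of _ _ _ 2] sv_morphism.brick bt_split mor_label) auto
    fix z assume "z \<in> pts 1"
    then show "interp (Comp (Brick 1 2 (simple_split S (\<phi> g s))) (Label [g])) z =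
        interp (Comp (Label [g, g]) (Brick 1 2 (simple_split S s))) z"
    proof (cases rule: pts_cases)
      case (1 i \<kappa> x)
      obtain b \<kappa>' where "\<kappa>' \<in> cube" "\<kappa> = scons s b \<kappa>'" using scons_cases[OF split(2) 1(3)] by metis
      then show ?thesis
        using 1 split by (simp add: act_scons simple_split_scons)
    qed
  qed
next
  case (perm gs \<sigma>)
  let ?n = "length gs"
  have \<sigma>: "\<sigma> i < ?n \<longleftrightarrow> i < ?n" for i using permutes_in_image[OF perm(3), of i] by simp
  have n: "1 \<le> ?n" using perm(1) by (simp add: Suc_le_eq)
  have B: "mor (Brick ?n ?n (copy_perm S ?n \<sigma>)) ?n ?n" by (intro sv_morphism.brick bt_perm n perm(3))
  show ?case
  proof (rule sameI[of _ ?n ?n])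
    show "mor (Comp (Label gs) (Brick ?n ?n (copy_perm S ?n \<sigma>))) ?n ?n"
      by (intro sv_morphism.comp[OF _ B] sv_morphism.label perm)
    show "mor (Comp (Brick ?n ?n (copy_perm S ?n \<sigma>)) (Label (map (\<lambda>i. gs ! \<sigma> i) [0..<?n]))) ?n ?n"
    proof (intro sv_morphism.comp[OF B] mor_label n)
      show "set (map (\<lambda>i. gs ! \<sigma> i) [0..<?n]) \<subseteq> carrier G"
        using perm(2) \<sigma> nth_mem by fastforce
    qed simp
    fix z assume "z \<in> pts ?n"
    then show "interp (Comp (Label gs) (Brick ?n ?n (copy_perm S ?n \<sigma>))) z =
        interp (Comp (Brick ?n ?n (copy_perm S ?n \<sigma>)) (Label (map (\<lambda>i. gs ! \<sigma> i) [0..<?n]))) z"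
      by (cases rule: pts_cases) simp
  qed
qed

end

section \<open>Normal forms and completeness\<close>

context twisted
begin

definition Hom :: "nat \<Rightarrow> nat \<Rightarrow> ('g, 's) sv_term set set" where
  "Hom m n = {cls t | t. mor t m n}"

text \<open>The multiplication formula of \<open>twisted_BT\<close>, used here between arbitrary
  objects, so that the group is \<open>Hom 1 1\<close> just by unfolding.\<close>

definition comp_cls (infixl "\<bullet>" 70) where
  "A \<bullet> B = (\<Union>t\<in>A. \<Union>u\<in>B. cls (Comp t u))"

definition sum_cls (infixl "\<boxplus>" 65) where
  "A \<boxplus> B = (\<Union>t\<in>A. \<Union>u\<in>B. cls (Sum t u))"

definition Br :: "nat \<Rightarrow> nat \<Rightarrow> ('s copies_point \<Rightarrow> 's copies_point) \<Rightarrow> ('g, 's) sv_term set" where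
  "Br m n f = cls (Brick m n f)"

definition Lb :: "'g list \<Rightarrow> ('g, 's) sv_term set" where
  "Lb gs = cls (Label gs)"

definition Id :: "nat \<Rightarrow> ('g, 's) sv_term set" where
  "Id n = Br n n (bt_id S n)"

definition labels :: "nat \<Rightarrow> 'g list set" where
  "labels n = {gs. length gs = n \<and> set gs \<subseteq> carrier G}"

lemma cls_eqI: "t \<approx> u \<Longrightarrow> cls t = cls u"
  unfolding sv_class_def by (auto intro: sv_eq.trans sv_eq.sym)

lemma in_cls: "mor t m n \<Longrightarrow> t \<in> cls t"
  by (simp add: sv_class_def sv_eq.refl)

lemma cls_comp: "mor t n p \<Longrightarrow> mor u m n \<Longrightarrow> cls t \<bullet> cls u = cls (Comp t u)"
proof -
  assume tu: "mor t n p" "mor u m n"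
  have "cls (Comp t' u') = cls (Comp t u)" if "t' \<in> cls t" "u' \<in> cls u" for t' u'
    using cls_eqI[OF sv_eq.comp_cong[OF tu, of \<phi> t' u']] that by (simp add: sv_class_def)
  then show ?thesis unfolding comp_cls_def using in_cls[OF tu(1)] in_cls[OF tu(2)] by blast
qed

lemma cls_sum: "mor t m n \<Longrightarrow> mor u m' n' \<Longrightarrow> cls t \<boxplus> cls u = cls (Sum t u)"
proof -
  assume tu: "mor t m n" "mor u m' n'"
  have "cls (Sum t' u') = cls (Sum t u)" if "t' \<in> cls t" "u' \<in> cls u" for t' u'
    using cls_eqI[OF sv_eq.sum_cong[of G S \<phi> t t' u u']] that by (simp add: sv_class_def)
  then show ?thesis unfolding sum_cls_def using in_cls[OF tu(1)] in_cls[OF tu(2)] by blast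
qed

lemma HomE: "A \<in> Hom m n \<Longrightarrow> (\<And>t. A = cls t \<Longrightarrow> mor t m n \<Longrightarrow> thesis) \<Longrightarrow> thesis"
  unfolding Hom_def by blast

lemma cls_Hom: "mor t m n \<Longrightarrow> cls t \<in> Hom m n"
  unfolding Hom_def by blast

lemma comp_Hom: "A \<in> Hom n p \<Longrightarrow> B \<in> Hom m n \<Longrightarrow> A \<bullet> B \<in> Hom m p"
  by (elim HomE) (simp add: cls_comp cls_Hom[OF sv_morphism.comp])

lemma sum_Hom: "A \<in> Hom m n \<Longrightarrow> B \<in> Hom m' n' \<Longrightarrow> A \<boxplus> B \<in> Hom (m + m') (n + n')"
  by (elim HomE) (simp add: cls_sum cls_Hom[OF sv_morphism.sum])

lemma assoc: "A \<in> Hom p q \<Longrightarrow> B \<in> Hom n p \<Longrightarrow> C \<in> Hom m n \<Longrightarrow> A \<bullet> B \<bullet> C = A \<bullet> (B \<bullet> C)"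
  by (elim HomE)
     (simp add: cls_comp[OF sv_morphism.comp] cls_comp[OF _ sv_morphism.comp] cls_comp cls_eqI[OF sv_eq.comp_assoc])

lemma Br_Hom: "f \<in> BT m n \<Longrightarrow> Br m n f \<in> Hom m n"
  unfolding Br_def by (intro cls_Hom sv_morphism.brick)

lemma Lb_Hom: "gs \<in> labels n \<Longrightarrow> 1 \<le> n \<Longrightarrow> Lb gs \<in> Hom n n"
  unfolding Lb_def labels_def by (intro cls_Hom mor_label) auto

lemma Id_Hom: "1 \<le> n \<Longrightarrow> Id n \<in> Hom n n"
  unfolding Id_def by (intro Br_Hom bt_id_closed)

lemma Hom_pos: "A \<in> Hom m n \<Longrightarrow> 1 \<le> m \<and> 1 \<le> n"
  by (elim HomE) (rule mor_pos)

lemma Id_left: "A \<in> Hom m n \<Longrightarrow> Id n \<bullet> A = A"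
proof (elim HomE)
  fix t assume t: "A = cls t" "mor t m n"
  then show ?thesis unfolding Id_def Br_def
    using cls_comp[OF sv_morphism.brick[OF bt_id_closed] t(2)] mor_pos[OF t(2)] cls_eqI[OF sv_eq.id_left[OF t(2)]]
    by simp
qed

lemma Id_right: "A \<in> Hom m n \<Longrightarrow> A \<bullet> Id m = A"
proof (elim HomE)
  fix t assume t: "A = cls t" "mor t m n"
  then show ?thesis unfolding Id_def Br_def
    using cls_comp[OF t(2) sv_morphism.brick[OF bt_id_closed]] mor_pos[OF t(2)] cls_eqI[OF sv_eq.id_right[OF t(2)]]
    by simp
qed

lemma Br_comp: "f \<in> BT m n \<Longrightarrow> g \<in> BT n p \<Longrightarrow> Br n p g \<bullet> Br m n f = Br m p (compose (copies m) g f)"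
  unfolding Br_def by (simp add: cls_comp[OF sv_morphism.brick sv_morphism.brick] cls_eqI[OF sv_eq.brick_comp])

lemma Br_sum:
  "f \<in> BT m n \<Longrightarrow> g \<in> BT m' n' \<Longrightarrow> Br m n f \<boxplus> Br m' n' g = Br (m + m') (n + n') (bt_sum S m n m' f g)"
  unfolding Br_def by (simp add: cls_sum[OF sv_morphism.brick sv_morphism.brick] cls_eqI[OF sv_eq.brick_sum])

lemma Lb_one: "1 \<le> n \<Longrightarrow> Lb (replicate n \<one>) = Id n"
  unfolding Lb_def Id_def Br_def by (rule cls_eqI[OF sv_eq.label_one])

lemma Lb_comp:
  assumes "gs \<in> labels n" "hs \<in> labels n" "1 \<le> n"
  shows "Lb gs \<bullet> Lb hs = Lb (map2 (\<otimes>) gs hs)"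
proof -
  have "mor (Label gs) n n" "mor (Label hs) n n" "gs \<noteq> []"
    using assms by (auto simp: labels_def intro: mor_label)
  then show ?thesis
    using assms unfolding Lb_def by (simp add: cls_comp labels_def cls_eqI[OF sv_eq.label_comp])
qed

lemma labels_nth: "gs \<in> labels n \<Longrightarrow> i < n \<Longrightarrow> gs ! i \<in> carrier G"
  using nth_mem[of i gs] by (auto simp: labels_def)

lemma labels_length: "gs \<in> labels n \<Longrightarrow> length gs = n"
  by (simp add: labels_def)

lemma map2_labels: "gs \<in> labels n \<Longrightarrow> hs \<in> labels n \<Longrightarrow> map2 (\<otimes>) gs hs \<in> labels n"
  using labels_nth[of gs n] labels_nth[of hs n] unfolding labels_def by (auto simp: set_zip)

lemma Lb_sum:
  assumes "gs \<in> labels n" "hs \<in> labels n'" "1 \<le> n" "1 \<le> n'"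
  shows "Lb gs \<boxplus> Lb hs = Lb (gs @ hs)"
proof -
  have "mor (Label gs) n n" "mor (Label hs) n' n'" "gs \<noteq> []" "hs \<noteq> []"
    using assms by (auto simp: labels_def intro: mor_label)
  then show ?thesis
    using assms unfolding Lb_def by (simp add: cls_sum labels_def cls_eqI[OF sv_eq.label_sum])
qed

lemma interchange:
  assumes "A \<in> Hom n p" "B \<in> Hom m n" "A' \<in> Hom n' p'" "B' \<in> Hom m' n'"
  shows "(A \<boxplus> A') \<bullet> (B \<boxplus> B') = (A \<bullet> B) \<boxplus> (A' \<bullet> B')"
proof -
  obtain t u t' u' where *: "A = cls t" "mor t n p" "B = cls u" "mor u m n"
    "A' = cls t'" "mor t' n' p'" "B' = cls u'" "mor u' m' n'"
    using assms by (elim HomE)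
  show ?thesis
    unfolding * cls_sum[OF *(2,6)] cls_sum[OF *(4,8)] cls_comp[OF *(2,4)] cls_comp[OF *(6,8)]
      cls_comp[OF sv_morphism.sum[OF *(2,6)] sv_morphism.sum[OF *(4,8)]]
      cls_sum[OF sv_morphism.comp[OF *(2,4)] sv_morphism.comp[OF *(6,8)]]
    by (rule cls_eqI[OF sv_eq.interchange[OF *(2,4,6,8)]])
qed

lemma Br_inv:
  assumes f: "f \<in> BT m n"
  shows "Br n m (bt_inv m f n) \<bullet> Br m n f = Id m" "Br m n f \<bullet> Br n m (bt_inv m f n) = Id n"
proof -
  note i = bt_inv_closed[OF f]
  have pos: "1 \<le> m" "1 \<le> n" using brin_thompsonD[OF f] by auto
  have "compose (copies m) (bt_inv m f n) f = bt_id S m"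
    by (rule bt_ext[OF brin_thompson_compose[OF f i] bt_id_closed[OF pos(1)]])
       (simp add: compose_def bt_inv_left[OF f])
  then show "Br n m (bt_inv m f n) \<bullet> Br m n f = Id m" unfolding Br_comp[OF f i] Id_def by simp
  have "compose (copies n) f (bt_inv m f n) = bt_id S n"
    by (rule bt_ext[OF brin_thompson_compose[OF i f] bt_id_closed[OF pos(2)]])
       (simp add: compose_def bt_inv_right[OF f])
  then show "Br m n f \<bullet> Br n m (bt_inv m f n) = Id n" unfolding Br_comp[OF i f] Id_def by simp
qed

lemma labels_inv: "gs \<in> labels n \<Longrightarrow> map (m_inv G) gs \<in> labels n"
  by (auto simp: labels_def)

lemma Lb_inv:
  assumes gs: "gs \<in> labels n" "1 \<le> n"
  shows "Lb (map (m_inv G) gs) \<bullet> Lb gs = Id n" "Lb gs \<bullet> Lb (map (m_inv G) gs) = Id n"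
proof -
  have len: "length gs = n" by (rule labels_length[OF gs(1)])
  have c: "gs ! i \<in> carrier G" if "i < n" for i by (rule labels_nth[OF gs(1) that])
  have "map2 (\<otimes>) (map (m_inv G) gs) gs = replicate n \<one>" "map2 (\<otimes>) gs (map (m_inv G) gs) = replicate n \<one>"
    using len c by (auto intro!: nth_equalityI)
  then show "Lb (map (m_inv G) gs) \<bullet> Lb gs = Id n" "Lb gs \<bullet> Lb (map (m_inv G) gs) = Id n"
    using Lb_comp[OF labels_inv[OF gs(1)] gs] Lb_comp[OF gs(1) labels_inv[OF gs(1)] gs(2)] Lb_one[OF gs(2)]
    by simp_all
qed

lemma Id_sum: "1 \<le> m \<Longrightarrow> 1 \<le> m' \<Longrightarrow> Id m \<boxplus> Id m' = Id (m + m')"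
proof -
  assume pos: "1 \<le> m" "1 \<le> m'"
  have "bt_sum S m m m' (bt_id S m) (bt_id S m') = bt_id S (m + m')"
  proof (rule bt_ext[OF bt_sum_closed[OF bt_id_closed[OF pos(1)] bt_id_closed[OF pos(2)]] bt_id_closed])
    fix p assume p: "p \<in> copies (m + m')"
    obtain i \<kappa> where ik: "p = (i, \<kappa>)" by (cases p)
    from p[unfolded ik] show "bt_sum S m m m' (bt_id S m) (bt_id S m') p = bt_id S (m + m') p"
      unfolding ik by (cases rule: copies_add_cases) (simp_all add: bt_sum_left bt_sum_right)
  qed (use pos in simp)
  then show ?thesis
    unfolding Id_def using Br_sum[OF bt_id_closed[OF pos(1)] bt_id_closed[OF pos(2)]] by simp
qed

text \<open>Both kinds of generators have inverses of the same kind, and composition and direct sum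
  pass inverses on.\<close>

lemma Hom_inverse:
  assumes "A \<in> Hom m n"
  shows "\<exists>B\<in>Hom n m. B \<bullet> A = Id m \<and> A \<bullet> B = Id n"
proof -
  obtain t where A: "A = cls t" and t: "mor t m n" using assms by (elim HomE)
  from t show ?thesis
    unfolding A
  proof (induction rule: sv_morphism.induct)
    case (brick f m n)
    then show ?case using Br_inv[OF brick] Br_Hom[OF bt_inv_closed[OF brick]] unfolding Br_def by blast
  next
    case (label gs)
    then have "gs \<in> labels (length gs)" "1 \<le> length gs" by (auto simp: labels_def Suc_le_eq)
    then show ?case using Lb_inv Lb_Hom labels_inv unfolding Lb_def by blast
  next
    case (comp t n p u m)
    obtain T where T: "T \<in> Hom p n" "T \<bullet> cls t = Id n" "cls t \<bullet> T = Id p" using comp.IH(1) by blast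
    obtain U where U: "U \<in> Hom n m" "U \<bullet> cls u = Id m" "cls u \<bullet> U = Id n" using comp.IH(2) by blast
    note t = cls_Hom[OF comp.hyps(1)] and u = cls_Hom[OF comp.hyps(2)]
    have "(U \<bullet> T) \<bullet> (cls t \<bullet> cls u) = U \<bullet> ((T \<bullet> cls t) \<bullet> cls u)"
      using assoc[OF U(1) T(1) comp_Hom[OF t u]] assoc[OF T(1) t u] by simp
    also have "\<dots> = Id m" using T(2) Id_left[OF u] U(2) by simp
    finally have 1: "(U \<bullet> T) \<bullet> (cls t \<bullet> cls u) = Id m" .
    have "(cls t \<bullet> cls u) \<bullet> (U \<bullet> T) = cls t \<bullet> ((cls u \<bullet> U) \<bullet> T)"
      using assoc[OF t u comp_Hom[OF U(1) T(1)]] assoc[OF u U(1) T(1)] by simp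
    also have "\<dots> = Id p" using U(3) Id_left[OF T(1)] T(3) by simp
    finally show ?case
      using 1 comp_Hom[OF U(1) T(1)] cls_comp[OF comp.hyps] by metis
  next
    case (sum t m n t' m' n')
    obtain T where T: "T \<in> Hom n m" "T \<bullet> cls t = Id m" "cls t \<bullet> T = Id n" using sum.IH(1) by blast
    obtain T' where T': "T' \<in> Hom n' m'" "T' \<bullet> cls t' = Id m'" "cls t' \<bullet> T' = Id n'" using sum.IH(2) by blast
    note t = cls_Hom[OF sum.hyps(1)] and t' = cls_Hom[OF sum.hyps(2)]
    have "(T \<boxplus> T') \<bullet> (cls t \<boxplus> cls t') = Id (m + m')"
      using interchange[OF T(1) t T'(1) t'] T T' Id_sum Hom_pos[OF t] Hom_pos[OF t'] by simp
    moreover have "(cls t \<boxplus> cls t') \<bullet> (T \<boxplus> T') = Id (n + n')"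
      using interchange[OF t T(1) t' T'(1)] T T' Id_sum Hom_pos[OF t] Hom_pos[OF t'] by simp
    ultimately show ?case
      using sum_Hom[OF T(1) T'(1)] cls_sum[OF sum.hyps] by metis
  qed
qed

text \<open>A label crosses \<open>T\<close> from right to left. It changes the colors of splits on
  its way, and permutations shuffle its entries, so both \<open>hs\<close> and \<open>T'\<close> are
  new, and \<open>T'\<close> is only required to lie in \<open>BT m n\<close>.\<close>

definition pushable :: "nat \<Rightarrow> nat \<Rightarrow> ('s copies_point \<Rightarrow> 's copies_point) \<Rightarrow> bool" where
  "pushable m n T \<longleftrightarrow> T \<in> BT m n \<and> (\<forall>gs\<in>labels m. \<exists>hs\<in>labels n. \<exists>T'\<in>BT m n.
     Br m n T \<bullet> Lb gs = Lb hs \<bullet> Br m n T')"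

lemma pushableE:
  assumes "pushable m n T" "gs \<in> labels m"
  obtains hs T' where "hs \<in> labels n" "T' \<in> BT m n" "Br m n T \<bullet> Lb gs = Lb hs \<bullet> Br m n T'"
  using assms unfolding pushable_def by blast

lemma pushable_id:
  assumes "1 \<le> n"
  shows "pushable n n (bt_id S n)"
  unfolding pushable_def
  using assms bt_id_closed[OF assms] Id_left[OF Lb_Hom] Id_right[OF Lb_Hom] unfolding Id_def by metis

lemma pushable_perm:
  assumes n: "1 \<le> n" and \<sigma>: "\<sigma> permutes {..<n}"
  shows "pushable n n (copy_perm S n \<sigma>)"
  unfolding pushable_def
proof (intro conjI ballI bt_perm n \<sigma>)
  fix gs assume gs: "gs \<in> labels n"
  \<comment> \<open>Labels travel along \<open>\<sigma>\<close>, so they are listed through its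
    inverse; this gives \<open>hs ! \<sigma> i = gs ! i\<close>, the form of the relation
    \<open>perm\<close>.\<close>
  define hs where "hs = map (\<lambda>i. gs ! inv_into UNIV \<sigma> i) [0..<n]"
  have lt: "inv_into UNIV \<sigma> i < n" if "i < n" for i
    using permutes_in_image[OF permutes_inv[OF \<sigma>], of i] that by simp
  have hs: "hs \<in> labels n"
    using gs lt nth_mem unfolding hs_def labels_def by fastforce
  have "map (\<lambda>i. hs ! \<sigma> i) [0..<n] = gs"
    using permutes_in_image[OF \<sigma>] permutes_inverses(2)[OF \<sigma>] gs
    by (auto simp: hs_def labels_def intro!: nth_equalityI)
  then have e: "Comp (Label hs) (Brick n n (copy_perm S n \<sigma>)) \<approx> Comp (Brick n n (copy_perm S n \<sigma>)) (Label gs)"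
    using sv_eq.perm[of hs G \<sigma> S \<phi>] hs n \<sigma> by (cases hs) (auto simp: labels_def)
  have m: "mor (Label hs) n n" "mor (Label gs) n n" "mor (Brick n n (copy_perm S n \<sigma>)) n n"
    using gs hs n bt_perm[OF n \<sigma>] by (auto simp: labels_def intro: mor_label sv_morphism.brick)
  have "Br n n (copy_perm S n \<sigma>) \<bullet> Lb gs = Lb hs \<bullet> Br n n (copy_perm S n \<sigma>)"
    unfolding Br_def Lb_def cls_comp[OF m(3,2)] cls_comp[OF m(1,3)] using cls_eqI[OF e] by simp
  then show "\<exists>hs\<in>labels n. \<exists>T'\<in>BT n n. Br n n (copy_perm S n \<sigma>) \<bullet> Lb gs = Lb hs \<bullet> Br n n T'"
    using hs bt_perm[OF n \<sigma>] by blast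
qed

lemma Lb_split:
  assumes g: "g \<in> carrier G" and s: "s \<in> S"
  shows "Br 1 2 (simple_split S (\<phi> g s)) \<bullet> Lb [g] = Lb [g, g] \<bullet> Br 1 2 (simple_split S s)"
proof -
  have m: "mor (Brick 1 2 (simple_split S (\<phi> g s))) 1 2" "mor (Label [g]) 1 1"
    "mor (Label [g, g]) 2 2" "mor (Brick 1 2 (simple_split S s)) 1 2"
    using sv_morphism.brick[OF bt_split[of "\<phi> g s"], of G] mor_label[of "[g]" 1] mor_label[of "[g, g]" 2]
      sv_morphism.brick[OF bt_split[OF s], of G] g s by simp_all
  show ?thesis
    unfolding Br_def Lb_def cls_comp[OF m(1,2)] cls_comp[OF m(3,4)]
    using cls_eqI[OF sv_eq.split[OF g s]] by simp
qed

lemma pushable_split: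
  assumes s: "s \<in> S"
  shows "pushable 1 2 (simple_split S s)"
  unfolding pushable_def
proof (intro conjI ballI bt_split s)
  fix gs assume "gs \<in> labels 1"
  then obtain g where g: "gs = [g]" "g \<in> carrier G" by (auto simp: labels_def length_Suc_conv)
  \<comment> \<open>The relation \<open>split\<close> is applied to the color
    \<open>\<phi> (inv g) s\<close>, so that the split on its left side is the one at
    \<open>s\<close>.\<close>
  have "\<phi> g (\<phi> (inv g) s) = s" "\<phi> (inv g) s \<in> S" using g s by auto
  then have "Br 1 2 (simple_split S s) \<bullet> Lb gs = Lb [g, g] \<bullet> Br 1 2 (simple_split S (\<phi> (inv g) s))"
    using Lb_split[OF g(2), of "\<phi> (inv g) s"] g(1) by simp
  then show "\<exists>hs\<in>labels 2. \<exists>T'\<in>BT 1 2. Br 1 2 (simple_split S s) \<bullet> Lb gs = Lb hs \<bullet> Br 1 2 T'"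
    using bt_split[OF \<open>\<phi> (inv g) s \<in> S\<close>] g by (intro bexI[of _ "[g, g]"]) (auto simp: labels_def)
qed

lemma pushable_sum:
  assumes T: "pushable m n T" and T': "pushable m' n' T'"
  shows "pushable (m + m') (n + n') (bt_sum S m n m' T T')"
  unfolding pushable_def
proof (intro conjI ballI)
  have TB: "T \<in> BT m n" "T' \<in> BT m' n'" using T T' by (auto simp: pushable_def)
  show "bt_sum S m n m' T T' \<in> BT (m + m') (n + n')" by (rule bt_sum_closed[OF TB])
  have pos: "1 \<le> m" "1 \<le> n" "1 \<le> m'" "1 \<le> n'" using brin_thompsonD[OF TB(1)] brin_thompsonD[OF TB(2)] by auto
  fix gs assume "gs \<in> labels (m + m')"
  then have gs: "take m gs \<in> labels m" "drop m gs \<in> labels m'"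
    by (auto simp: labels_def dest: in_set_takeD in_set_dropD)
  obtain hs U where U: "hs \<in> labels n" "U \<in> BT m n" "Br m n T \<bullet> Lb (take m gs) = Lb hs \<bullet> Br m n U"
    by (rule pushableE[OF T gs(1)])
  obtain hs' U' where U': "hs' \<in> labels n'" "U' \<in> BT m' n'" "Br m' n' T' \<bullet> Lb (drop m gs) = Lb hs' \<bullet> Br m' n' U'"
    by (rule pushableE[OF T' gs(2)])
  have "Br (m + m') (n + n') (bt_sum S m n m' T T') \<bullet> Lb gs =
      (Br m n T \<boxplus> Br m' n' T') \<bullet> (Lb (take m gs) \<boxplus> Lb (drop m gs))"
    using Br_sum[OF TB] Lb_sum[OF gs pos(1,3)] by simp
  also have "\<dots> = (Br m n T \<bullet> Lb (take m gs)) \<boxplus> (Br m' n' T' \<bullet> Lb (drop m gs))"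
    by (rule interchange[OF Br_Hom[OF TB(1)] Lb_Hom[OF gs(1) pos(1)] Br_Hom[OF TB(2)] Lb_Hom[OF gs(2) pos(3)]])
  also have "\<dots> = (Lb hs \<boxplus> Lb hs') \<bullet> (Br m n U \<boxplus> Br m' n' U')"
    unfolding U(3) U'(3)
    by (rule interchange[OF Lb_Hom[OF U(1) pos(2)] Br_Hom[OF U(2)] Lb_Hom[OF U'(1) pos(4)] Br_Hom[OF U'(2)], symmetric])
  also have "\<dots> = Lb (hs @ hs') \<bullet> Br (m + m') (n + n') (bt_sum S m n m' U U')"
    using Br_sum[OF U(2) U'(2)] Lb_sum[OF U(1) U'(1) pos(2,4)] by simp
  finally have "Br (m + m') (n + n') (bt_sum S m n m' T T') \<bullet> Lb gs = \<dots>" .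
  moreover have "hs @ hs' \<in> labels (n + n')" using U(1) U'(1) by (auto simp: labels_def)
  ultimately show "\<exists>hs\<in>labels (n + n'). \<exists>T''\<in>BT (m + m') (n + n').
      Br (m + m') (n + n') (bt_sum S m n m' T T') \<bullet> Lb gs = Lb hs \<bullet> Br (m + m') (n + n') T''"
    using bt_sum_closed[OF U(2) U'(2)] by blast
qed

lemma pushable_compose:
  assumes T: "pushable m n T" and U: "pushable n q U"
  shows "pushable m q (compose (copies m) U T)"
  unfolding pushable_def
proof (intro conjI ballI)
  have B: "T \<in> BT m n" "U \<in> BT n q" using T U by (auto simp: pushable_def)
  note H = Br_Hom[OF B(1)] Br_Hom[OF B(2)]
  have pos: "1 \<le> m" "1 \<le> n" "1 \<le> q" using brin_thompsonD[OF B(1)] brin_thompsonD[OF B(2)] by auto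
  show "compose (copies m) U T \<in> BT m q" by (rule brin_thompson_compose[OF B])
  fix gs assume gs: "gs \<in> labels m"
  obtain hs T' where T': "hs \<in> labels n" "T' \<in> BT m n" "Br m n T \<bullet> Lb gs = Lb hs \<bullet> Br m n T'"
    by (rule pushableE[OF T gs])
  obtain ks U' where U': "ks \<in> labels q" "U' \<in> BT n q" "Br n q U \<bullet> Lb hs = Lb ks \<bullet> Br n q U'"
    by (rule pushableE[OF U T'(1)])
  have "Br m q (compose (copies m) U T) \<bullet> Lb gs = Br n q U \<bullet> Br m n T \<bullet> Lb gs"
    using Br_comp[OF B] by simp
  also have "\<dots> = Br n q U \<bullet> (Lb hs \<bullet> Br m n T')"
    using assoc[OF H(2,1) Lb_Hom[OF gs pos(1)]] T'(3) by simp
  also have "\<dots> = Lb ks \<bullet> Br n q U' \<bullet> Br m n T'"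
    using assoc[OF H(2) Lb_Hom[OF T'(1) pos(2)] Br_Hom[OF T'(2)]] U'(3) by simp
  also have "\<dots> = Lb ks \<bullet> Br m q (compose (copies m) U' T')"
    using assoc[OF Lb_Hom[OF U'(1) pos(3)] Br_Hom[OF U'(2)] Br_Hom[OF T'(2)]] Br_comp[OF T'(2) U'(2)] by simp
  finally show "\<exists>hs\<in>labels q. \<exists>T''\<in>BT m q. Br m q (compose (copies m) U T) \<bullet> Lb gs = Lb hs \<bullet> Br m q T''"
    using U'(1) brin_thompson_compose[OF T'(2) U'(2)] by blast
qed

lemma pushable_split0: "1 \<le> n \<Longrightarrow> s \<in> S \<Longrightarrow> pushable n (Suc n) (split0 n s)"
proof (cases "n = 1")
  case True
  assume "s \<in> S"
  then show ?thesis using True pushable_split split0_one by (simp add: numeral_2_eq_2)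
next
  case False
  assume "1 \<le> n" "s \<in> S"
  then show ?thesis
    using False pushable_sum[OF pushable_split pushable_id, of s "n - 1"] by (simp add: split0_def)
qed

lemma pushable_forest: "forest m n f \<Longrightarrow> pushable m n f"
proof (induction rule: forest.induct)
  case (forest_id m)
  then show ?case by (rule pushable_id)
next
  case (forest_perm m n f \<sigma>)
  have "1 \<le> n" using brin_thompsonD(3)[OF forest_BT[OF forest_perm.hyps(1)]] .
  then show ?case using pushable_compose[OF forest_perm.IH pushable_perm] forest_perm.hyps(2) by blast
next
  case (forest_split m n f s)
  have "1 \<le> n" using brin_thompsonD(3)[OF forest_BT[OF forest_split.hyps(1)]] .
  then show ?case using pushable_compose[OF forest_split.IH pushable_split0] forest_split.hyps(2) by blast
qed

text \<open>The conclusion is the inverse of the equation \<open>eq\<close>. The inverses are passed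
  explicitly because those of bricks and of labels come from different constructions.\<close>

lemma Hom_conj_inverse:
  assumes a: "a \<in> Hom m n" "a' \<in> Hom n m" "a \<bullet> a' = Id n"
    and l: "l \<in> Hom m m" "l' \<in> Hom m m" "l' \<bullet> l = Id m"
    and c: "c \<in> Hom n n" "c' \<in> Hom n n" "c' \<bullet> c = Id n"
    and b: "b \<in> Hom m n" "b' \<in> Hom n m" "b' \<bullet> b = Id m"
    and eq: "a \<bullet> l' = c \<bullet> b"
  shows "l \<bullet> a' = b' \<bullet> c'"
proof -
  have la: "l \<bullet> a' \<in> Hom n m" by (rule comp_Hom[OF l(1) a(2)])
  have "(a \<bullet> l') \<bullet> (l \<bullet> a') = a \<bullet> ((l' \<bullet> l) \<bullet> a')"
    using assoc[OF a(1) l(2) la] assoc[OF l(2,1) a(2)] by simp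
  also have "\<dots> = Id n" using l(3) Id_left[OF a(2)] a(3) by simp
  finally have 1: "(c \<bullet> b) \<bullet> (l \<bullet> a') = Id n" using eq by simp
  have "b' \<bullet> c' = b' \<bullet> (c' \<bullet> ((c \<bullet> b) \<bullet> (l \<bullet> a')))"
    unfolding 1 Id_right[OF c(2)] ..
  also have "\<dots> = b' \<bullet> ((c' \<bullet> c) \<bullet> (b \<bullet> (l \<bullet> a')))"
    using assoc[OF c(1) b(1) la] assoc[OF c(2,1) comp_Hom[OF b(1) la]] by simp
  also have "\<dots> = (b' \<bullet> b) \<bullet> (l \<bullet> a')"
    using c(3) Id_left[OF comp_Hom[OF b(1) la]] assoc[OF b(2,1) la] by simp
  also have "\<dots> = l \<bullet> a'" using b(3) Id_left[OF la] by simp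
  finally show ?thesis by simp
qed

text \<open>Pushing the inverse labels across \<open>T\<close> and inverting the resulting equation
  lets labels cross the inverse of \<open>T\<close> from left to right.\<close>

lemma pushable_inverse:
  assumes T: "pushable m n T" and gs: "gs \<in> labels m"
  shows "\<exists>hs\<in>labels n. \<exists>T'\<in>BT n m. Lb gs \<bullet> Br n m (bt_inv m T n) = Br n m T' \<bullet> Lb hs"
proof -
  have TB: "T \<in> BT m n" using T by (simp add: pushable_def)
  have pos: "1 \<le> m" "1 \<le> n" using brin_thompsonD[OF TB] by auto
  obtain hs U where U: "hs \<in> labels n" "U \<in> BT m n"
    "Br m n T \<bullet> Lb (map (m_inv G) gs) = Lb hs \<bullet> Br m n U"
    by (rule pushableE[OF T labels_inv[OF gs]])
  have "Lb gs \<bullet> Br n m (bt_inv m T n) = Br n m (bt_inv m U n) \<bullet> Lb (map (m_inv G) hs)"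
    by (rule Hom_conj_inverse[OF Br_Hom[OF TB] Br_Hom[OF bt_inv_closed[OF TB]] Br_inv(2)[OF TB]
          Lb_Hom[OF gs pos(1)] Lb_Hom[OF labels_inv[OF gs] pos(1)] Lb_inv(1)[OF gs pos(1)]
          Lb_Hom[OF U(1) pos(2)] Lb_Hom[OF labels_inv[OF U(1)] pos(2)] Lb_inv(1)[OF U(1) pos(2)]
          Br_Hom[OF U(2)] Br_Hom[OF bt_inv_closed[OF U(2)]] Br_inv(1)[OF U(2)] U(3)])
  then show ?thesis using bt_inv_closed[OF U(2)] labels_inv[OF U(1)] by blast
qed

text \<open>With \<open>f\<close> an inverse forest after a forest, \<open>gs\<close> crosses the
  inverse forest to the right and \<open>hs\<close> crosses the forest to the left, and the two
  labels meet in the middle.\<close>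

lemma Lb_Br_Lb:
  assumes gs: "gs \<in> labels n" and hs: "hs \<in> labels m" and f: "f \<in> BT m n"
  shows "\<exists>q. \<exists>F\<in>BT q n. \<exists>ks\<in>labels q. \<exists>E\<in>BT m q. Lb gs \<bullet> (Br m n f \<bullet> Lb hs) = Br q n F \<bullet> (Lb ks \<bullet> Br m q E)"
proof -
  obtain q A B where q: "forest m q A" "forest n q B" "\<And>p. p \<in> copies m \<Longrightarrow> B (f p) = A p"
    using brin_thompson_forests[OF f] by metis
  note A = forest_BT[OF q(1)] and B = forest_BT[OF q(2)]
  note iB = bt_inv_closed[OF B]
  have pos: "1 \<le> m" "1 \<le> n" "1 \<le> q" using brin_thompsonD[OF A] brin_thompsonD[OF f] by auto
  have "f = compose (copies m) (bt_inv n B q) A"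
  proof (rule bt_ext[OF f brin_thompson_compose[OF A iB]])
    fix p assume p: "p \<in> copies m"
    show "f p = compose (copies m) (bt_inv n B q) A p"
      using bt_inv_left[OF B brin_thompson_closed[OF f p]] q(3)[OF p] p by (simp add: compose_def)
  qed
  then have f': "Br m n f = Br q n (bt_inv n B q) \<bullet> Br m q A" using Br_comp[OF A iB] by simp
  obtain ks F where F: "ks \<in> labels q" "F \<in> BT q n" "Lb gs \<bullet> Br q n (bt_inv n B q) = Br q n F \<bullet> Lb ks"
    using pushable_inverse[OF pushable_forest[OF q(2)] gs] by blast
  obtain ls E where E: "ls \<in> labels q" "E \<in> BT m q" "Br m q A \<bullet> Lb hs = Lb ls \<bullet> Br m q E"
    by (rule pushableE[OF pushable_forest[OF q(1)] hs])
  have "Lb gs \<bullet> (Br m n f \<bullet> Lb hs) = (Lb gs \<bullet> Br q n (bt_inv n B q)) \<bullet> (Br m q A \<bullet> Lb hs)"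
    unfolding f' assoc[OF Br_Hom[OF iB] Br_Hom[OF A] Lb_Hom[OF hs pos(1)]]
    by (rule assoc[OF Lb_Hom[OF gs pos(2)] Br_Hom[OF iB] comp_Hom[OF Br_Hom[OF A] Lb_Hom[OF hs pos(1)]], symmetric])
  also have "\<dots> = Br q n F \<bullet> Lb ks \<bullet> (Lb ls \<bullet> Br m q E)" unfolding F(3) E(3) ..
  also have "\<dots> = Br q n F \<bullet> (Lb ks \<bullet> (Lb ls \<bullet> Br m q E))"
    by (rule assoc[OF Br_Hom[OF F(2)] Lb_Hom[OF F(1) pos(3)] comp_Hom[OF Lb_Hom[OF E(1) pos(3)] Br_Hom[OF E(2)]]])
  also have "\<dots> = Br q n F \<bullet> (Lb (map2 (\<otimes>) ks ls) \<bullet> Br m q E)"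
    using assoc[OF Lb_Hom[OF F(1) pos(3)] Lb_Hom[OF E(1) pos(3)] Br_Hom[OF E(2)]] Lb_comp[OF F(1) E(1) pos(3)]
    by simp
  finally show ?thesis using F(2) E(2) map2_labels[OF F(1) E(1)] by blast
qed

text \<open>\<open>F\<close> and \<open>E\<close> may be any Brin-Thompson maps, not only trees or
  their inverses. This is enough for completeness and lets the outer maps absorb neighbouring
  bricks.\<close>

definition has_nf :: "nat \<Rightarrow> nat \<Rightarrow> ('g, 's) sv_term set \<Rightarrow> bool" where
  "has_nf m n A \<longleftrightarrow> (\<exists>r. \<exists>F\<in>BT r n. \<exists>gs\<in>labels r. \<exists>E\<in>BT m r. A = Br r n F \<bullet> (Lb gs \<bullet> Br m r E))"

lemma has_nfI:
  "F \<in> BT r n \<Longrightarrow> gs \<in> labels r \<Longrightarrow> E \<in> BT m r \<Longrightarrow> A = Br r n F \<bullet> (Lb gs \<bullet> Br m r E) \<Longrightarrow> has_nf m n A"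
  unfolding has_nf_def by blast

text \<open>Composition is the real case: two normal forms meet in a label, a brick map and a label,
  which \<open>Lb_Br_Lb\<close> rewrites with a single label.\<close>

theorem normal_form:
  assumes "A \<in> Hom m n"
  obtains r F gs E where "F \<in> BT r n" "gs \<in> labels r" "E \<in> BT m r" "A = Br r n F \<bullet> (Lb gs \<bullet> Br m r E)"
proof -
  obtain t where A: "A = cls t" and t: "mor t m n" using assms by (elim HomE)
  from t have "has_nf m n (cls t)"
  proof (induction rule: sv_morphism.induct)
    case (brick f m n)
    have pos: "1 \<le> m" "1 \<le> n" using brin_thompsonD[OF brick] by auto
    have "cls (Brick m n f) = Br n n (bt_id S n) \<bullet> (Lb (replicate n \<one>) \<bullet> Br m n f)"
      unfolding Lb_one[OF pos(2)] Id_left[OF Br_Hom[OF brick]] Id_def[symmetric] by (simp add: Br_def)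
    moreover have "replicate n \<one> \<in> labels n" by (auto simp: labels_def)
    ultimately show ?case using has_nfI brick bt_id_closed[OF pos(2)] by metis
  next
    case (label gs)
    have pos: "1 \<le> length gs" and gs: "gs \<in> labels (length gs)" using label by (auto simp: Suc_le_eq labels_def)
    note L = Lb_Hom[OF gs pos]
    have "cls (Label gs) = Br (length gs) (length gs) (bt_id S (length gs)) \<bullet>
        (Lb gs \<bullet> Br (length gs) (length gs) (bt_id S (length gs)))"
      unfolding Id_def[symmetric] Id_right[OF L] Id_left[OF L] by (simp add: Lb_def)
    then show ?case by (rule has_nfI[OF bt_id_closed[OF pos] gs bt_id_closed[OF pos]])
  next
    case (comp t n p u m)
    obtain r F gs E where 1: "F \<in> BT r p" "gs \<in> labels r" "E \<in> BT n r" "cls t = Br r p F \<bullet> (Lb gs \<bullet> Br n r E)"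
      using comp.IH(1) unfolding has_nf_def by blast
    obtain r' F' gs' E' where 2: "F' \<in> BT r' n" "gs' \<in> labels r'" "E' \<in> BT m r'" "cls u = Br r' n F' \<bullet> (Lb gs' \<bullet> Br m r' E')"
      using comp.IH(2) unfolding has_nf_def by blast
    have pos: "1 \<le> r" "1 \<le> r'" using brin_thompsonD[OF 1(1)] brin_thompsonD[OF 2(1)] by auto
    note H = Br_Hom[OF 1(1)] Lb_Hom[OF 1(2) pos(1)] Br_Hom[OF 1(3)]
      and H' = Br_Hom[OF 2(1)] Lb_Hom[OF 2(2) pos(2)] Br_Hom[OF 2(3)]
    define h where "h = compose (copies r') E F'"
    have h: "h \<in> BT r' r" unfolding h_def by (rule brin_thompson_compose[OF 2(1) 1(3)])
    obtain q K ks J where 3: "K \<in> BT q r" "ks \<in> labels q" "J \<in> BT r' q"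
      "Lb gs \<bullet> (Br r' r h \<bullet> Lb gs') = Br q r K \<bullet> (Lb ks \<bullet> Br r' q J)"
      using Lb_Br_Lb[OF 1(2) 2(2) h] by blast
    have q: "1 \<le> q" using brin_thompsonD[OF 3(1)] by auto
    note H'' = Br_Hom[OF 3(1)] Lb_Hom[OF 3(2) q] Br_Hom[OF 3(3)]
    have LE': "Lb gs' \<bullet> Br m r' E' \<in> Hom m r'" by (rule comp_Hom[OF H'(2,3)])
    have "cls (Comp t u) = (Br r p F \<bullet> (Lb gs \<bullet> Br n r E)) \<bullet> (Br r' n F' \<bullet> (Lb gs' \<bullet> Br m r' E'))"
      using cls_comp[OF comp.hyps] 1(4) 2(4) by simp
    also have "\<dots> = Br r p F \<bullet> ((Lb gs \<bullet> Br n r E) \<bullet> (Br r' n F' \<bullet> (Lb gs' \<bullet> Br m r' E')))"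
      by (rule assoc[OF H(1) comp_Hom[OF H(2,3)] comp_Hom[OF H'(1) LE']])
    also have "(Lb gs \<bullet> Br n r E) \<bullet> (Br r' n F' \<bullet> (Lb gs' \<bullet> Br m r' E')) =
        Lb gs \<bullet> (Br n r E \<bullet> (Br r' n F' \<bullet> (Lb gs' \<bullet> Br m r' E')))"
      by (rule assoc[OF H(2,3) comp_Hom[OF H'(1) LE']])
    also have "Br n r E \<bullet> (Br r' n F' \<bullet> (Lb gs' \<bullet> Br m r' E')) = Br r' r h \<bullet> (Lb gs' \<bullet> Br m r' E')"
      unfolding h_def Br_comp[OF 2(1) 1(3), symmetric] by (rule assoc[OF H(3) H'(1) LE', symmetric])
    also have "\<dots> = (Br r' r h \<bullet> Lb gs') \<bullet> Br m r' E'"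
      by (rule assoc[OF Br_Hom[OF h] H'(2,3), symmetric])
    also have "Lb gs \<bullet> ((Br r' r h \<bullet> Lb gs') \<bullet> Br m r' E') = (Lb gs \<bullet> (Br r' r h \<bullet> Lb gs')) \<bullet> Br m r' E'"
      by (rule assoc[OF H(2) comp_Hom[OF Br_Hom[OF h] H'(2)] H'(3), symmetric])
    also have "\<dots> = Br q r K \<bullet> ((Lb ks \<bullet> Br r' q J) \<bullet> Br m r' E')"
      unfolding 3(4) by (rule assoc[OF H''(1) comp_Hom[OF H''(2,3)] H'(3)])
    also have "(Lb ks \<bullet> Br r' q J) \<bullet> Br m r' E' = Lb ks \<bullet> Br m q (compose (copies m) J E')"
      using assoc[OF H''(2,3) H'(3)] Br_comp[OF 2(3) 3(3)] by simp
    also have "Br r p F \<bullet> (Br q r K \<bullet> (Lb ks \<bullet> Br m q (compose (copies m) J E'))) =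
        Br q p (compose (copies q) F K) \<bullet> (Lb ks \<bullet> Br m q (compose (copies m) J E'))"
      unfolding Br_comp[OF 3(1) 1(1), symmetric]
      by (rule assoc[OF H(1) H''(1) comp_Hom[OF H''(2) Br_Hom[OF brin_thompson_compose[OF 2(3) 3(3)]]], symmetric])
    finally show ?case
      by (rule has_nfI[OF brin_thompson_compose[OF 3(1) 1(1)] 3(2) brin_thompson_compose[OF 2(3) 3(3)]])
  next
    case (sum t m n t' m' n')
    obtain r F gs E where 1: "F \<in> BT r n" "gs \<in> labels r" "E \<in> BT m r" "cls t = Br r n F \<bullet> (Lb gs \<bullet> Br m r E)"
      using sum.IH(1) unfolding has_nf_def by blast
    obtain r' F' gs' E' where 2: "F' \<in> BT r' n'" "gs' \<in> labels r'" "E' \<in> BT m' r'" "cls t' = Br r' n' F' \<bullet> (Lb gs' \<bullet> Br m' r' E')"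
      using sum.IH(2) unfolding has_nf_def by blast
    have pos: "1 \<le> r" "1 \<le> r'" using brin_thompsonD[OF 1(1)] brin_thompsonD[OF 2(1)] by auto
    note H = Br_Hom[OF 1(1)] Lb_Hom[OF 1(2) pos(1)] Br_Hom[OF 1(3)]
      and H' = Br_Hom[OF 2(1)] Lb_Hom[OF 2(2) pos(2)] Br_Hom[OF 2(3)]
    have "cls (Sum t t') = (Br r n F \<bullet> (Lb gs \<bullet> Br m r E)) \<boxplus> (Br r' n' F' \<bullet> (Lb gs' \<bullet> Br m' r' E'))"
      using cls_sum[OF sum.hyps] 1(4) 2(4) by simp
    also have "\<dots> = (Br r n F \<boxplus> Br r' n' F') \<bullet> ((Lb gs \<bullet> Br m r E) \<boxplus> (Lb gs' \<bullet> Br m' r' E'))"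
      by (rule interchange[OF H(1) comp_Hom[OF H(2,3)] H'(1) comp_Hom[OF H'(2,3)], symmetric])
    also have "\<dots> = (Br r n F \<boxplus> Br r' n' F') \<bullet> ((Lb gs \<boxplus> Lb gs') \<bullet> (Br m r E \<boxplus> Br m' r' E'))"
      using interchange[OF H(2,3) H'(2,3)] by simp
    also have "\<dots> = Br (r + r') (n + n') (bt_sum S r n r' F F') \<bullet>
        (Lb (gs @ gs') \<bullet> Br (m + m') (r + r') (bt_sum S m r m' E E'))"
      using Br_sum[OF 1(1) 2(1)] Br_sum[OF 1(3) 2(3)] Lb_sum[OF 1(2) 2(2) pos] by simp
    finally have eq: "cls (Sum t t') = \<dots>" .
    have "gs @ gs' \<in> labels (r + r')" using 1(2) 2(2) by (auto simp: labels_def)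
    then show ?case by (rule has_nfI[OF bt_sum_closed[OF 1(1) 2(1)] _ bt_sum_closed[OF 1(3) 2(3)] eq])
  qed
  then show thesis using that A unfolding has_nf_def by blast
qed

lemma cls_interp: "mor t m n \<Longrightarrow> cls t = cls u \<Longrightarrow> z \<in> pts m \<Longrightarrow> interp t z = interp u z"
proof -
  assume t: "mor t m n" "cls t = cls u" "z \<in> pts m"
  then have "t \<in> cls u" using in_cls by blast
  then have "t \<approx> u" by (simp add: sv_class_def sv_eq.sym)
  then show ?thesis using sameD(2)[OF sound t(1,3)] by blast
qed

text \<open>Let \<open>V\<close> invert \<open>cls u\<close>; then \<open>V \<bullet> cls t\<close>
  acts as the identity. In its normal form the \<open>G\<close>-coordinate, started at
  \<open>\<one>\<close>, reads off that every label is \<open>\<one>\<close>, after which the cube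
  coordinate shows that the two outer maps cancel.\<close>

theorem complete:
  assumes t: "mor t m n" and u: "mor u m n" and same: "\<And>z. z \<in> pts m \<Longrightarrow> interp t z = interp u z"
  shows "cls t = cls u"
proof -
  obtain V where V: "V \<in> Hom n m" "V \<bullet> cls u = Id m" "cls u \<bullet> V = Id n"
    using Hom_inverse[OF cls_Hom[OF u]] by blast
  obtain v where v: "V = cls v" "mor v n m" using V(1) by (elim HomE)
  note m = mor_pos[OF t, THEN conjunct1]
  have vt: "interp (Comp v t) z = z" if z: "z \<in> pts m" for z
  proof -
    have "cls (Comp v u) = cls (Brick m m (bt_id S m))"
      using V(2) cls_comp[OF v(2) u] v(1) by (simp add: Id_def Br_def)
    then have "interp (Comp v u) z = interp (Brick m m (bt_id S m)) z"
      using cls_interp[OF sv_morphism.comp[OF v(2) u]] z by blast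
    then show ?thesis using same[OF z] z by (cases z) simp
  qed
  have H: "V \<bullet> cls t \<in> Hom m m" using comp_Hom[OF V(1) cls_Hom[OF t]] .
  obtain r F gs E where nf: "F \<in> BT r m" "gs \<in> labels r" "E \<in> BT m r" "V \<bullet> cls t = Br r m F \<bullet> (Lb gs \<bullet> Br m r E)"
    using normal_form[OF H] by metis
  have r: "1 \<le> r" using brin_thompsonD[OF nf(1)] by auto
  have mg: "mor (Brick r m F) r m" "mor (Label gs) r r" "mor (Brick m r E) m r"
    using nf(1-3) r by (auto intro: sv_morphism.brick mor_label simp: labels_def)
  have "cls (Comp v t) = cls (Comp (Brick r m F) (Comp (Label gs) (Brick m r E)))"
    using nf(4) cls_comp[OF v(2) t] v(1) cls_comp[OF mg(1) sv_morphism.comp[OF mg(2,3)]] cls_comp[OF mg(2,3)]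
    by (simp add: Br_def Lb_def)
  then have I: "interp (Comp (Brick r m F) (Comp (Label gs) (Brick m r E))) z = z" if "z \<in> pts m" for z
    using cls_interp[OF sv_morphism.comp[OF v(2) t] _ that] vt[OF that] by metis
  have c: "gs ! k \<in> carrier G" if "k < r" for k
    by (rule labels_nth[OF nf(2) that])
  have "gs ! k = \<one>" if k: "k < r" for k
  proof -
    \<comment> \<open>A point of piece \<open>k\<close>, so that label \<open>k\<close> is the one
      it meets.\<close>
    define p where "p = bt_inv m E r (k, \<lambda>s\<in>S. undefined)"
    have p: "p \<in> copies m" "E p = (k, \<lambda>s\<in>S. undefined)"
      using brin_thompson_closed[OF bt_inv_closed[OF nf(3)]] bt_inv_right[OF nf(3)] k cube_nonempty
      by (auto simp: p_def)
    show ?thesis using I[of "(p, \<one>)"] p c[OF k] by simp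
  qed
  then have gs: "gs = replicate r \<one>" using nf(2) by (auto simp: labels_def intro!: nth_equalityI)
  have "V \<bullet> cls t = Br m m (compose (copies m) F E)"
    unfolding nf(4) gs Lb_one[OF r] Id_left[OF Br_Hom[OF nf(3)]] by (rule Br_comp[OF nf(3,1)])
  moreover have "compose (copies m) F E = bt_id S m"
  proof (rule bt_ext[OF brin_thompson_compose[OF nf(3,1)] bt_id_closed[OF m]])
    fix p assume p: "p \<in> copies m"
    obtain k \<kappa> where k: "E p = (k, \<kappa>)" by (cases "E p")
    have "k < r" "\<kappa> \<in> cube" using brin_thompson_closed[OF nf(3) p] k by simp_all
    then show "compose (copies m) F E p = bt_id S m p"
      using I[of "(p, \<one>)"] p k gs by (simp add: compose_def act_one)
  qed
  ultimately have "V \<bullet> cls t = Id m" by (simp add: Id_def)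
  then have "cls u = (cls u \<bullet> V) \<bullet> cls t"
    using assoc[OF cls_Hom[OF u] V(1) cls_Hom[OF t]] Id_right[OF cls_Hom[OF u]] by simp
  then show ?thesis using V(3) Id_left[OF cls_Hom[OF t]] by simp
qed

end

section \<open>Squeezing elements into a half of the cube\<close>

context brick_system
begin

section \<open>Pieces of the cube: matching, permuting and merging them\<close>

lemma copies1_cases:
  assumes "p \<in> copies 1"
  obtains \<kappa> where "p = (0, \<kappa>)" "\<kappa> \<in> cube"
  using assms by (cases p) auto

lemma ex_brin_thompson: "1 \<le> n \<Longrightarrow> S \<noteq> {} \<Longrightarrow> \<exists>f. f \<in> BT 1 n"
proof (induction n)
  case (Suc n)
  show ?case
  proof (cases "n = 0")
    case True
    then show ?thesis using bt_id_closed[of 1] by auto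
  next
    case False
    obtain s where "s \<in> S" using Suc.prems by blast
    then show ?thesis using Suc False brin_thompson_compose bt_split0[of n s] by fastforce
  qed
qed simp

text \<open>The element \<open>E^-1 F\<close>: it sends piece \<open>i\<close> of the cut
  \<open>F\<close> to piece \<open>i\<close> of the cut \<open>E\<close>, keeping
  coordinates.\<close>

definition quot :: "nat \<Rightarrow> ('s copies_point \<Rightarrow> 's copies_point) \<Rightarrow> ('s copies_point \<Rightarrow> 's copies_point) \<Rightarrow>
    's copies_point \<Rightarrow> 's copies_point" where
  "quot n E F = compose (copies 1) (bt_inv 1 E n) F"

lemma quot_BT: "E \<in> BT 1 n \<Longrightarrow> F \<in> BT 1 n \<Longrightarrow> quot n E F \<in> BT 1 1"
  unfolding quot_def by (rule brin_thompson_compose[OF _ bt_inv_closed])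

lemma quot_apply: "E \<in> BT 1 n \<Longrightarrow> F \<in> BT 1 n \<Longrightarrow> p \<in> copies 1 \<Longrightarrow> E (quot n E F p) = F p"
  using bt_inv_right brin_thompson_closed by (simp add: quot_def compose_def del: One_nat_def)

lemma quot_eqI:
  assumes E: "E \<in> BT 1 n" and F: "F \<in> BT 1 n" and f: "f \<in> BT 1 1"
    and eq: "\<And>p. p \<in> copies 1 \<Longrightarrow> E (f p) = F p"
  shows "quot n E F = f"
proof (rule bt_ext[OF quot_BT[OF E F] f])
  fix p :: "'s copies_point" assume p: "p \<in> copies 1"
  show "quot n E F p = f p"
    by (rule bt_inj[OF E brin_thompson_closed[OF quot_BT[OF E F] p] brin_thompson_closed[OF f p]])
       (simp only: quot_apply[OF E F p] eq[OF p])
qed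

definition permute :: "nat \<Rightarrow> ('s copies_point \<Rightarrow> 's copies_point) \<Rightarrow> (nat \<Rightarrow> nat) \<Rightarrow> 's copies_point \<Rightarrow> 's copies_point" where
  "permute n E \<sigma> = compose (copies 1) (copy_perm S n \<sigma>) E"

lemma permute_BT: "E \<in> BT 1 n \<Longrightarrow> \<sigma> permutes {..<n} \<Longrightarrow> permute n E \<sigma> \<in> BT 1 n"
  unfolding permute_def by (rule brin_thompson_compose[OF _ bt_perm]) (auto dest: brin_thompsonD)

lemma permute_apply:
  assumes "E \<in> BT 1 n" "p \<in> copies 1" "E p = (k, \<kappa>)"
  shows "permute n E \<sigma> p = (\<sigma> k, \<kappa>)"
  using brin_thompson_closed[OF assms(1,2)] assms(2,3) by (simp add: permute_def compose_def)

definition conj_perm :: "nat \<Rightarrow> ('s copies_point \<Rightarrow> 's copies_point) \<Rightarrow> (nat \<Rightarrow> nat) \<Rightarrow> 's copies_point \<Rightarrow> 's copies_point" where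
  "conj_perm n E \<sigma> = quot n E (permute n E \<sigma>)"

lemma conj_perm_BT: "E \<in> BT 1 n \<Longrightarrow> \<sigma> permutes {..<n} \<Longrightarrow> conj_perm n E \<sigma> \<in> BT 1 1"
  unfolding conj_perm_def by (rule quot_BT[OF _ permute_BT])

lemma conj_perm_apply:
  assumes "E \<in> BT 1 n" "\<sigma> permutes {..<n}" "p \<in> copies 1" "E p = (k, \<kappa>)"
  shows "E (conj_perm n E \<sigma> p) = (\<sigma> k, \<kappa>)"
  unfolding conj_perm_def
  using quot_apply[OF assms(1) permute_BT[OF assms(1,2)] assms(3)] permute_apply[OF assms(1,3,4)] by simp

lemma conj_perm_compose:
  assumes E: "E \<in> BT 1 n" and \<sigma>: "\<sigma> permutes {..<n}" and \<tau>: "\<tau> permutes {..<n}"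
  shows "conj_perm n E (\<sigma> \<circ> \<tau>) = compose (copies 1) (conj_perm n E \<sigma>) (conj_perm n E \<tau>)"
proof -
  have \<sigma>\<tau>: "(\<sigma> \<circ> \<tau>) permutes {..<n}" by (rule permutes_compose[OF \<tau> \<sigma>])
  show ?thesis
    unfolding conj_perm_def[of n E "\<sigma> \<circ> \<tau>"]
  proof (rule quot_eqI[OF E permute_BT[OF E \<sigma>\<tau>] brin_thompson_compose[OF conj_perm_BT[OF E \<tau>] conj_perm_BT[OF E \<sigma>]]])
    fix p :: "'s copies_point" assume p: "p \<in> copies 1"
    obtain k \<kappa> where k: "E p = (k, \<kappa>)" by (cases "E p")
    note q = brin_thompson_closed[OF conj_perm_BT[OF E \<tau>] p]
    show "E (compose (copies 1) (conj_perm n E \<sigma>) (conj_perm n E \<tau>) p) = permute n E (\<sigma> \<circ> \<tau>) p"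
      using conj_perm_apply[OF E \<sigma> q conj_perm_apply[OF E \<tau> p k]] permute_apply[OF E p k] p
      by (simp add: compose_def)
  qed
qed

lemma inv_split: "s \<in> S \<Longrightarrow> \<kappa> \<in> cube \<Longrightarrow> bt_inv 1 (simple_split S s) 2 (if b then 1 else 0, \<kappa>) = (0, scons s b \<kappa>)"
  using bt_inv_left[OF bt_split, of s "(0, scons s b \<kappa>)"] by (simp add: scons_cube simple_split_scons)

text \<open>The first half of \<open>E'\<close> is piece \<open>i\<close> of \<open>E\<close> with
  the same coordinates. How the remaining pieces form the second half is left open.\<close>

definition merges :: "nat \<Rightarrow> ('s copies_point \<Rightarrow> 's copies_point) \<Rightarrow> nat \<Rightarrow> ('s copies_point \<Rightarrow> 's copies_point) \<Rightarrow> bool" where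
  "merges n E i E' \<longleftrightarrow> E' \<in> BT 1 2 \<and> (\<forall>p\<in>copies 1. \<forall>\<kappa>. E p = (i, \<kappa>) \<longleftrightarrow> E' p = (0, \<kappa>))"

lemma mergesD:
  assumes "merges n E i E'"
  shows "E' \<in> BT 1 2" "\<And>p \<kappa>. p \<in> copies 1 \<Longrightarrow> E p = (i, \<kappa>) \<Longrightarrow> E' p = (0, \<kappa>)"
    "\<And>p \<kappa>. p \<in> copies 1 \<Longrightarrow> E' p = (0, \<kappa>) \<Longrightarrow> E p = (i, \<kappa>)"
  using assms by (auto simp: merges_def)

lemma BT2_cases:
  assumes "E \<in> BT 1 2" "p \<in> copies 1"
  obtains \<kappa> where "E p = (0, \<kappa>)" "\<kappa> \<in> cube" | \<kappa> where "E p = (1, \<kappa>)" "\<kappa> \<in> cube"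
proof -
  obtain i \<kappa> where i: "E p = (i, \<kappa>)" by (cases "E p")
  then have "i < 2" "\<kappa> \<in> cube" using brin_thompson_closed[OF assms] by simp_all
  then have "i = 0 \<or> i = 1" by auto
  then show thesis using that i \<open>\<kappa> \<in> cube\<close> by blast
qed

text \<open>Once piece \<open>i\<close> is moved to the front, the other \<open>n - 1\<close> pieces
  are fused by the inverse of any map from one copy to \<open>n - 1\<close>. Hence
  \<open>2 \<le> n\<close>, and \<open>S \<noteq> {}\<close> supplies such a map.\<close>

lemma ex_merges:
  assumes E: "E \<in> BT 1 n" and n: "2 \<le> n" "i < n" and S: "S \<noteq> {}"
  shows "\<exists>E'. merges n E i E'"
proof -
  have "1 \<le> n - 1" and n': "1 + (n - 1) = n" using n by simp_all
  then obtain c where c: "c \<in> BT 1 (n - 1)" using ex_brin_thompson[OF _ S] by blast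
  define \<rho> where "\<rho> = Transposition.transpose 0 i"
  have \<rho>: "\<rho> permutes {..<n}" unfolding \<rho>_def using n by (intro permutes_swap_id) auto
  let ?J = "bt_sum S 1 1 (n - 1) (bt_id S 1) (bt_inv 1 c (n - 1))"
  have J: "?J \<in> BT n 2"
    using bt_sum_closed[OF bt_id_closed[of 1] bt_inv_closed[OF c]] by (simp only: n' one_add_one order.refl)
  note P = permute_BT[OF E \<rho>]
  define E' where "E' = compose (copies 1) ?J (permute n E \<rho>)"
  have E': "E' \<in> BT 1 2" unfolding E'_def by (rule brin_thompson_compose[OF P J])
  have "E p = (i, \<kappa>) \<longleftrightarrow> E' p = (0, \<kappa>)" if p: "p \<in> copies 1" for p \<kappa>
  proof -
    obtain k \<kappa>' where k: "E p = (k, \<kappa>')" by (cases "E p")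
    have kn: "k < n" "\<kappa>' \<in> cube" using brin_thompson_closed[OF E p] k by simp_all
    have E'p: "E' p = ?J (\<rho> k, \<kappa>')" using permute_apply[OF E p k] p by (simp add: E'_def compose_def)
    show ?thesis
    proof (cases "k = i")
      case True
      then have "E' p = (0, \<kappa>')" using E'p kn by (simp add: \<rho>_def bt_sum_left)
      then show ?thesis using k True by simp
    next
      case False
      then have "\<rho> k \<noteq> 0" "\<rho> k < n" using permutes_in_image[OF \<rho>, of k] kn
        by (auto simp: \<rho>_def transpose_def)
      then obtain l where l: "\<rho> k = 1 + l" "l < n - 1" by (cases "\<rho> k") auto
      have "E' p = (1 + fst (bt_inv 1 c (n - 1) (l, \<kappa>')), snd (bt_inv 1 c (n - 1) (l, \<kappa>')))"
        unfolding E'p l(1) by (rule bt_sum_right[OF l(2) kn(2)])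
      then show ?thesis using k False by simp
    qed
  qed
  then show ?thesis using E' unfolding merges_def by blast
qed

text \<open>Pieces \<open>i\<close> and \<open>j\<close> are fused along coordinate \<open>s\<close>
  into the first half of \<open>E'\<close>, so that exchanging them becomes a flip inside that
  half.\<close>

definition merges2 :: "nat \<Rightarrow> ('s copies_point \<Rightarrow> 's copies_point) \<Rightarrow> nat \<Rightarrow> nat \<Rightarrow> 's \<Rightarrow>
    ('s copies_point \<Rightarrow> 's copies_point) \<Rightarrow> bool" where
  "merges2 n E i j s E' \<longleftrightarrow> E' \<in> BT 1 2 \<and> (\<forall>p\<in>copies 1. \<forall>k \<kappa>. E p = (k, \<kappa>) \<longrightarrow>
     (if k = i then E' p = (0, scons s False \<kappa>) else if k = j then E' p = (0, scons s True \<kappa>)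
      else fst (E' p) = 1))"

lemma merges2D:
  assumes "merges2 n E i j s E'" "p \<in> copies 1"
  shows "E' \<in> BT 1 2" "E p = (i, \<kappa>) \<Longrightarrow> E' p = (0, scons s False \<kappa>)"
    "E p = (j, \<kappa>) \<Longrightarrow> i \<noteq> j \<Longrightarrow> E' p = (0, scons s True \<kappa>)"
    "E p = (k, \<kappa>) \<Longrightarrow> k \<noteq> i \<Longrightarrow> k \<noteq> j \<Longrightarrow> fst (E' p) = 1"
  using assms unfolding merges2_def by (metis, metis, metis, metis)

text \<open>As in \<open>ex_merges\<close>, but two pieces go to the front and are fused by the
  inverse of the split at \<open>s\<close>. A third piece has to remain for the second half of
  \<open>E'\<close>.\<close>

lemma ex_merges2:
  assumes E: "E \<in> BT 1 n" and n: "3 \<le> n" "i < n" "j < n" "i \<noteq> j" and s: "s \<in> S"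
  shows "\<exists>E'. merges2 n E i j s E'"
proof -
  have "1 \<le> n - 2" and n': "2 + (n - 2) = n" using n by simp_all
  then obtain c where c: "c \<in> BT 1 (n - 2)" using ex_brin_thompson s by blast
  \<comment> \<open>The place of \<open>j\<close> after \<open>i\<close> has been moved to 0; moving
    it on to 1 gives \<open>\<rho> i = 0\<close> and \<open>\<rho> j = 1\<close>.\<close>
  define l where "l = Transposition.transpose 0 i j"
  define \<rho> where "\<rho> = Transposition.transpose 1 l \<circ> Transposition.transpose 0 i"
  have l: "l < n" "l \<noteq> 0" using n by (auto simp: l_def transpose_def)
  have \<rho>: "\<rho> permutes {..<n}" unfolding \<rho>_def
    by (rule permutes_compose; rule permutes_swap_id) (use n l in auto)
  have \<rho>i: "\<rho> i = 0" "\<rho> j = 1" using l by (auto simp: \<rho>_def l_def[symmetric])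
  let ?x = "bt_inv 1 (simple_split S s) 2"
  let ?J = "bt_sum S 2 1 (n - 2) ?x (bt_inv 1 c (n - 2))"
  have J: "?J \<in> BT n 2"
    using bt_sum_closed[OF bt_inv_closed[OF bt_split[OF s]] bt_inv_closed[OF c]] by (simp only: n' one_add_one)
  note P = permute_BT[OF E \<rho>]
  define E' where "E' = compose (copies 1) ?J (permute n E \<rho>)"
  have E': "E' \<in> BT 1 2" unfolding E'_def by (rule brin_thompson_compose[OF P J])
  have E'p: "E' p = ?J (\<rho> k, \<kappa>)" "k < n" "\<kappa> \<in> cube" if "p \<in> copies 1" "E p = (k, \<kappa>)" for p k \<kappa>
    using permute_apply[OF E that] that brin_thompson_closed[OF E that(1)] by (simp_all add: E'_def compose_def)
  have "if k = i then E' p = (0, scons s False \<kappa>) else if k = j then E' p = (0, scons s True \<kappa>)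
      else fst (E' p) = 1" if *: "p \<in> copies 1" "E p = (k, \<kappa>)" for p k \<kappa>
  proof (cases "k = i \<or> k = j")
    case True
    then show ?thesis
      using E'p[OF *] inv_split[OF s, of \<kappa> False] inv_split[OF s, of \<kappa> True] n
      by (auto simp: \<rho>i bt_sum_left)
  next
    case False
    then have k: "k \<noteq> i" "k \<noteq> j" by simp_all
    have "\<rho> k \<noteq> \<rho> i" using k injD[OF permutes_inj[OF \<rho>]] by blast
    moreover have "\<rho> k \<noteq> \<rho> j" using k injD[OF permutes_inj[OF \<rho>]] by blast
    moreover have "\<rho> k < n" using permutes_in_image[OF \<rho>, of k] E'p(2)[OF *] by simp
    ultimately have "\<rho> k = 2 + (\<rho> k - 2)" "\<rho> k - 2 < n - 2" unfolding \<rho>i by simp_all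
    then obtain q where q: "\<rho> k = 2 + q" "q < n - 2" by blast
    have "E' p = (1 + fst (bt_inv 1 c (n - 2) (q, \<kappa>)), snd (bt_inv 1 c (n - 2) (q, \<kappa>)))"
      unfolding E'p(1)[OF *] q(1) by (rule bt_sum_right[OF q(2) E'p(3)[OF *]])
    then have "fst (E' p) \<noteq> 0" by simp
    then have "fst (E' p) = 1" using BT2_cases[OF E' *(1)] by (metis fst_conv)
    then show ?thesis using k by simp
  qed
  then show ?thesis using E' unfolding merges2_def by blast
qed

definition flip :: "'s \<Rightarrow> 's copies_point \<Rightarrow> 's copies_point" where
  "flip s = conj_perm 2 (simple_split S s) (Transposition.transpose 0 1)"

lemma swap01: "Transposition.transpose 0 1 permutes {..<2::nat}"
  by (rule permutes_swap_id) auto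

lemma flip_BT: "s \<in> S \<Longrightarrow> flip s \<in> BT 1 1"
  unfolding flip_def by (rule conj_perm_BT[OF bt_split swap01])

lemma flip_scons:
  assumes s: "s \<in> S" and \<kappa>: "\<kappa> \<in> cube"
  shows "flip s (0, scons s b \<kappa>) = (0, scons s (\<not> b) \<kappa>)"
proof -
  have p: "(0, scons s b \<kappa>) \<in> copies 1" for b using s \<kappa> by (simp add: scons_cube)
  have "simple_split S s (flip s (0, scons s b \<kappa>)) = (Transposition.transpose 0 1 (if b then 1 else 0), \<kappa>)"
    unfolding flip_def by (rule conj_perm_apply[OF bt_split[OF s] swap01 p simple_split_scons[OF s \<kappa>]])
  also have "\<dots> = simple_split S s (0, scons s (\<not> b) \<kappa>)"
    using simple_split_scons[OF s \<kappa>, of "\<not> b"] by simp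
  finally show ?thesis
    using bt_inj[OF bt_split[OF s] brin_thompson_closed[OF flip_BT[OF s] p] p] by blast
qed

text \<open>Quarters are numbered in binary by the first two letters at \<open>s\<close>, the first
  letter having weight 2.\<close>

definition split4 :: "'s \<Rightarrow> 's copies_point \<Rightarrow> 's copies_point" where
  "split4 s = compose (copies 1) (bt_sum S 1 2 1 (simple_split S s) (simple_split S s)) (simple_split S s)"

lemma bt_sum_halves: "f \<in> BT 1 m \<Longrightarrow> g \<in> BT 1 n \<Longrightarrow> bt_sum S 1 m 1 f g \<in> BT 2 (m + n)"
  using bt_sum_closed[of f 1 m g 1 n] by (simp only: one_add_one)

lemma split4_BT: "s \<in> S \<Longrightarrow> split4 s \<in> BT 1 4"
  using brin_thompson_compose[OF bt_split bt_sum_halves[OF bt_split bt_split], of s s s]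
  unfolding split4_def by simp

lemma split4_scons:
  assumes "s \<in> S" "\<kappa> \<in> cube"
  shows "split4 s (0, scons s b (scons s c \<kappa>)) = ((if b then 2 else 0) + (if c then 1 else 0), \<kappa>)"
proof -
  have "bt_sum S 1 2 1 (simple_split S s) (simple_split S s) (1 + 0, scons s c \<kappa>) =
      (2 + fst (simple_split S s (0, scons s c \<kappa>)), snd (simple_split S s (0, scons s c \<kappa>)))"
    using assms by (intro bt_sum_right) (simp_all add: scons_cube)
  then show ?thesis
    using assms by (auto simp: split4_def compose_def scons_cube simple_split_scons bt_sum_left)
qed

lemma scons_commute: "s \<noteq> t \<Longrightarrow> scons s b (scons t c \<kappa>) = scons t c (scons s b \<kappa>)"
  by (auto simp: scons_def fun_eq_iff)

end

section \<open>Evaluation of classes, and squeezed elements\<close>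

context twisted
begin

text \<open>Equal classes are known to act equally only on points over their source, so a
  representative is chosen and later facts state where the point lies.\<close>

definition ev :: "('g, 's) sv_term set \<Rightarrow> 's copies_point \<times> 'g \<Rightarrow> 's copies_point \<times> 'g" where
  "ev A = interp (SOME t. A = cls t \<and> (\<exists>m n. mor t m n))"

lemma ev_cls:
  assumes "mor t m n" "z \<in> pts m"
  shows "ev (cls t) z = interp t z"
proof -
  let ?P = "\<lambda>u. cls t = cls u \<and> (\<exists>m n. mor u m n)"
  have "?P (SOME u. ?P u)" by (rule someI[of ?P t]) (use assms in blast)
  then have "interp t z = interp (SOME u. ?P u) z" using cls_interp[OF assms(1) _ assms(2)] by blast
  then show ?thesis by (simp add: ev_def)
qed

lemma ev_closed: "A \<in> Hom m n \<Longrightarrow> z \<in> pts m \<Longrightarrow> ev A z \<in> pts n"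
  by (elim HomE) (simp only: ev_cls interp_closed)

lemma ev_eqI: "A \<in> Hom m n \<Longrightarrow> B \<in> Hom m n \<Longrightarrow> (\<And>z. z \<in> pts m \<Longrightarrow> ev A z = ev B z) \<Longrightarrow> A = B"
  by (elim HomE) (metis complete ev_cls)

lemma ev_comp:
  assumes "A \<in> Hom n p" "B \<in> Hom m n" "z \<in> pts m"
  shows "ev (A \<bullet> B) z = ev A (ev B z)"
proof -
  obtain t where t: "A = cls t" "mor t n p" using assms(1) by (elim HomE)
  obtain u where u: "B = cls u" "mor u m n" using assms(2) by (elim HomE)
  show ?thesis
    unfolding t(1) u(1) cls_comp[OF t(2) u(2)] ev_cls[OF sv_morphism.comp[OF t(2) u(2)] assms(3)]
      ev_cls[OF u(2) assms(3)] ev_cls[OF t(2) interp_closed[OF u(2) assms(3)]]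
    by simp
qed

lemma ev_Br: "f \<in> BT m n \<Longrightarrow> p \<in> copies m \<Longrightarrow> x \<in> carrier G \<Longrightarrow> ev (Br m n f) (p, x) = (f p, x)"
  unfolding Br_def by (subst ev_cls[OF sv_morphism.brick]) auto

lemma ev_Id: "1 \<le> m \<Longrightarrow> z \<in> pts m \<Longrightarrow> ev (Id m) z = z"
  unfolding Id_def by (cases z) (simp add: ev_Br[OF bt_id_closed])

lemma ev_Lb:
  "gs \<in> labels n \<Longrightarrow> i < n \<Longrightarrow> \<kappa> \<in> cube \<Longrightarrow> x \<in> carrier G \<Longrightarrow>
     ev (Lb gs) ((i, \<kappa>), x) = ((i, act (gs ! i) \<kappa>), gs ! i \<otimes> x)"
  unfolding Lb_def by (subst ev_cls[OF mor_label[of gs n]]) (auto simp: labels_def)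

lemma ev_sum_left:
  assumes "A \<in> Hom m n" "B \<in> Hom m' n'" "i < m" "\<kappa> \<in> cube" "x \<in> carrier G"
  shows "ev (A \<boxplus> B) ((i, \<kappa>), x) = ev A ((i, \<kappa>), x)"
proof -
  obtain t where t: "A = cls t" "mor t m n" using assms(1) by (elim HomE)
  obtain u where u: "B = cls u" "mor u m' n'" using assms(2) by (elim HomE)
  have "((i, \<kappa>), x) \<in> pts (m + m')" "((i, \<kappa>), x) \<in> pts m" using assms by auto
  then show ?thesis
    unfolding t(1) u(1) cls_sum[OF t(2) u(2)]
    using ev_cls[OF sv_morphism.sum[OF t(2) u(2)]] ev_cls[OF t(2)] interp_Sum_left[OF t(2) assms(3)] by metis
qed

lemma ev_sum_right:
  assumes "A \<in> Hom m n" "B \<in> Hom m' n'" "i < m'" "\<kappa> \<in> cube" "x \<in> carrier G"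
    and "ev B ((i, \<kappa>), x) = ((j, \<kappa>'), x')"
  shows "ev (A \<boxplus> B) ((m + i, \<kappa>), x) = ((n + j, \<kappa>'), x')"
proof -
  obtain t where t: "A = cls t" "mor t m n" using assms(1) by (elim HomE)
  obtain u where u: "B = cls u" "mor u m' n'" using assms(2) by (elim HomE)
  have p: "((m + i, \<kappa>), x) \<in> pts (m + m')" "((i, \<kappa>), x) \<in> pts m'" using assms by auto
  show ?thesis
    unfolding t(1) u(1) cls_sum[OF t(2) u(2)] ev_cls[OF sv_morphism.sum[OF t(2) u(2)] p(1)]
    using interp_Sum_right[OF t(2), of u i \<kappa> x] ev_cls[OF u(2) p(2)] assms(6) u(1) by simp
qed

text \<open>The element \<open>A\<close> carried out in the first half of the cut \<open>E\<close>,
  with the identity on the second half.\<close>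

definition inside :: "('s copies_point \<Rightarrow> 's copies_point) \<Rightarrow> ('g, 's) sv_term set \<Rightarrow> ('g, 's) sv_term set" where
  "inside E A = Br 2 1 (bt_inv 1 E 2) \<bullet> ((A \<boxplus> Id 1) \<bullet> Br 1 2 E)"

lemma inside_parts:
  assumes "E \<in> BT 1 2" "A \<in> Hom 1 1"
  shows "Br 2 1 (bt_inv 1 E 2) \<in> Hom 2 1" "A \<boxplus> Id 1 \<in> Hom 2 2" "Br 1 2 E \<in> Hom 1 2"
  using Br_Hom[OF bt_inv_closed[OF assms(1)]] Br_Hom[OF assms(1)] sum_Hom[OF assms(2) Id_Hom[of 1]]
  by (simp_all add: numeral_2_eq_2)

lemma inside_Hom: "E \<in> BT 1 2 \<Longrightarrow> A \<in> Hom 1 1 \<Longrightarrow> inside E A \<in> Hom 1 1"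
  unfolding inside_def by (intro comp_Hom[OF inside_parts(1)] comp_Hom[OF inside_parts(2,3)])

lemma ev_inside:
  assumes E: "E \<in> BT 1 2" and A: "A \<in> Hom 1 1" and z: "p \<in> copies 1" "x \<in> carrier G"
  shows "ev (inside E A) (p, x) = ev (Br 2 1 (bt_inv 1 E 2)) (ev (A \<boxplus> Id 1) (E p, x))"
  unfolding inside_def
  using ev_comp[OF inside_parts(1)[OF E A] comp_Hom[OF inside_parts(2,3)[OF E A]], of "(p, x)"]
    ev_comp[OF inside_parts(2,3)[OF E A], of "(p, x)"] ev_Br[OF E z] z by simp

text \<open>The result is named by the point \<open>p'\<close> lying over it under \<open>E\<close>,
  which keeps the inverse of \<open>E\<close> out of later computations.\<close>

lemma ev_inside_in:
  assumes E: "E \<in> BT 1 2" and A: "A \<in> Hom 1 1" and z: "p \<in> copies 1" "x \<in> carrier G"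
    and p: "E p = (0, \<kappa>)" "ev A ((0, \<kappa>), x) = (E p', x')" "p' \<in> copies 1"
  shows "ev (inside E A) (p, x) = (p', x')"
proof -
  have \<kappa>: "\<kappa> \<in> cube" using brin_thompson_closed[OF E z(1)] p(1) by simp
  have "ev (A \<boxplus> Id 1) ((0, \<kappa>), x) = (E p', x')"
    using ev_sum_left[OF A Id_Hom, of 1 0 \<kappa> x] \<kappa> z(2) p(2) by simp
  moreover have "x' \<in> carrier G" using ev_closed[OF A, of "((0, \<kappa>), x)"] \<kappa> z(2) p(2) by simp
  ultimately show ?thesis
    unfolding ev_inside[OF E A z]
    using p(1) ev_Br[OF bt_inv_closed[OF E] brin_thompson_closed[OF E p(3)]] bt_inv_left[OF E p(3)] by simp
qed

lemma ev_inside_out: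
  assumes E: "E \<in> BT 1 2" and A: "A \<in> Hom 1 1" and z: "p \<in> copies 1" "x \<in> carrier G"
    and p: "E p = (1, \<kappa>)"
  shows "ev (inside E A) (p, x) = (p, x)"
proof -
  have \<kappa>: "\<kappa> \<in> cube" using brin_thompson_closed[OF E z(1)] p(1) by simp
  have "ev (Id 1) ((0, \<kappa>), x) = ((0, \<kappa>), x)" using \<kappa> z by (intro ev_Id) auto
  then have "ev (A \<boxplus> Id 1) ((1 + 0, \<kappa>), x) = ((1 + 0, \<kappa>), x)"
    using ev_sum_right[OF A Id_Hom, of 1 0 \<kappa> x 0 \<kappa> x] \<kappa> z(2) by simp
  then show ?thesis
    unfolding ev_inside[OF E A z]
    using p ev_Br[OF bt_inv_closed[OF E] brin_thompson_closed[OF E z(1)] z(2)] bt_inv_left[OF E z(1)] by simp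
qed

lemma ev_in_copies1:
  assumes "A \<in> Hom 1 1" "\<kappa> \<in> cube" "x \<in> carrier G"
  obtains \<kappa>' x' where "ev A ((0, \<kappa>), x) = ((0, \<kappa>'), x')" "\<kappa>' \<in> cube" "x' \<in> carrier G"
proof -
  have "ev A ((0, \<kappa>), x) \<in> pts 1" using assms by (intro ev_closed) auto
  then show thesis by (rule pts_cases) (use that in simp)
qed

lemma ev_inside_inE:
  assumes E: "E \<in> BT 1 2" and A: "A \<in> Hom 1 1" and z: "p \<in> copies 1" "x \<in> carrier G" and p: "E p = (0, \<kappa>)"
  obtains \<kappa>' p' x' where "ev A ((0, \<kappa>), x) = ((0, \<kappa>'), x')" "E p' = (0, \<kappa>')" "p' \<in> copies 1" "x' \<in> carrier G"
    "\<kappa>' \<in> cube" "ev (inside E A) (p, x) = (p', x')"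
proof -
  have \<kappa>: "\<kappa> \<in> cube" using brin_thompson_closed[OF E z(1)] p(1) by simp
  obtain \<kappa>' x' where A': "ev A ((0, \<kappa>), x) = ((0, \<kappa>'), x')" "\<kappa>' \<in> cube" "x' \<in> carrier G"
    using ev_in_copies1[OF A \<kappa> z(2)] .
  define p' where "p' = bt_inv 1 E 2 (0, \<kappa>')"
  have p': "p' \<in> copies 1" "E p' = (0, \<kappa>')"
    using brin_thompson_closed[OF bt_inv_closed[OF E]] bt_inv_right[OF E] A'(2) by (auto simp: p'_def)
  then show thesis using ev_inside_in[OF E A z p, of p' x'] A' that by simp
qed

lemma inside_comp:
  assumes E: "E \<in> BT 1 2" and A: "A \<in> Hom 1 1" and B: "B \<in> Hom 1 1"
  shows "inside E (A \<bullet> B) = inside E A \<bullet> inside E B"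
proof (rule ev_eqI[OF inside_Hom[OF E comp_Hom[OF A B]] comp_Hom[OF inside_Hom[OF E A] inside_Hom[OF E B]]])
  fix z assume "z \<in> pts 1"
  then obtain p x where z: "z = (p, x)" "p \<in> copies 1" "x \<in> carrier G" by auto
  have c: "ev (inside E A \<bullet> inside E B) z = ev (inside E A) (ev (inside E B) z)"
    using ev_comp[OF inside_Hom[OF E A] inside_Hom[OF E B]] z by simp
  from E z(2) show "ev (inside E (A \<bullet> B)) z = ev (inside E A \<bullet> inside E B) z"
  proof (cases rule: BT2_cases)
    case (1 \<kappa>)
    obtain \<kappa>1 p1 x1 where b: "ev B ((0, \<kappa>), x) = ((0, \<kappa>1), x1)" "E p1 = (0, \<kappa>1)" "p1 \<in> copies 1" "x1 \<in> carrier G"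
      "\<kappa>1 \<in> cube" "ev (inside E B) (p, x) = (p1, x1)" using ev_inside_inE[OF E B z(2,3) 1(1)] by metis
    obtain \<kappa>2 p2 x2 where a: "ev A ((0, \<kappa>1), x1) = ((0, \<kappa>2), x2)" "E p2 = (0, \<kappa>2)" "p2 \<in> copies 1" "x2 \<in> carrier G"
      "\<kappa>2 \<in> cube" "ev (inside E A) (p1, x1) = (p2, x2)" using ev_inside_inE[OF E A b(3,4,2)] by metis
    have "ev (A \<bullet> B) ((0, \<kappa>), x) = (E p2, x2)"
      using ev_comp[OF A B, of "((0, \<kappa>), x)"] 1(2) z(3) b(1) a(1,2) by simp
    then show ?thesis
      using ev_inside_in[OF E comp_Hom[OF A B] z(2,3) 1(1) _ a(3)] c b(6) a(6) z(1) by simp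
  next
    case (2 \<kappa>)
    then show ?thesis
      using c ev_inside_out[OF E A z(2,3) 2(1)] ev_inside_out[OF E B z(2,3) 2(1)]
        ev_inside_out[OF E comp_Hom[OF A B] z(2,3) 2(1)] z(1) by simp
  qed
qed

end

section \<open>Homomorphisms insensitive to squeezing\<close>

text \<open>
  \<open>\<Theta>_inside\<close> is the common generalisation of the two homomorphisms needed: \<open>A \<mapsto> [inside D A]\<close>, which is
  unchanged by squeezing, and, once that one is known to be trivial, \<open>A \<mapsto> [A]\<close>, which is killed by it.
\<close>

locale halving_invariant = twisted G S \<phi> + Q: group Q
  for G :: "('g, 'm) monoid_scheme" (structure) and S :: "'s set" and \<phi> :: "'g \<Rightarrow> 's \<Rightarrow> 's"
    and Q :: "('q, 'r) monoid_scheme" +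
  fixes \<Theta> :: "('g, 's) sv_term set \<Rightarrow> 'q"
  assumes \<Theta>_closed: "A \<in> Hom 1 1 \<Longrightarrow> \<Theta> A \<in> carrier Q"
    and \<Theta>_mult: "A \<in> Hom 1 1 \<Longrightarrow> B \<in> Hom 1 1 \<Longrightarrow> \<Theta> (A \<bullet> B) = \<Theta> A \<otimes>\<^bsub>Q\<^esub> \<Theta> B"
    and \<Theta>_inside: "A \<in> Hom 1 1 \<Longrightarrow>
      (\<forall>E\<in>BT 1 2. \<Theta> (inside E A) = \<Theta> A) \<or> (\<forall>E\<in>BT 1 2. \<Theta> (inside E A) = \<one>\<^bsub>Q\<^esub>)"
begin

lemma \<Theta>_Id: "\<Theta> (Id 1) = \<one>\<^bsub>Q\<^esub>"
proof -
  have H: "Id 1 \<in> Hom 1 1" by (simp add: Id_Hom)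
  have "\<Theta> (Id 1) \<otimes>\<^bsub>Q\<^esub> \<Theta> (Id 1) = \<Theta> (Id 1)" using \<Theta>_mult[OF H H] Id_left[OF H] by simp
  then show ?thesis using \<Theta>_closed[OF H] by (metis Q.l_cancel_one)
qed

lemma \<Theta>_inside_one: "A \<in> Hom 1 1 \<Longrightarrow> \<Theta> A = \<one>\<^bsub>Q\<^esub> \<Longrightarrow> E \<in> BT 1 2 \<Longrightarrow> \<Theta> (inside E A) = \<one>\<^bsub>Q\<^esub>"
  using \<Theta>_inside by fastforce

text \<open>In the first alternative of \<open>\<Theta>_inside\<close> the hypothesis
  \<open>eq\<close> reads \<open>x = x x\<close> in a group; in the second it reads
  \<open>x = 1\<close>.\<close>

lemma \<Theta>_halves:
  assumes A: "A \<in> Hom 1 1" and E: "E \<in> BT 1 2" "E' \<in> BT 1 2"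
    and eq: "\<Theta> A = \<Theta> (inside E A) \<otimes>\<^bsub>Q\<^esub> \<Theta> (inside E' A)"
  shows "\<Theta> A = \<one>\<^bsub>Q\<^esub>"
  using \<Theta>_inside[OF A]
proof
  assume "\<forall>E\<in>BT 1 2. \<Theta> (inside E A) = \<Theta> A"
  then have same: "\<Theta> (inside E A) = \<Theta> A" "\<Theta> (inside E' A) = \<Theta> A" using E by (blast, blast)
  have "\<Theta> A \<otimes>\<^bsub>Q\<^esub> \<Theta> A = \<Theta> A" using eq[symmetric] unfolding same .
  then show ?thesis using \<Theta>_closed[OF A] by (metis Q.l_cancel_one)
next
  assume "\<forall>E\<in>BT 1 2. \<Theta> (inside E A) = \<one>\<^bsub>Q\<^esub>"
  then show ?thesis using eq E by simp
qed

section \<open>Triviality on Brin-Thompson elements\<close>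

abbreviation \<theta> :: "('s copies_point \<Rightarrow> 's copies_point) \<Rightarrow> 'q" where
  "\<theta> f \<equiv> \<Theta> (Br 1 1 f)"

lemma \<theta>_closed: "f \<in> BT 1 1 \<Longrightarrow> \<theta> f \<in> carrier Q"
  by (intro \<Theta>_closed Br_Hom)

lemma \<theta>_compose: "f \<in> BT 1 1 \<Longrightarrow> g \<in> BT 1 1 \<Longrightarrow> \<theta> (compose (copies 1) f g) = \<theta> f \<otimes>\<^bsub>Q\<^esub> \<theta> g"
  using \<Theta>_mult[OF Br_Hom Br_Hom] Br_comp by simp

lemma \<theta>_id: "\<theta> (bt_id S 1) = \<one>\<^bsub>Q\<^esub>"
  using \<Theta>_Id by (simp add: Id_def)

text \<open>Fusing pieces \<open>i\<close> and \<open>j\<close> along \<open>s\<close> turns their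
  exchange into a flip; everything else lies in the second half of \<open>E'\<close> and is
  fixed.\<close>

lemma conj_transpose_inside:
  assumes E: "E \<in> BT 1 n" and n: "3 \<le> n" "i < n" "j < n" "i \<noteq> j" and s: "s \<in> S"
  obtains E' where "E' \<in> BT 1 2" "Br 1 1 (conj_perm n E (Transposition.transpose i j)) = inside E' (Br 1 1 (flip s))"
proof -
  obtain E' where "merges2 n E i j s E'" using ex_merges2[OF E n s] by blast
  note M = merges2D[OF this]
  have E': "E' \<in> BT 1 2" using M(1)[of "(0, \<lambda>s\<in>S. undefined)"] cube_nonempty by simp
  have \<tau>: "Transposition.transpose i j permutes {..<n}" using n by (intro permutes_swap_id) auto
  let ?f = "conj_perm n E (Transposition.transpose i j)"
  note f = conj_perm_BT[OF E \<tau>]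
  have "Br 1 1 ?f = inside E' (Br 1 1 (flip s))"
  proof (rule ev_eqI[OF Br_Hom[OF f] inside_Hom[OF E' Br_Hom[OF flip_BT[OF s]]]])
    fix z :: "'s copies_point \<times> 'g" assume "z \<in> pts 1"
    then obtain p x where z: "z = (p, x)" "p \<in> copies 1" "x \<in> carrier G" by auto
    obtain k \<kappa> where k: "E p = (k, \<kappa>)" by (cases "E p")
    have kn: "\<kappa> \<in> cube" using brin_thompson_closed[OF E z(2)] k by simp
    note fp = brin_thompson_closed[OF f z(2)]
    note Ef = conj_perm_apply[OF E \<tau> z(2) k]
    have "ev (inside E' (Br 1 1 (flip s))) (p, x) = (?f p, x)"
    proof (cases "k = i \<or> k = j")
      case True
      then obtain b where b: "E' p = (0, scons s b \<kappa>)" "E' (?f p) = (0, scons s (\<not> b) \<kappa>)"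
        using M(2,3)[OF z(2)] M(2,3)[OF fp] k Ef n(4) by fastforce
      have "ev (Br 1 1 (flip s)) ((0, scons s b \<kappa>), x) = (E' (?f p), x)"
        using ev_Br[OF flip_BT[OF s], of "(0, scons s b \<kappa>)" x] z(3) scons_cube[OF s kn] flip_scons[OF s kn] b(2)
        by simp
      then show ?thesis by (rule ev_inside_in[OF E' Br_Hom[OF flip_BT[OF s]] z(2,3) b(1) _ fp])
    next
      case False
      then have "E (?f p) = E p" using Ef k by (simp add: transpose_def)
      then have "?f p = p" using bt_inj[OF E fp z(2)] by blast
      moreover have "E' p = (1, snd (E' p))" using M(4)[OF z(2) k] False by (metis prod.collapse)
      ultimately show ?thesis using ev_inside_out[OF E' Br_Hom[OF flip_BT[OF s]] z(2,3)] by metis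
    qed
    then show "ev (Br 1 1 ?f) z = ev (inside E' (Br 1 1 (flip s))) z"
      using ev_Br[OF f z(2,3)] z(1) by simp
  qed
  then show thesis using that E' by blast
qed

lemma split4_cases:
  assumes s: "s \<in> S" and p: "p \<in> copies 1"
  obtains b c \<kappa> where "p = (0, scons s b (scons s c \<kappa>))" "\<kappa> \<in> cube"
proof -
  obtain \<kappa>0 where 0: "p = (0, \<kappa>0)" "\<kappa>0 \<in> cube" using copies1_cases[OF p] .
  obtain b \<kappa>1 where 1: "\<kappa>1 \<in> cube" "\<kappa>0 = scons s b \<kappa>1" using scons_cases[OF s 0(2)] by metis
  obtain c \<kappa> where "\<kappa> \<in> cube" "\<kappa>1 = scons s c \<kappa>" using scons_cases[OF s 1(1)] by metis
  then show thesis using that 0 1 by blast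
qed

text \<open>On quarters, flipping the first letter exchanges 0 with 2 and 1 with 3. Each exchange
  alone is a squeezed flip, so the flip is a product of two squeezed copies of itself.\<close>

lemma \<theta>_flip:
  assumes s: "s \<in> S"
  shows "\<theta> (flip s) = \<one>\<^bsub>Q\<^esub>"
proof -
  let ?\<sigma> = "Transposition.transpose 0 (2::nat)" and ?\<tau> = "Transposition.transpose 1 (3::nat)"
  note x = split4_BT[OF s]
  have \<sigma>: "?\<sigma> permutes {..<4}" by (rule permutes_swap_id) auto
  have \<tau>: "?\<tau> permutes {..<4}" by (rule permutes_swap_id) auto
  obtain E where E: "E \<in> BT 1 2" "Br 1 1 (conj_perm 4 (split4 s) ?\<sigma>) = inside E (Br 1 1 (flip s))"
    by (rule conj_transpose_inside[OF x _ _ _ _ s, of 0 2]) auto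
  obtain E' where E': "E' \<in> BT 1 2" "Br 1 1 (conj_perm 4 (split4 s) ?\<tau>) = inside E' (Br 1 1 (flip s))"
    by (rule conj_transpose_inside[OF x _ _ _ _ s, of 1 3]) auto
  have "conj_perm 4 (split4 s) (?\<sigma> \<circ> ?\<tau>) = flip s"
    unfolding conj_perm_def
  proof (rule quot_eqI[OF x permute_BT[OF x permutes_compose[OF \<tau> \<sigma>]] flip_BT[OF s]])
    fix p :: "'s copies_point" assume p: "p \<in> copies 1"
    obtain b c \<kappa> where k: "p = (0, scons s b (scons s c \<kappa>))" "\<kappa> \<in> cube" using split4_cases[OF s p] .
    have "split4 s (flip s p) = ((if \<not> b then 2 else 0) + (if c then 1 else 0), \<kappa>)"
      unfolding k(1) flip_scons[OF s scons_cube[OF s k(2)]] by (rule split4_scons[OF s k(2)])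
    moreover have "permute 4 (split4 s) (?\<sigma> \<circ> ?\<tau>) p = ((?\<sigma> \<circ> ?\<tau>) ((if b then 2 else 0) + (if c then 1 else 0)), \<kappa>)"
      by (rule permute_apply[OF x p]) (simp only: k(1) split4_scons[OF s k(2)])
    ultimately show "split4 s (flip s p) = permute 4 (split4 s) (?\<sigma> \<circ> ?\<tau>) p"
      by (cases b; cases c) (simp_all add: transpose_def)
  qed
  then have "\<theta> (flip s) = \<Theta> (inside E (Br 1 1 (flip s))) \<otimes>\<^bsub>Q\<^esub> \<Theta> (inside E' (Br 1 1 (flip s)))"
    using conj_perm_compose[OF x \<sigma> \<tau>] \<theta>_compose[OF conj_perm_BT[OF x \<sigma>] conj_perm_BT[OF x \<tau>]] E(2) E'(2)
    by simp
  then show ?thesis by (rule \<Theta>_halves[OF Br_Hom[OF flip_BT[OF s]] E(1) E'(1)])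
qed

text \<open>The hypothesis \<open>eq\<close> says that \<open>g\<close> is \<open>h^-1 f h\<close>,
  and kernels are closed under conjugation.\<close>

lemma \<theta>_conj_trivial:
  assumes h: "h \<in> BT 1 1" and f: "f \<in> BT 1 1" "\<theta> f = \<one>\<^bsub>Q\<^esub>" and g: "g \<in> BT 1 1"
    and eq: "\<And>p. p \<in> copies 1 \<Longrightarrow> h (g p) = f (h p)"
  shows "\<theta> g = \<one>\<^bsub>Q\<^esub>"
proof -
  have "compose (copies 1) h g = compose (copies 1) f h"
    by (rule bt_ext[OF brin_thompson_compose[OF g h] brin_thompson_compose[OF h f(1)]])
       (simp add: compose_def eq del: One_nat_def)
  then have "\<theta> h \<otimes>\<^bsub>Q\<^esub> \<theta> g = \<theta> h"
    using \<theta>_compose[OF h g] \<theta>_compose[OF f(1) h] f(2) \<theta>_closed[OF h] by simp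
  then show ?thesis using \<theta>_closed[OF h] \<theta>_closed[OF g] Q.l_cancel_one by blast
qed

lemma \<theta>_conj_transpose:
  assumes E: "E \<in> BT 1 n" and n: "i < n" "j < n" "i \<noteq> j"
  shows "\<theta> (conj_perm n E (Transposition.transpose i j)) = \<one>\<^bsub>Q\<^esub>"
proof -
  obtain s where s: "s \<in> S" using S_nonempty by blast
  show ?thesis
  proof (cases "3 \<le> n")
    case True
    obtain E' where "E' \<in> BT 1 2"
      "Br 1 1 (conj_perm n E (Transposition.transpose i j)) = inside E' (Br 1 1 (flip s))"
      using conj_transpose_inside[OF E True n s] .
    then show ?thesis using \<Theta>_inside_one[OF Br_Hom[OF flip_BT[OF s]] \<theta>_flip[OF s]] by simp
  next
    case False
    then have n2: "n = 2" and tr: "Transposition.transpose i j = Transposition.transpose 0 1"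
      using n by (auto simp: transpose_def fun_eq_iff)
    note x = bt_split[OF s] and E2 = E[unfolded n2]
    \<comment> \<open>Two pieces leave no room for \<open>ex_merges2\<close>, but their exchange is
      conjugate to \<open>flip s\<close> by the map matching the two cuts.\<close>
    define h where "h = quot 2 (simple_split S s) E"
    have h: "h \<in> BT 1 1" unfolding h_def by (rule quot_BT[OF x E2])
    let ?g = "conj_perm 2 E (Transposition.transpose 0 1)"
    note g = conj_perm_BT[OF E2 swap01]
    have "\<theta> ?g = \<one>\<^bsub>Q\<^esub>"
    proof (rule \<theta>_conj_trivial[OF h flip_BT[OF s] \<theta>_flip[OF s] g])
      fix p :: "'s copies_point" assume p: "p \<in> copies 1"
      obtain k \<kappa> where k: "E p = (k, \<kappa>)" by (cases "E p")
      note hp = brin_thompson_closed[OF h p] and gp = brin_thompson_closed[OF g p]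
      have "simple_split S s (h p) = (k, \<kappa>)" unfolding h_def quot_apply[OF x E2 p] k ..
      then have "simple_split S s (flip s (h p)) = (Transposition.transpose 0 1 k, \<kappa>)"
        unfolding flip_def by (rule conj_perm_apply[OF x swap01 hp])
      moreover have "simple_split S s (h (?g p)) = (Transposition.transpose 0 1 k, \<kappa>)"
        unfolding h_def quot_apply[OF x E2 gp] by (rule conj_perm_apply[OF E2 swap01 p k])
      ultimately show "h (?g p) = flip s (h p)"
        using bt_inj[OF x brin_thompson_closed[OF h gp] brin_thompson_closed[OF flip_BT[OF s] hp]] by simp
    qed
    then show ?thesis unfolding n2 tr .
  qed
qed

lemma \<theta>_conj_perm:
  assumes E: "E \<in> BT 1 n" and \<sigma>: "\<sigma> permutes {..<n}"
  shows "\<theta> (conj_perm n E \<sigma>) = \<one>\<^bsub>Q\<^esub>"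
  using \<sigma> finite_lessThan
proof (induction rule: permutes_induct)
  case id
  have "conj_perm n E id = bt_id S 1"
    unfolding conj_perm_def
  proof (rule quot_eqI[OF E permute_BT[OF E permutes_id] bt_id_closed])
    fix p :: "'s copies_point" assume p: "p \<in> copies 1"
    obtain k \<kappa> where k: "E p = (k, \<kappa>)" by (cases "E p")
    show "E (bt_id S 1 p) = permute n E id p" using permute_apply[OF E p k] k p by simp
  qed simp
  then show ?case by (simp only: \<theta>_id)
next
  case (swap a b p)
  have p: "p permutes {..<n}" and IH: "\<theta> (conj_perm n E p) = \<one>\<^bsub>Q\<^esub>"
    and ab: "a < n" "b < n" "a \<noteq> b" using swap by simp_all
  have \<tau>: "Transposition.transpose a b permutes {..<n}" using ab by (intro permutes_swap_id) auto
  show ?case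
    unfolding conj_perm_compose[OF E \<tau> p] \<theta>_compose[OF conj_perm_BT[OF E \<tau>] conj_perm_BT[OF E p]]
      IH \<theta>_conj_transpose[OF E ab]
    by simp
qed

text \<open>The element \<open>x_s^-1 x_t\<close>: it takes the first letter of coordinate
  \<open>t\<close> and puts it in front of coordinate \<open>s\<close>.\<close>

definition resplit :: "'s \<Rightarrow> 's \<Rightarrow> 's copies_point \<Rightarrow> 's copies_point" where
  "resplit s t = quot 2 (simple_split S s) (simple_split S t)"

lemma resplit_BT: "s \<in> S \<Longrightarrow> t \<in> S \<Longrightarrow> resplit s t \<in> BT 1 1"
  unfolding resplit_def by (rule quot_BT[OF bt_split bt_split])

lemma resplit_scons:
  assumes s: "s \<in> S" and t: "t \<in> S" and \<kappa>: "\<kappa> \<in> cube"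
  shows "resplit s t (0, scons t b \<kappa>) = (0, scons s b \<kappa>)"
proof -
  have p: "(0, scons t b \<kappa>) \<in> copies 1" and q: "(0, scons s b \<kappa>) \<in> copies 1"
    using s t \<kappa> by (simp_all add: scons_cube)
  have "simple_split S s (resplit s t (0, scons t b \<kappa>)) = simple_split S s (0, scons s b \<kappa>)"
    unfolding resplit_def quot_apply[OF bt_split[OF s] bt_split[OF t] p]
    by (simp only: simple_split_scons[OF s \<kappa>] simple_split_scons[OF t \<kappa>])
  then show ?thesis
    by (rule bt_inj[OF bt_split[OF s] brin_thompson_closed[OF resplit_BT[OF s t] p] q])
qed

text \<open>On a point with first letters \<open>b\<close> at \<open>s\<close> and \<open>c\<close>
  at \<open>t\<close>, \<open>resplit s t\<close> puts \<open>c b\<close> at the start of coordinate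
  \<open>s\<close>; exchanging quarters 1 and 2 turns this into \<open>b c\<close>. The product
  keeps \<open>b\<close> and acts as \<open>resplit s t\<close> behind it, so it consists of two
  squeezed copies, while the exchange is already trivial.\<close>

lemma \<theta>_resplit:
  assumes s: "s \<in> S" and t: "t \<in> S"
  shows "\<theta> (resplit s t) = \<one>\<^bsub>Q\<^esub>"
proof (cases "s = t")
  case True
  have "resplit s t = bt_id S 1"
    unfolding resplit_def True
    by (rule quot_eqI[OF bt_split[OF t] bt_split[OF t] bt_id_closed]) simp_all
  then show ?thesis by (simp only: \<theta>_id)
next
  case False
  let ?A = "Br 1 1 (resplit s t)"
  note f = resplit_BT[OF s t]
  note A = Br_Hom[OF f]
  let ?\<sigma> = "Transposition.transpose 1 (2::nat)"
  have \<sigma>: "?\<sigma> permutes {..<4}" by (rule permutes_swap_id) auto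
  let ?g = "conj_perm 4 (split4 s) ?\<sigma>"
  note x4 = split4_BT[OF s]
  note g = conj_perm_BT[OF x4 \<sigma>]
  \<comment> \<open>The same cut with its halves renumbered, so that \<open>inside ?E'\<close>
    squeezes into the half where the letter at \<open>s\<close> is 1.\<close>
  let ?E = "simple_split S s" and ?E' = "permute 2 (simple_split S s) (Transposition.transpose 0 1)"
  note E = bt_split[OF s]
  note E' = permute_BT[OF E swap01]
  have "Br 1 1 ?g \<bullet> ?A = inside ?E ?A \<bullet> inside ?E' ?A"
  proof (rule ev_eqI[OF comp_Hom[OF Br_Hom[OF g] A] comp_Hom[OF inside_Hom[OF E A] inside_Hom[OF E' A]]])
    fix z :: "'s copies_point \<times> 'g" assume "z \<in> pts 1"
    then obtain p0 x where z: "z = (p0, x)" "p0 \<in> copies 1" "x \<in> carrier G" by auto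
    obtain \<kappa>0 where 0: "p0 = (0, \<kappa>0)" "\<kappa>0 \<in> cube" using copies1_cases[OF z(2)] .
    obtain b \<kappa>1 where 1: "\<kappa>1 \<in> cube" "\<kappa>0 = scons s b \<kappa>1" using scons_cases[OF s 0(2)] by metis
    obtain c \<kappa> where k: "\<kappa> \<in> cube" "\<kappa>1 = scons t c \<kappa>" using scons_cases[OF t 1(1)] by metis
    define q where "q = (0::nat, scons s b (scons s c \<kappa>))"
    have q: "q \<in> copies 1" using s k by (simp add: q_def scons_cube)
    have m: "(0, scons s c (scons s b \<kappa>)) \<in> copies 1" using s k by (simp add: scons_cube)
    have "resplit s t p0 = (0, scons s c (scons s b \<kappa>))"
      unfolding 0 1 k scons_commute[OF False] by (rule resplit_scons[OF s t scons_cube[OF s k(1)]])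
    then have ev1: "ev (Br 1 1 ?g \<bullet> ?A) z = (?g (0, scons s c (scons s b \<kappa>)), x)"
      using ev_comp[OF Br_Hom[OF g] A, of z] z ev_Br[OF f z(2,3)] ev_Br[OF g m z(3)] by simp
    have "split4 s (?g (0, scons s c (scons s b \<kappa>))) = split4 s q"
      unfolding q_def split4_scons[OF s k(1)]
      using conj_perm_apply[OF x4 \<sigma> m split4_scons[OF s k(1)]]
      by (cases b; cases c) (simp_all add: transpose_def)
    then have gq: "?g (0, scons s c (scons s b \<kappa>)) = q"
      by (rule bt_inj[OF x4 brin_thompson_closed[OF g m] q])
    have sp: "?E p0 = (if b then 1 else 0, \<kappa>1)" "?E q = (if b then 1 else 0, scons s c \<kappa>)"
      unfolding 0 1(2) q_def
      by (rule simple_split_scons[OF s 1(1)], rule simple_split_scons[OF s scons_cube[OF s k(1)]])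
    have Aq: "ev ?A ((0, \<kappa>1), x) = ((0, scons s c \<kappa>), x)"
      using ev_Br[OF f, of "(0, \<kappa>1)" x] z(3) 1(1) unfolding k(2) by (simp add: resplit_scons[OF s t k(1)])
    have c2: "ev (inside ?E ?A \<bullet> inside ?E' ?A) z = ev (inside ?E ?A) (ev (inside ?E' ?A) (p0, x))"
      using ev_comp[OF inside_Hom[OF E A] inside_Hom[OF E' A]] z by simp
    have "ev (inside ?E ?A) (ev (inside ?E' ?A) (p0, x)) = (q, x)"
    proof (cases b)
      case True
      have "?E' p0 = (0, \<kappa>1)" "?E' q = (0, scons s c \<kappa>)"
        using permute_apply[OF E z(2) sp(1)] permute_apply[OF E q sp(2)] True by simp_all
      then have "ev (inside ?E' ?A) (p0, x) = (q, x)"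
        using ev_inside_in[OF E' A z(2,3) _ _ q, of \<kappa>1 x] Aq by simp
      moreover have "?E q = (1, scons s c \<kappa>)" using sp(2) True by simp
      ultimately show ?thesis using ev_inside_out[OF E A q z(3)] by simp
    next
      case b: False
      have "?E' p0 = (1, \<kappa>1)" using permute_apply[OF E z(2) sp(1)] b by simp
      then have "ev (inside ?E' ?A) (p0, x) = (p0, x)" by (rule ev_inside_out[OF E' A z(2,3)])
      moreover have "?E p0 = (0, \<kappa>1)" "?E q = (0, scons s c \<kappa>)" using sp b by simp_all
      ultimately show ?thesis using ev_inside_in[OF E A z(2,3) _ _ q, of \<kappa>1 x] Aq by simp
    qed
    then show "ev (Br 1 1 ?g \<bullet> ?A) z = ev (inside ?E ?A \<bullet> inside ?E' ?A) z"
      using ev1 gq c2 by simp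
  qed
  then have "\<theta> ?g \<otimes>\<^bsub>Q\<^esub> \<Theta> ?A = \<Theta> (inside ?E ?A) \<otimes>\<^bsub>Q\<^esub> \<Theta> (inside ?E' ?A)"
    using \<Theta>_mult[OF Br_Hom[OF g] A] \<Theta>_mult[OF inside_Hom[OF E A] inside_Hom[OF E' A]] by simp
  then have "\<Theta> ?A = \<Theta> (inside ?E ?A) \<otimes>\<^bsub>Q\<^esub> \<Theta> (inside ?E' ?A)"
    using \<theta>_conj_perm[OF x4 \<sigma>] \<Theta>_closed[OF A] by simp
  then show ?thesis by (rule \<Theta>_halves[OF A E E'])
qed

lemma split0_cases:
  assumes n: "1 \<le> n" and s: "s \<in> S" "t \<in> S" and q: "(k, \<kappa>) \<in> copies n"
  shows "(\<exists>b \<kappa>'. k = 0 \<and> \<kappa>' \<in> cube \<and> \<kappa> = scons t b \<kappa>' \<and>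
      split0 n t (k, \<kappa>) = split0 n s (0, scons s b \<kappa>')) \<or> (k \<noteq> 0 \<and> split0 n t (k, \<kappa>) = split0 n s (k, \<kappa>))"
proof (cases k)
  case 0
  have "\<kappa> \<in> cube" using q by simp
  then obtain b \<kappa>' where *: "\<kappa>' \<in> cube" "\<kappa> = scons t b \<kappa>'" using scons_cases[OF s(2)] by metis
  have "split0 n t (k, \<kappa>) = split0 n s (0, scons s b \<kappa>')"
    unfolding 0 *(2) split0_scons[OF n s(1) *(1)] split0_scons[OF n s(2) *(1)] ..
  then show ?thesis using 0 * by blast
next
  case (Suc k')
  then show ?thesis using q by (simp add: split0_Suc)
qed

text \<open>Let the last splits be \<open>R = \<sigma> x_s R'\<close> and
  \<open>D = \<tau> x_t D'\<close>. Then \<open>R^-1 D\<close> is the product of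
  \<open>R'^-1 D'\<close>, trivial by induction, of a permutation of pieces, and of a copy of
  \<open>x_s^-1 x_t\<close> acting on leaf 0 of \<open>D'\<close>.\<close>

lemma \<theta>_trees:
  "forest 1 n R \<Longrightarrow> forest 1 n D \<Longrightarrow> \<theta> (quot n R D) = \<one>\<^bsub>Q\<^esub>"
proof (induction n arbitrary: R D)
  case 0
  then show ?case using brin_thompsonD(3)[OF forest_BT[OF 0(1)]] by simp
next
  case (Suc n)
  note RB = forest_BT[OF Suc.prems(1)] and DB = forest_BT[OF Suc.prems(2)]
  show ?case
  proof (cases "n = 0")
    case True
    have "R = bt_id S 1" "D = bt_id S 1"
      using tree_cases[OF Suc.prems(1)] tree_cases[OF Suc.prems(2)] True by auto
    then have "quot (Suc n) R D = bt_id S 1"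
      using True by (intro quot_eqI RB DB bt_id_closed) auto
    then show ?thesis by (simp only: \<theta>_id)
  next
    case False
    then have n: "1 \<le> n" by simp
    obtain \<sigma> s R' where R: "\<sigma> permutes {..<Suc n}" "s \<in> S" "forest 1 n R'"
      "R = permute (Suc n) (compose (copies 1) (split0 n s) R') \<sigma>"
      using tree_cases[OF Suc.prems(1)] False by (auto simp: permute_def)
    obtain \<tau> t D' where D: "\<tau> permutes {..<Suc n}" "t \<in> S" "forest 1 n D'"
      "D = permute (Suc n) (compose (copies 1) (split0 n t) D') \<tau>"
      using tree_cases[OF Suc.prems(2)] False by (auto simp: permute_def)
    note R' = forest_BT[OF R(3)] and D' = forest_BT[OF D(3)]
    define R1 where "R1 = compose (copies 1) (split0 n s) R'"
    define D1 where "D1 = compose (copies 1) (split0 n t) D'"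
    \<comment> \<open>The intermediate tree: the last split of \<open>R\<close> applied to
      \<open>D'\<close>. It allows the smaller tree, the permutation and the color to be changed one
      at a time.\<close>
    define Z where "Z = compose (copies 1) (split0 n s) D'"
    note xs = bt_split0[OF n R(2)] and xt = bt_split0[OF n D(2)]
    have R1: "R1 \<in> BT 1 (Suc n)" and D1: "D1 \<in> BT 1 (Suc n)" and Z: "Z \<in> BT 1 (Suc n)"
      unfolding R1_def D1_def Z_def
      by (rule brin_thompson_compose[OF R' xs], rule brin_thompson_compose[OF D' xt],
          rule brin_thompson_compose[OF D' xs])
    let ?\<rho> = "inv_into UNIV \<sigma> \<circ> \<tau>"
    have \<rho>: "?\<rho> permutes {..<Suc n}" by (rule permutes_compose[OF D(1) permutes_inv[OF R(1)]])
    define f1 where "f1 = quot n R' D'"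
    define f2 where "f2 = conj_perm (Suc n) Z ?\<rho>"
    define f3 where "f3 = quot (Suc n) Z D1"
    have f: "f1 \<in> BT 1 1" "f2 \<in> BT 1 1" "f3 \<in> BT 1 1"
      unfolding f1_def f2_def f3_def
      by (rule quot_BT[OF R' D'], rule conj_perm_BT[OF Z \<rho>], rule quot_BT[OF Z D1])
    have R1f1: "R1 (f1 p) = Z p" if p: "p \<in> copies 1" for p
      using quot_apply[OF R' D' p] brin_thompson_closed[OF f(1) p] p
      by (simp add: R1_def Z_def f1_def compose_def del: One_nat_def)
    have "quot (Suc n) R D = compose (copies 1) f1 (compose (copies 1) f2 f3)"
    proof (rule quot_eqI[OF RB DB brin_thompson_compose[OF brin_thompson_compose[OF f(3,2)] f(1)]])
      fix p :: "'s copies_point" assume p: "p \<in> copies 1"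
      obtain k \<kappa> where k: "D1 p = (k, \<kappa>)" by (cases "D1 p")
      note p3 = brin_thompson_closed[OF f(3) p]
      note p2 = brin_thompson_closed[OF f(2) p3]
      note p1 = brin_thompson_closed[OF f(1) p2]
      have "Z (f3 p) = (k, \<kappa>)" unfolding f3_def quot_apply[OF Z D1 p] k ..
      then have "Z (f2 (f3 p)) = (?\<rho> k, \<kappa>)" unfolding f2_def by (rule conj_perm_apply[OF Z \<rho> p3])
      then have "R1 (f1 (f2 (f3 p))) = (?\<rho> k, \<kappa>)" using R1f1[OF p2] by simp
      then have "R (f1 (f2 (f3 p))) = (\<sigma> (?\<rho> k), \<kappa>)"
        unfolding R(4) R1_def[symmetric] by (rule permute_apply[OF R1 p1])
      also have "\<sigma> (?\<rho> k) = \<tau> k" using permutes_inverses(1)[OF R(1)] by simp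
      also have "(\<tau> k, \<kappa>) = D p" unfolding D(4) D1_def[symmetric] using permute_apply[OF D1 p k] by simp
      finally show "R (compose (copies 1) f1 (compose (copies 1) f2 f3) p) = D p"
        using p by (simp add: compose_def)
    qed
    then have "\<theta> (quot (Suc n) R D) = \<theta> f1 \<otimes>\<^bsub>Q\<^esub> (\<theta> f2 \<otimes>\<^bsub>Q\<^esub> \<theta> f3)"
      using \<theta>_compose[OF f(1) brin_thompson_compose[OF f(3,2)]] \<theta>_compose[OF f(2,3)] by simp
    moreover have "\<theta> f1 = \<one>\<^bsub>Q\<^esub>" unfolding f1_def by (rule Suc.IH[OF R(3) D(3)])
    moreover have "\<theta> f2 = \<one>\<^bsub>Q\<^esub>" unfolding f2_def by (rule \<theta>_conj_perm[OF Z \<rho>])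
    moreover have "\<theta> f3 = \<one>\<^bsub>Q\<^esub>"
    proof -
      have f3: "(\<exists>b \<kappa>. \<kappa> \<in> cube \<and> D' p = (0, scons t b \<kappa>) \<and> D' (f3 p) = (0, scons s b \<kappa>)) \<or>
          (fst (D' p) \<noteq> 0 \<and> f3 p = p)" if p: "p \<in> copies 1" for p
      proof -
        note p3 = brin_thompson_closed[OF f(3) p]
        obtain k \<kappa> where k: "D' p = (k, \<kappa>)" by (cases "D' p")
        have kn: "(k, \<kappa>) \<in> copies n" using brin_thompson_closed[OF D' p] k by simp
        have e: "split0 n s (D' (f3 p)) = split0 n t (k, \<kappa>)"
          using quot_apply[OF Z D1 p] p p3 k by (simp add: f3_def Z_def D1_def compose_def del: One_nat_def)
        show ?thesis
          using split0_cases[OF n R(2) D(2) kn]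
        proof
          assume "\<exists>b \<kappa>'. k = 0 \<and> \<kappa>' \<in> cube \<and> \<kappa> = scons t b \<kappa>' \<and>
            split0 n t (k, \<kappa>) = split0 n s (0, scons s b \<kappa>')"
          then obtain b \<kappa>' where *: "k = 0" "\<kappa>' \<in> cube" "\<kappa> = scons t b \<kappa>'"
            "split0 n t (k, \<kappa>) = split0 n s (0, scons s b \<kappa>')" by blast
          have "D' (f3 p) = (0, scons s b \<kappa>')"
            using n * e R(2) by (intro bt_inj[OF xs brin_thompson_closed[OF D' p3]]) (simp_all add: scons_cube)
          then show ?thesis using k * by blast
        next
          assume *: "k \<noteq> 0 \<and> split0 n t (k, \<kappa>) = split0 n s (k, \<kappa>)"
          have "D' (f3 p) = D' p"
            using e * k by (intro bt_inj[OF xs brin_thompson_closed[OF D' p3] brin_thompson_closed[OF D' p]]) simp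
          then have "f3 p = p" by (rule bt_inj[OF D' p3 p])
          then show ?thesis using * k by simp
        qed
      qed
      note rs = resplit_BT[OF R(2) D(2)]
      show ?thesis
      \<comment> \<open>If \<open>D'\<close> has a single leaf, there is nothing to merge and
        \<open>f3\<close> is a conjugate of \<open>resplit s t\<close>; otherwise it is a squeezed
        copy.\<close>
      proof (cases "n = 1")
        case True
        then have D'1: "D' \<in> BT 1 1" using D' by simp
        show ?thesis
        proof (rule \<theta>_conj_trivial[OF D'1 rs \<theta>_resplit[OF R(2) D(2)] f(3)])
          fix p :: "'s copies_point" assume p: "p \<in> copies 1"
          have "fst (D' p) = 0" using brin_thompson_closed[OF D'1 p] by (cases "D' p") simp
          then obtain b \<kappa> where "\<kappa> \<in> cube" "D' p = (0, scons t b \<kappa>)" "D' (f3 p) = (0, scons s b \<kappa>)"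
            using f3[OF p] by blast
          then show "D' (f3 p) = resplit s t (D' p)" using resplit_scons[OF R(2) D(2)] by simp
        qed
      next
        case False
        then obtain E where "merges n D' 0 E" using ex_merges[OF D' _ _ S_nonempty, of 0] n by fastforce
        note E = mergesD[OF this]
        have "Br 1 1 f3 = inside E (Br 1 1 (resplit s t))"
        proof (rule ev_eqI[OF Br_Hom[OF f(3)] inside_Hom[OF E(1) Br_Hom[OF rs]]])
          fix z :: "'s copies_point \<times> 'g" assume "z \<in> pts 1"
          then obtain p x where z: "z = (p, x)" "p \<in> copies 1" "x \<in> carrier G" by auto
          note p3 = brin_thompson_closed[OF f(3) z(2)]
          have "ev (inside E (Br 1 1 (resplit s t))) (p, x) = (f3 p, x)"
            using f3[OF z(2)]
          proof
            assume "\<exists>b \<kappa>. \<kappa> \<in> cube \<and> D' p = (0, scons t b \<kappa>) \<and> D' (f3 p) = (0, scons s b \<kappa>)"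
            then obtain b \<kappa> where *: "\<kappa> \<in> cube" "D' p = (0, scons t b \<kappa>)" "D' (f3 p) = (0, scons s b \<kappa>)" by blast
            have "ev (Br 1 1 (resplit s t)) ((0, scons t b \<kappa>), x) = (E (f3 p), x)"
              using ev_Br[OF rs, of "(0, scons t b \<kappa>)" x] z(3) *(1) D(2) E(2)[OF p3 *(3)]
                resplit_scons[OF R(2) D(2) *(1)] by (simp add: scons_cube)
            then show ?thesis
              by (rule ev_inside_in[OF E(1) Br_Hom[OF rs] z(2,3) E(2)[OF z(2) *(2)] _ p3])
          next
            assume *: "fst (D' p) \<noteq> 0 \<and> f3 p = p"
            from E(1) z(2) show ?thesis
            proof (cases rule: BT2_cases)
              case (1 \<kappa>)
              then show ?thesis using E(3)[OF z(2) 1(1)] * by simp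
            next
              case (2 \<kappa>)
              then show ?thesis using ev_inside_out[OF E(1) Br_Hom[OF rs] z(2,3)] * by simp
            qed
          qed
          then show "ev (Br 1 1 f3) z = ev (inside E (Br 1 1 (resplit s t))) z"
            using ev_Br[OF f(3) z(2,3)] z(1) by simp
        qed
        then show ?thesis using \<Theta>_inside_one[OF Br_Hom[OF rs] \<theta>_resplit[OF R(2) D(2)] E(1)] by simp
      qed
    qed
    ultimately show ?thesis by simp
  qed
qed

lemma \<theta>_trivial:
  assumes f: "f \<in> BT 1 1"
  shows "\<theta> f = \<one>\<^bsub>Q\<^esub>"
proof -
  obtain q A B where q: "forest 1 q A" "forest 1 q B" "\<And>p. p \<in> copies 1 \<Longrightarrow> B (f p) = A p"
    using brin_thompson_forests[OF f] by metis
  have "quot q B A = f" by (rule quot_eqI[OF forest_BT[OF q(2)] forest_BT[OF q(1)] f q(3)])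
  then show ?thesis using \<theta>_trees[OF q(2,1)] by simp
qed

section \<open>Triviality on labels and on all elements\<close>

lemma \<Theta>_label:
  assumes g: "g \<in> carrier G"
  shows "\<Theta> (Lb [g]) = \<one>\<^bsub>Q\<^esub>"
proof -
  obtain s where s: "s \<in> S" using S_nonempty by blast
  have gs: "\<phi> g s \<in> S" using g s by simp
  have l: "[g] \<in> labels 1" using g by (simp add: labels_def)
  have L: "Lb [g] \<in> Hom 1 1" using Lb_Hom[OF l] by simp
  let ?f = "resplit (\<phi> g s) s"
  note f = resplit_BT[OF gs s]
  let ?E = "simple_split S s" and ?E' = "permute 2 (simple_split S s) (Transposition.transpose 0 1)"
  note E = bt_split[OF s]
  note E' = permute_BT[OF E swap01]
  note I = inside_Hom[OF E L] and I' = inside_Hom[OF E' L]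
  \<comment> \<open>The relation \<open>split\<close> gives \<open>g = x_gs^-1 (g, g) x_s\<close>
    with \<open>gs\<close> the image of \<open>s\<close>; this is \<open>x_gs^-1 x_s\<close> times
    one squeezed copy of \<open>g\<close> in each half at \<open>s\<close>.\<close>
  have "Lb [g] = Br 1 1 ?f \<bullet> (inside ?E (Lb [g]) \<bullet> inside ?E' (Lb [g]))"
  proof (rule ev_eqI[OF L comp_Hom[OF Br_Hom[OF f] comp_Hom[OF I I']]])
    fix z :: "'s copies_point \<times> 'g" assume "z \<in> pts 1"
    then obtain p0 x where z: "z = (p0, x)" "p0 \<in> copies 1" "x \<in> carrier G" by auto
    obtain \<kappa>0 where 0: "p0 = (0, \<kappa>0)" "\<kappa>0 \<in> cube" using copies1_cases[OF z(2)] .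
    obtain b \<kappa> where 1: "\<kappa> \<in> cube" "\<kappa>0 = scons s b \<kappa>" using scons_cases[OF s 0(2)] by metis
    define q where "q = (0::nat, scons s b (act g \<kappa>))"
    have q: "q \<in> copies 1" using s by (simp add: q_def scons_cube)
    have gx: "g \<otimes> x \<in> carrier G" using g z by simp
    have Aq: "ev (Lb [g]) ((0, \<kappa>), x) = ((0, act g \<kappa>), g \<otimes> x)"
      using ev_Lb[OF l, of 0 \<kappa> x] 1(1) z(3) by simp
    have sp: "?E p0 = (if b then 1 else 0, \<kappa>)" "?E q = (if b then 1 else 0, act g \<kappa>)"
      unfolding 0 1(2) q_def
      by (rule simple_split_scons[OF s 1(1)], rule simple_split_scons[OF s act_cube])
    have "ev (inside ?E (Lb [g])) (ev (inside ?E' (Lb [g])) (p0, x)) = (q, g \<otimes> x)"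
    proof (cases b)
      case True
      have "?E' p0 = (0, \<kappa>)" "?E' q = (0, act g \<kappa>)"
        using permute_apply[OF E z(2) sp(1)] permute_apply[OF E q sp(2)] True by simp_all
      then have "ev (inside ?E' (Lb [g])) (p0, x) = (q, g \<otimes> x)"
        using ev_inside_in[OF E' L z(2,3) _ _ q, of \<kappa> "g \<otimes> x"] Aq by simp
      moreover have "?E q = (1, act g \<kappa>)" using sp(2) True by simp
      ultimately show ?thesis using ev_inside_out[OF E L q gx] by simp
    next
      case b: False
      have "?E' p0 = (1, \<kappa>)" using permute_apply[OF E z(2) sp(1)] b by simp
      then have "ev (inside ?E' (Lb [g])) (p0, x) = (p0, x)" by (rule ev_inside_out[OF E' L z(2,3)])
      moreover have "?E p0 = (0, \<kappa>)" "?E q = (0, act g \<kappa>)" using sp b by simp_all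
      ultimately show ?thesis using ev_inside_in[OF E L z(2,3) _ _ q, of \<kappa> "g \<otimes> x"] Aq by simp
    qed
    moreover have "?f q = (0, act g \<kappa>0)"
      unfolding q_def 1(2) act_scons[OF g s] by (rule resplit_scons[OF gs s act_cube])
    ultimately have "ev (Br 1 1 ?f \<bullet> (inside ?E (Lb [g]) \<bullet> inside ?E' (Lb [g]))) z = ((0, act g \<kappa>0), g \<otimes> x)"
      using ev_comp[OF Br_Hom[OF f] comp_Hom[OF I I'], of z] ev_comp[OF I I', of z] z ev_Br[OF f q gx] by simp
    moreover have "ev (Lb [g]) z = ((0, act g \<kappa>0), g \<otimes> x)"
      using ev_Lb[OF l, of 0 \<kappa>0 x] 0 z by simp
    ultimately show "ev (Lb [g]) z = ev (Br 1 1 ?f \<bullet> (inside ?E (Lb [g]) \<bullet> inside ?E' (Lb [g]))) z" by simp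
  qed
  then have "\<Theta> (Lb [g]) = \<theta> ?f \<otimes>\<^bsub>Q\<^esub> (\<Theta> (inside ?E (Lb [g])) \<otimes>\<^bsub>Q\<^esub> \<Theta> (inside ?E' (Lb [g])))"
    using \<Theta>_mult[OF Br_Hom[OF f] comp_Hom[OF I I']] \<Theta>_mult[OF I I'] by metis
  then have "\<Theta> (Lb [g]) = \<Theta> (inside ?E (Lb [g])) \<otimes>\<^bsub>Q\<^esub> \<Theta> (inside ?E' (Lb [g]))"
    using \<theta>_trivial[OF f] \<Theta>_closed[OF I] \<Theta>_closed[OF I'] by simp
  then show ?thesis by (rule \<Theta>_halves[OF L E E'])
qed

text \<open>The element \<open>E^-1 gs E\<close>: label \<open>gs ! k\<close> acts within piece
  \<open>k\<close> of \<open>E\<close>.\<close>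

definition conj_label :: "nat \<Rightarrow> ('s copies_point \<Rightarrow> 's copies_point) \<Rightarrow> 'g list \<Rightarrow> ('g, 's) sv_term set" where
  "conj_label n E gs = Br n 1 (bt_inv 1 E n) \<bullet> (Lb gs \<bullet> Br 1 n E)"

lemma conj_label_Hom: "E \<in> BT 1 n \<Longrightarrow> gs \<in> labels n \<Longrightarrow> conj_label n E gs \<in> Hom 1 1"
  unfolding conj_label_def
  by (intro comp_Hom[OF Br_Hom[OF bt_inv_closed]] comp_Hom[OF Lb_Hom Br_Hom]) (auto dest: brin_thompsonD)

lemma ev_conj_label:
  assumes E: "E \<in> BT 1 n" and gs: "gs \<in> labels n" and z: "p \<in> copies 1" "x \<in> carrier G"
    and p: "E p = (k, \<kappa>)"
  shows "ev (conj_label n E gs) (p, x) = (bt_inv 1 E n (k, act (gs ! k) \<kappa>), gs ! k \<otimes> x)"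
proof -
  have n: "1 \<le> n" using brin_thompsonD[OF E] by simp
  have k: "k < n" "\<kappa> \<in> cube" using brin_thompson_closed[OF E z(1)] p by simp_all
  note H = Br_Hom[OF bt_inv_closed[OF E]] Lb_Hom[OF gs n] Br_Hom[OF E]
  have "gs ! k \<otimes> x \<in> carrier G" using labels_nth[OF gs k(1)] z by simp
  then show ?thesis
    unfolding conj_label_def
    using ev_comp[OF H(1) comp_Hom[OF H(2,3)], of "(p, x)"] ev_comp[OF H(2,3), of "(p, x)"] z p k
      ev_Br[OF E z] ev_Lb[OF gs k z(2)] ev_Br[OF bt_inv_closed[OF E], of "(k, act (gs ! k) \<kappa>)"]
    by simp
qed

lemma conj_label_mult:
  assumes E: "E \<in> BT 1 n" and gs: "gs \<in> labels n" and hs: "hs \<in> labels n"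
  shows "conj_label n E (map2 (\<otimes>) gs hs) = conj_label n E gs \<bullet> conj_label n E hs"
proof (rule ev_eqI[OF conj_label_Hom[OF E map2_labels[OF gs hs]]
      comp_Hom[OF conj_label_Hom[OF E gs] conj_label_Hom[OF E hs]]])
  fix z :: "'s copies_point \<times> 'g" assume "z \<in> pts 1"
  then obtain p x where z: "z = (p, x)" "p \<in> copies 1" "x \<in> carrier G" by auto
  obtain k \<kappa> where p: "E p = (k, \<kappa>)" by (cases "E p")
  have k: "k < n" "\<kappa> \<in> cube" using brin_thompson_closed[OF E z(2)] p by simp_all
  define q where "q = bt_inv 1 E n (k, act (hs ! k) \<kappa>)"
  have q: "q \<in> copies 1" "E q = (k, act (hs ! k) \<kappa>)"
    using brin_thompson_closed[OF bt_inv_closed[OF E]] bt_inv_right[OF E] k(1) by (auto simp: q_def)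
  have c: "gs ! k \<in> carrier G" "hs ! k \<in> carrier G" "hs ! k \<otimes> x \<in> carrier G"
    using labels_nth[OF gs k(1)] labels_nth[OF hs k(1)] z(3) by auto
  have m: "map2 (\<otimes>) gs hs ! k = gs ! k \<otimes> hs ! k"
    using labels_length[OF gs] labels_length[OF hs] k(1) by simp
  have "ev (conj_label n E gs \<bullet> conj_label n E hs) z = ev (conj_label n E gs) (q, hs ! k \<otimes> x)"
    using ev_comp[OF conj_label_Hom[OF E gs] conj_label_Hom[OF E hs], of z] z
      ev_conj_label[OF E hs z(2,3) p] by (simp add: q_def)
  then show "ev (conj_label n E (map2 (\<otimes>) gs hs)) z = ev (conj_label n E gs \<bullet> conj_label n E hs) z"
    using ev_conj_label[OF E map2_labels[OF gs hs] z(2,3) p] ev_conj_label[OF E gs q(1) c(3) q(2)] z(1) c m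
    by (simp add: act_mult m_assoc z(3))
qed

text \<open>A label on one piece and \<open>\<one>\<close> on the others is a squeezed label, the
  other pieces being merged into the second half.\<close>

lemma \<Theta>_conj_single:
  assumes E: "E \<in> BT 1 n" and n: "2 \<le> n" and j: "j < n" and g: "g \<in> carrier G"
  shows "\<Theta> (conj_label n E ((replicate n \<one>)[j := g])) = \<one>\<^bsub>Q\<^esub>"
proof -
  let ?gs = "(replicate n \<one>)[j := g]"
  have gs: "?gs \<in> labels n" using set_update_subset_insert[of "replicate n \<one>" j g] g by (auto simp: labels_def)
  have l: "[g] \<in> labels 1" using g by (simp add: labels_def)
  have L: "Lb [g] \<in> Hom 1 1" using Lb_Hom[OF l] by simp
  obtain E' where "merges n E j E'" using ex_merges[OF E n j S_nonempty] by blast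
  note E' = mergesD[OF this]
  have "conj_label n E ?gs = inside E' (Lb [g])"
  proof (rule ev_eqI[OF conj_label_Hom[OF E gs] inside_Hom[OF E'(1) L]])
    fix z :: "'s copies_point \<times> 'g" assume "z \<in> pts 1"
    then obtain p x where z: "z = (p, x)" "p \<in> copies 1" "x \<in> carrier G" by auto
    obtain k \<kappa> where p: "E p = (k, \<kappa>)" by (cases "E p")
    have k: "k < n" "\<kappa> \<in> cube" using brin_thompson_closed[OF E z(2)] p by simp_all
    define q where "q = bt_inv 1 E n (k, act (?gs ! k) \<kappa>)"
    have q: "q \<in> copies 1" "E q = (k, act (?gs ! k) \<kappa>)"
      using brin_thompson_closed[OF bt_inv_closed[OF E]] bt_inv_right[OF E] k(1) by (auto simp: q_def)
    have "ev (inside E' (Lb [g])) (p, x) = (q, ?gs ! k \<otimes> x)"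
    proof (cases "k = j")
      case True
      then have gk: "?gs ! k = g" using j by simp
      have "ev (Lb [g]) ((0, \<kappa>), x) = (E' q, g \<otimes> x)"
        using ev_Lb[OF l, of 0 \<kappa> x] k(2) z(3) E'(2)[OF q(1)] q(2) True gk by simp
      then show ?thesis
        unfolding gk using ev_inside_in[OF E'(1) L z(2,3) E'(2)[OF z(2)] _ q(1)] p True by simp
    next
      case False
      then have gk: "?gs ! k = \<one>" using k by simp
      have "q = p" using bt_inj[OF E q(1) z(2)] q(2) p gk act_one[OF k(2)] by simp
      moreover from E'(1) z(2) have "ev (inside E' (Lb [g])) (p, x) = (p, x)"
      proof (cases rule: BT2_cases)
        case (1 \<kappa>')
        then show ?thesis using E'(3)[OF z(2) 1(1)] p False by simp
      next
        case (2 \<kappa>')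
        then show ?thesis using ev_inside_out[OF E'(1) L z(2,3)] by simp
      qed
      ultimately show ?thesis using gk z(3) by simp
    qed
    then show "ev (conj_label n E ?gs) z = ev (inside E' (Lb [g])) z"
      using ev_conj_label[OF E gs z(2,3) p] z(1) by (simp add: q_def)
  qed
  then show ?thesis using \<Theta>_inside_one[OF L \<Theta>_label[OF g] E'(1)] by simp
qed

lemma \<Theta>_conj_label:
  assumes E: "E \<in> BT 1 n" and gs: "gs \<in> labels n"
  shows "\<Theta> (conj_label n E gs) = \<one>\<^bsub>Q\<^esub>"
proof -
  have n: "1 \<le> n" using brin_thompsonD[OF E] by simp
  show ?thesis
  proof (cases "n = 1")
    case True
    then obtain g where g: "gs = [g]" "g \<in> carrier G" using gs by (auto simp: labels_def length_Suc_conv)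
    have E1: "E \<in> BT 1 1" using E True by simp
    have L: "Lb gs \<in> Hom 1 1" using Lb_Hom[OF gs n] True by simp
    have "\<Theta> (conj_label n E gs) = \<theta> (bt_inv 1 E 1) \<otimes>\<^bsub>Q\<^esub> (\<Theta> (Lb gs) \<otimes>\<^bsub>Q\<^esub> \<theta> E)"
      unfolding conj_label_def True
      using \<Theta>_mult[OF Br_Hom[OF bt_inv_closed[OF E1]] comp_Hom[OF L Br_Hom[OF E1]]] \<Theta>_mult[OF L Br_Hom[OF E1]]
      by simp
    then show ?thesis using \<theta>_trivial[OF E1] \<theta>_trivial[OF bt_inv_closed[OF E1]] \<Theta>_label[OF g(2)] g(1) by simp
  next
    case False
    then have n2: "2 \<le> n" using n by simp
    \<comment> \<open>The entries of \<open>gs\<close> are switched on one place at a time, each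
      step multiplying by a single label.\<close>
    define h where "h = (\<lambda>j. map (\<lambda>i. if i < j then gs ! i else \<one>) [0..<n])"
    have h: "h j \<in> labels n" for j
      using labels_nth[OF gs] by (auto simp: h_def labels_def)
    have "\<Theta> (conj_label n E (h j)) = \<one>\<^bsub>Q\<^esub>" if "j \<le> n" for j
      using that
    proof (induction j)
      case 0
      have "h 0 = (replicate n \<one>)[0 := \<one>]"
        unfolding h_def by (rule nth_equalityI) (auto simp: nth_list_update)
      then show ?case using \<Theta>_conj_single[OF E n2, of 0 \<one>] n2 by simp
    next
      case (Suc j)
      then have j: "j < n" by simp
      note gj = labels_nth[OF gs j]
      let ?e = "(replicate n \<one>)[j := gs ! j]"
      have e: "?e \<in> labels n" using set_update_subset_insert[of "replicate n \<one>" j "gs ! j"] gj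
        by (auto simp: labels_def)
      have "h (Suc j) = map2 (\<otimes>) (h j) ?e"
      proof (rule nth_equalityI)
        fix i assume "i < length (h (Suc j))"
        then have i: "i < n" by (simp add: h_def)
        show "h (Suc j) ! i = map2 (\<otimes>) (h j) ?e ! i"
          using i gj labels_nth[OF gs i] by (auto simp: h_def nth_list_update less_Suc_eq)
      qed (simp add: h_def)
      then show ?case
        using \<Theta>_mult[OF conj_label_Hom[OF E h] conj_label_Hom[OF E e]] conj_label_mult[OF E h e]
          \<Theta>_conj_single[OF E n2 j gj] Suc.IH j by simp
    qed
    moreover have "h n = gs" using labels_length[OF gs] by (auto simp: h_def intro!: nth_equalityI)
    ultimately show ?thesis by (metis order.refl)
  qed
qed

text \<open>A normal form \<open>F gs E\<close> is the Brin-Thompson element \<open>F E\<close>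
  times the conjugated label \<open>E^-1 gs E\<close>, and both have trivial value.\<close>

theorem \<Theta>_trivial:
  assumes A: "A \<in> Hom 1 1"
  shows "\<Theta> A = \<one>\<^bsub>Q\<^esub>"
proof -
  obtain r F gs E where nf: "F \<in> BT r 1" "gs \<in> labels r" "E \<in> BT 1 r" "A = Br r 1 F \<bullet> (Lb gs \<bullet> Br 1 r E)"
    using normal_form[OF A] by metis
  have r: "1 \<le> r" using brin_thompsonD[OF nf(1)] by simp
  note LE = comp_Hom[OF Lb_Hom[OF nf(2) r] Br_Hom[OF nf(3)]]
  let ?f = "compose (copies 1) F E"
  have f: "?f \<in> BT 1 1" by (rule brin_thompson_compose[OF nf(3,1)])
  have "Br 1 1 ?f \<bullet> conj_label r E gs = Br r 1 F \<bullet> (Br 1 r E \<bullet> (Br r 1 (bt_inv 1 E r) \<bullet> (Lb gs \<bullet> Br 1 r E)))"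
    unfolding conj_label_def Br_comp[OF nf(3,1), symmetric]
    by (rule assoc[OF Br_Hom[OF nf(1)] Br_Hom[OF nf(3)] comp_Hom[OF Br_Hom[OF bt_inv_closed[OF nf(3)]] LE]])
  also have "Br 1 r E \<bullet> (Br r 1 (bt_inv 1 E r) \<bullet> (Lb gs \<bullet> Br 1 r E)) = Lb gs \<bullet> Br 1 r E"
    using assoc[OF Br_Hom[OF nf(3)] Br_Hom[OF bt_inv_closed[OF nf(3)]] LE] Br_inv(2)[OF nf(3)] Id_left[OF LE]
    by simp
  finally have "A = Br 1 1 ?f \<bullet> conj_label r E gs" using nf(4) by simp
  then show ?thesis
    using \<Theta>_mult[OF Br_Hom[OF f] conj_label_Hom[OF nf(3,2)]] \<theta>_trivial[OF f] \<Theta>_conj_label[OF nf(3,2)] by simp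
qed

end

section \<open>Normal subgroups\<close>

context brick_system
begin

text \<open>Since \<open>f\<close> only replaces a prefix, the depth at which it is canonical plus
  the wanted depth \<open>b\<close> is enough.\<close>

lemma brin_thompson_continuous:
  assumes f: "f \<in> BT m n" and i: "i < m" "\<kappa> \<in> cube" and b: "fin_depth b"
  obtains c where "fin_depth c"
    "\<forall>\<kappa>'\<in>cube. agree c \<kappa> \<kappa>' \<longrightarrow> fst (f (i, \<kappa>')) = fst (f (i, \<kappa>)) \<and> agree b (snd (f (i, \<kappa>))) (snd (f (i, \<kappa>')))"
proof -
  obtain a where a: "fin_depth a" "canonical_below m a f" using brin_thompson_canonical[OF f] .
  obtain \<psi> j where \<psi>: "\<psi> \<in> brick_addresses S"
    "\<forall>\<kappa>'\<in>cube. agree a \<kappa> \<kappa>' \<longrightarrow> f (i, \<kappa>') = (j, glue \<psi> (strip a \<kappa>'))"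
    by (rule canonical_belowE[OF a(2) i])
  have e: "f (i, \<kappa>) = (j, glue \<psi> (strip a \<kappa>))" using \<psi>(2) i(2) by simp
  have "fst (f (i, \<kappa>')) = fst (f (i, \<kappa>)) \<and> agree b (snd (f (i, \<kappa>))) (snd (f (i, \<kappa>')))"
    if *: "\<kappa>' \<in> cube" "agree (\<lambda>s. a s + b s) \<kappa> \<kappa>'" for \<kappa>'
  proof -
    have "agree a \<kappa> \<kappa>'" by (rule agree_mono[OF *(2)]) simp
    then have "f (i, \<kappa>') = (j, glue \<psi> (strip a \<kappa>'))" using \<psi>(2) * by simp
    moreover have "agree b (glue \<psi> (strip a \<kappa>)) (glue \<psi> (strip a \<kappa>'))"
      using *(2) by (auto simp: agree_def glue_apply strip_apply conc_def)
    ultimately show ?thesis using e by simp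
  qed
  then show thesis using that fin_depth_add[OF a(1) b] by blast
qed

text \<open>Only a finite prefix of each coordinate changes, and coordinates are never exchanged.
  Labels do exchange coordinates, so constant tails reveal them in
  \<open>fixing_in_SK\<close>.\<close>

lemma brin_thompson_tail:
  assumes f: "f \<in> BT m n" and i: "i < m" "\<kappa> \<in> cube" and s: "s \<in> S" and e: "f (i, \<kappa>) = (j, \<kappa>')"
    and tail: "\<forall>x\<ge>l. \<kappa> s x = b"
  shows "\<exists>l. \<forall>x\<ge>l. \<kappa>' s x = b"
proof -
  obtain a where a: "fin_depth a" "canonical_below m a f" using brin_thompson_canonical[OF f] .
  obtain \<psi> j' where \<psi>: "\<psi> \<in> brick_addresses S"
    "\<forall>\<kappa>'\<in>cube. agree a \<kappa> \<kappa>' \<longrightarrow> f (i, \<kappa>') = (j', glue \<psi> (strip a \<kappa>'))"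
    by (rule canonical_belowE[OF a(2) i])
  have "\<kappa>' = glue \<psi> (strip a \<kappa>)" using \<psi>(2) i(2) e by simp
  then have k: "\<kappa>' s = \<psi> s \<frown> sfx (a s) (\<kappa> s)" using s by (simp add: glue_apply strip_apply)
  have "\<kappa>' s x = b" if "x \<ge> length (\<psi> s) + l" for x
  proof -
    have "\<not> x < length (\<psi> s)" "a s + (x - length (\<psi> s)) \<ge> l" using that by simp_all
    then show ?thesis unfolding k using tail by simp
  qed
  then show ?thesis by blast
qed

end

context twisted
begin

section \<open>The group \<open>M\<close> and bricks moved off themselves\<close>

abbreviation "M \<equiv> twisted_BT G S \<phi>"

lemma carrier_M: "carrier M = Hom 1 1"
  by (simp add: twisted_BT_def Hom_def)

lemma mult_M: "A \<otimes>\<^bsub>M\<^esub> B = A \<bullet> B"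
  by (simp add: twisted_BT_def comp_cls_def)

lemma one_M: "\<one>\<^bsub>M\<^esub> = Id 1"
  by (simp add: twisted_BT_def Id_def Br_def)

lemma group_M: "group M"
proof (rule groupI)
  fix A assume "A \<in> carrier M"
  then show "\<exists>B\<in>carrier M. B \<otimes>\<^bsub>M\<^esub> A = \<one>\<^bsub>M\<^esub>"
    using Hom_inverse unfolding carrier_M mult_M one_M by blast
qed (auto simp: carrier_M mult_M one_M comp_Hom Id_Hom assoc Id_left)

sublocale M: group M
  by (rule group_M)

lemma ev_nf:
  assumes F: "F \<in> BT r 1" and gs: "gs \<in> labels r" and E: "E \<in> BT 1 r"
    and z: "p \<in> copies 1" "x \<in> carrier G" "E p = (k, \<kappa>)"
  shows "ev (Br r 1 F \<bullet> (Lb gs \<bullet> Br 1 r E)) (p, x) = (F (k, act (gs ! k) \<kappa>), gs ! k \<otimes> x)"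
proof -
  have r: "1 \<le> r" using brin_thompsonD[OF E] by simp
  have k: "k < r" "\<kappa> \<in> cube" using brin_thompson_closed[OF E z(1)] z(3) by simp_all
  note H = Br_Hom[OF F] Lb_Hom[OF gs r] Br_Hom[OF E]
  have "gs ! k \<otimes> x \<in> carrier G" using labels_nth[OF gs k(1)] z by simp
  then show ?thesis
    using ev_comp[OF H(1) comp_Hom[OF H(2,3)], of "(p, x)"] ev_comp[OF H(2,3), of "(p, x)"] z k
      ev_Br[OF E z(1,2)] ev_Lb[OF gs k z(2)] ev_Br[OF F, of "(k, act (gs ! k) \<kappa>)"]
    by simp
qed

text \<open>Coordinates are only permuted, so the wanted depth is carried back along
  \<open>\<phi> g\<close> and keeps finite support.\<close>

lemma act_continuous:
  assumes g: "g \<in> carrier G" and b: "fin_depth b"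
  obtains c where "fin_depth c" "\<And>\<kappa> \<kappa>'. agree c \<kappa> \<kappa>' \<Longrightarrow> agree b (act g \<kappa>) (act g \<kappa>')"
proof
  have "{s \<in> S. b (\<phi> g s) \<noteq> 0} \<subseteq> \<phi> (inv g) ` {s \<in> S. b s \<noteq> 0}"
  proof
    fix s assume s: "s \<in> {s \<in> S. b (\<phi> g s) \<noteq> 0}"
    then have "s = \<phi> (inv g) (\<phi> g s)" "\<phi> g s \<in> {s \<in> S. b s \<noteq> 0}" using g by simp_all
    then show "s \<in> \<phi> (inv g) ` {s \<in> S. b s \<noteq> 0}" by (rule image_eqI)
  qed
  then show "fin_depth (\<lambda>s. b (\<phi> g s))"
    using b unfolding fin_depth_def by (meson finite_imageI finite_subset)
  fix \<kappa> \<kappa>' assume ag: "agree (\<lambda>s. b (\<phi> g s)) \<kappa> \<kappa>'"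
  show "agree b (act g \<kappa>) (act g \<kappa>')"
    unfolding agree_def
  proof (intro ballI allI impI)
    fix s j assume s: "s \<in> S" "j < b s"
    then have "\<phi> (inv g) s \<in> S" "j < b (\<phi> g (\<phi> (inv g) s))" using g by simp_all
    then show "act g \<kappa> s j = act g \<kappa>' s j" using ag s(1) by (simp add: agree_def act_def)
  qed
qed

text \<open>Continuity gives a cell around \<open>p\<close> whose image misses it. A uniform tree
  has this cell as a leaf, and merging its other leaves makes the cell the first half of a cut. The
  conclusion holds for every \<open>y\<close> because the moved point does not depend on the label
  coordinate.\<close>

lemma moves_brick:
  assumes A: "A \<in> Hom 1 1" and z: "p \<in> copies 1" "x \<in> carrier G" "fst (ev A (p, x)) \<noteq> p"
  obtains E where "E \<in> BT 1 2"
    "\<forall>q\<in>copies 1. \<forall>y\<in>carrier G. fst (E q) = 0 \<longrightarrow> fst (E (fst (ev A (q, y)))) = 1"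
proof -
  obtain r F gs E0 where nf: "F \<in> BT r 1" "gs \<in> labels r" "E0 \<in> BT 1 r" "A = Br r 1 F \<bullet> (Lb gs \<bullet> Br 1 r E0)"
    using normal_form[OF A] by metis
  obtain \<kappa>0 where p: "p = (0, \<kappa>0)" "\<kappa>0 \<in> cube" using copies1_cases[OF z(1)] .
  obtain k \<kappa>1 where k: "E0 p = (k, \<kappa>1)" by (cases "E0 p")
  have kr: "k < r" "\<kappa>1 \<in> cube" using brin_thompson_closed[OF nf(3) z(1)] k by simp_all
  note gk = labels_nth[OF nf(2) kr(1)]
  obtain i \<kappa>h where h: "F (k, act (gs ! k) \<kappa>1) = (i, \<kappa>h)" by (cases "F (k, act (gs ! k) \<kappa>1)")
  have ih: "i = 0" "\<kappa>h \<in> cube" using brin_thompson_closed[OF nf(1), of "(k, act (gs ! k) \<kappa>1)"] kr h by simp_all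
  have "\<kappa>h \<noteq> \<kappa>0" using z(3) p(1) ev_nf[OF nf(1-3) z(1,2) k] nf(4) h ih by simp
  then obtain s where s: "s \<in> S" "\<kappa>h s \<noteq> \<kappa>0 s"
    using cube_ext[OF ih(2) p(2)] by blast
  then obtain j where j: "\<kappa>h s j \<noteq> \<kappa>0 s j" by (auto simp: fun_eq_iff)
  note sj = s(1) j
  \<comment> \<open>Just enough letters at \<open>s\<close> to see letter \<open>j\<close>, where
    \<open>p\<close> and its image differ.\<close>
  define b where "b = (\<lambda>t. 0)(s := Suc j)"
  have b: "fin_depth b" by (simp add: fin_depth_def b_def)
  \<comment> \<open>The depth \<open>b\<close> is pulled back through the three factors of the
    normal form: \<open>F\<close>, the label, and \<open>E0\<close>.\<close>
  obtain c1 where c1: "fin_depth c1" "\<forall>\<kappa>'\<in>cube. agree c1 (act (gs ! k) \<kappa>1) \<kappa>' \<longrightarrow>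
      fst (F (k, \<kappa>')) = fst (F (k, act (gs ! k) \<kappa>1)) \<and> agree b (snd (F (k, act (gs ! k) \<kappa>1))) (snd (F (k, \<kappa>')))"
    by (rule brin_thompson_continuous[OF nf(1) kr(1) act_cube b])
  obtain c2 where c2: "fin_depth c2" "\<And>\<kappa> \<kappa>'. agree c2 \<kappa> \<kappa>' \<Longrightarrow> agree c1 (act (gs ! k) \<kappa>) (act (gs ! k) \<kappa>')"
    using act_continuous[OF gk c1(1)] by metis
  obtain c3 where c3: "fin_depth c3" "\<forall>\<kappa>'\<in>cube. agree c3 \<kappa>0 \<kappa>' \<longrightarrow>
      fst (E0 (0, \<kappa>')) = fst (E0 (0, \<kappa>0)) \<and> agree c2 (snd (E0 (0, \<kappa>0))) (snd (E0 (0, \<kappa>')))"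
    by (rule brin_thompson_continuous[OF nf(3) _ p(2) c2(1), of 0]) auto
  \<comment> \<open>\<open>c3\<close> forces the image of the cell to keep letter \<open>j\<close>
    of \<open>\<kappa>h\<close>; adding \<open>b\<close> makes this letter count in
    \<open>agree c\<close>, so the image leaves the cell.\<close>
  define c where "c = (\<lambda>t. c3 t + b t)"
  have c: "fin_depth c" unfolding c_def by (rule fin_depth_add[OF c3(1) b])
  have far: "\<exists>\<kappa>''. fst (ev A ((0, \<kappa>), y)) = (0, \<kappa>'') \<and> \<kappa>'' \<in> cube \<and> \<not> agree c \<kappa>0 \<kappa>''"
    if \<kappa>: "\<kappa> \<in> cube" "agree c \<kappa>0 \<kappa>" and y: "y \<in> carrier G" for \<kappa> y
  proof -
    have q: "(0, \<kappa>) \<in> copies 1" using \<kappa> by simp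
    obtain k' \<kappa>2 where k': "E0 (0, \<kappa>) = (k', \<kappa>2)" by (cases "E0 (0, \<kappa>)")
    have "agree c3 \<kappa>0 \<kappa>" by (rule agree_mono[OF \<kappa>(2)]) (simp add: c_def)
    then have "k' = k" "agree c2 \<kappa>1 \<kappa>2" using c3(2) \<kappa>(1) k' k p(1) by auto
    then have e: "ev A ((0, \<kappa>), y) = (F (k, act (gs ! k) \<kappa>2), gs ! k \<otimes> y)"
      and ag: "agree c1 (act (gs ! k) \<kappa>1) (act (gs ! k) \<kappa>2)"
      using ev_nf[OF nf(1-3) q y k'] nf(4) c2(2) by simp_all
    obtain i'' \<kappa>'' where F: "F (k, act (gs ! k) \<kappa>2) = (i'', \<kappa>'')" by (cases "F (k, act (gs ! k) \<kappa>2)")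
    have F0: "i'' = 0" "\<kappa>'' \<in> cube" using brin_thompson_closed[OF nf(1), of "(k, act (gs ! k) \<kappa>2)"] kr F by simp_all
    have "agree b \<kappa>h \<kappa>''" using c1(2) ag F h by (metis act_cube snd_conv)
    then have "\<kappa>'' s j = \<kappa>h s j" using sj(1) by (simp add: agree_def b_def)
    moreover have "j < c s" by (simp add: c_def b_def)
    ultimately have "\<not> agree c \<kappa>0 \<kappa>''" using sj by (auto simp: agree_def)
    then show ?thesis using e F F0 by simp
  qed
  obtain q T where T: "forest 1 q T" "shape 1 q (\<lambda>_. c) T"
    using forest_of_shape[of 1 "\<lambda>_. c"] c by blast
  note TB = forest_BT[OF T(1)]
  obtain l \<kappa>2 where l: "T (0, \<kappa>0) = (l, \<kappa>2)" by (cases "T (0, \<kappa>0)")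
  have p0: "(0, \<kappa>0) \<in> copies 1" using p by simp
  have lq: "l < q" "\<kappa>2 \<in> cube" using brin_thompson_closed[OF TB p0] l by simp_all
  obtain \<psi> where \<psi>: "\<And>t. t \<in> S \<Longrightarrow> length (\<psi> t) = c t" "\<And>\<kappa>. \<kappa> \<in> cube \<Longrightarrow> T (0, glue \<psi> \<kappa>) = (l, \<kappa>)"
    using T(2) lq(1) unfolding shape_def by (metis less_one)
  have Tl: "agree c \<kappa>0 \<kappa>" if \<kappa>: "\<kappa> \<in> cube" "T (0, \<kappa>) = (l, \<kappa>')" for \<kappa> \<kappa>'
  proof -
    have "\<kappa>' \<in> cube" using brin_thompson_closed[OF TB, of "(0, \<kappa>)"] \<kappa> by simp
    then have "\<kappa> = glue \<psi> \<kappa>'" "\<kappa>0 = glue \<psi> \<kappa>2"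
      using bt_inj[OF TB, of "(0, \<kappa>)" "(0, glue \<psi> \<kappa>')"] bt_inj[OF TB, of "(0, \<kappa>0)" "(0, glue \<psi> \<kappa>2)"]
        \<kappa> \<psi>(2) l lq p by auto
    then show ?thesis using agree_glue[of \<psi> c, OF \<psi>(1)] by simp
  qed
  have far_T: "fst (T (fst (ev A (w, y)))) \<noteq> l"
    if w: "w \<in> copies 1" "T w = (l, \<kappa>)" and y: "y \<in> carrier G" for w \<kappa> y
  proof -
    obtain \<kappa>w where \<kappa>w: "w = (0, \<kappa>w)" "\<kappa>w \<in> cube" using copies1_cases[OF w(1)] .
    obtain \<kappa>'' where \<kappa>'': "fst (ev A ((0, \<kappa>w), y)) = (0, \<kappa>'')" "\<kappa>'' \<in> cube" "\<not> agree c \<kappa>0 \<kappa>''"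
      using far[OF \<kappa>w(2) Tl[OF \<kappa>w(2)] y] w(2) \<kappa>w(1) by blast
    have "T (0, \<kappa>'') \<noteq> (l, snd (T (0, \<kappa>'')))" using Tl[OF \<kappa>''(2)] \<kappa>''(3) by blast
    then show ?thesis using \<kappa>''(1) \<kappa>w(1) by (metis prod.collapse)
  qed
  \<comment> \<open>The image of \<open>p\<close> lies in a leaf other than \<open>l\<close>, so
    there is something to merge.\<close>
  have "2 \<le> q"
  proof -
    have "fst (T (fst (ev A ((0, \<kappa>0), x)))) < q"
    proof -
      have "fst (ev A ((0, \<kappa>0), x)) \<in> copies 1"
        using ev_closed[OF A, of "((0, \<kappa>0), x)"] p0 z(2) by (simp add: mem_Times_iff)
      then have "T (fst (ev A ((0, \<kappa>0), x))) \<in> copies q" by (rule brin_thompson_closed[OF TB])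
      then show ?thesis by (cases "T (fst (ev A ((0, \<kappa>0), x)))") simp
    qed
    then show ?thesis using far_T[OF p0 l z(2)] lq(1) by linarith
  qed
  then obtain E where "merges q T l E" using ex_merges[OF TB _ lq(1) S_nonempty] by blast
  note E = mergesD[OF this]
  have "fst (E (fst (ev A (w, y)))) = 1" if w: "w \<in> copies 1" "y \<in> carrier G" "fst (E w) = 0" for w y
  proof -
    have Aw: "fst (ev A (w, y)) \<in> copies 1" using ev_closed[OF A, of "(w, y)"] w by (auto simp: mem_Times_iff)
    have "T w = (l, snd (E w))" using E(3)[OF w(1)] w(3) by (metis prod.collapse)
    then have "fst (T (fst (ev A (w, y)))) \<noteq> l" by (rule far_T[OF w(1) _ w(2)])
    then have "fst (E (fst (ev A (w, y)))) \<noteq> 0" using E(3)[OF Aw] by (metis fst_conv prod.collapse)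
    then show ?thesis using BT2_cases[OF E(1) Aw] by (metis fst_conv)
  qed
  then show thesis using that E(1) by blast
qed

definition supported :: "('s copies_point \<Rightarrow> 's copies_point) \<Rightarrow> ('g, 's) sv_term set \<Rightarrow> bool" where
  "supported E A \<longleftrightarrow> A \<in> Hom 1 1 \<and> (\<forall>p\<in>copies 1. \<forall>x\<in>carrier G. fst (E p) \<noteq> 0 \<longrightarrow> ev A (p, x) = (p, x))"

lemma ev_inverse: "B \<bullet> A = Id 1 \<Longrightarrow> A \<in> Hom 1 1 \<Longrightarrow> B \<in> Hom 1 1 \<Longrightarrow> z \<in> pts 1 \<Longrightarrow> ev B (ev A z) = z"
  using ev_comp[of B 1 1 A 1 z] ev_Id[of 1 z] by simp

lemma ev_inj: "A \<in> Hom 1 1 \<Longrightarrow> z \<in> pts 1 \<Longrightarrow> w \<in> pts 1 \<Longrightarrow> ev A z = ev A w \<Longrightarrow> z = w"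
  using Hom_inverse[of A 1 1] ev_inverse by metis

lemma supports_commute:
  assumes w: "w \<in> Hom 1 1" and v: "supported E v"
    and wY: "\<And>z. z \<in> pts 1 \<Longrightarrow> fst (E (fst z)) = 0 \<Longrightarrow> ev w z = z"
  shows "w \<bullet> v = v \<bullet> w"
proof -
  have vH: "v \<in> Hom 1 1" and vY: "\<And>z. z \<in> pts 1 \<Longrightarrow> fst (E (fst z)) \<noteq> 0 \<Longrightarrow> ev v z = z"
    using v by (auto simp: supported_def)
  show ?thesis
  proof (rule ev_eqI[OF comp_Hom[OF w vH] comp_Hom[OF vH w]])
    fix z assume z: "z \<in> pts 1"
    note vz = ev_closed[OF vH z] and wz = ev_closed[OF w z]
    have "ev w (ev v z) = ev v (ev w z)"
    proof (cases "fst (E (fst z)) = 0")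
      case True
      have "fst (E (fst (ev v z))) = 0"
      proof (rule ccontr)
        assume *: "fst (E (fst (ev v z))) \<noteq> 0"
        then have "ev v z = z" using ev_inj[OF vH vz z] vY[OF vz] by blast
        then show False using * True by simp
      qed
      then show ?thesis using wY[OF vz] wY[OF z True] by simp
    next
      case False
      have "fst (E (fst (ev w z))) \<noteq> 0"
      proof
        assume *: "fst (E (fst (ev w z))) = 0"
        then have "ev w z = z" using ev_inj[OF w wz z] wY[OF wz] by blast
        then show False using * False by simp
      qed
      then show ?thesis using vY[OF wz] vY[OF z False] by simp
    qed
    then show "ev (w \<bullet> v) z = ev (v \<bullet> w) z" using ev_comp[OF w vH z] ev_comp[OF vH w z] by simp
  qed
qed

text \<open>A squeezed element depends only on the piece it lives in and on the coordinates of that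
  piece; by \<open>eq\<close>, the nested squeezing and \<open>E1\<close> share both.\<close>

lemma inside_inside:
  assumes D: "D \<in> BT 1 2" and E: "E \<in> BT 1 2" and A: "A \<in> Hom 1 1" and E1: "E1 \<in> BT 1 2"
    and eq: "\<And>p \<kappa>. p \<in> copies 1 \<Longrightarrow> E1 p = (0, \<kappa>) \<longleftrightarrow> (\<exists>\<kappa>'. D p = (0, \<kappa>') \<and> E (0, \<kappa>') = (0, \<kappa>))"
  shows "inside D (inside E A) = inside E1 A"
proof (rule ev_eqI[OF inside_Hom[OF D inside_Hom[OF E A]] inside_Hom[OF E1 A]])
  note IE = inside_Hom[OF E A]
  fix z :: "'s copies_point \<times> 'g" assume "z \<in> pts 1"
  then obtain p x where z: "z = (p, x)" "p \<in> copies 1" "x \<in> carrier G" by auto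
  have out: "ev (inside E1 A) (p, x) = (p, x)" if "\<And>\<kappa>. E1 p \<noteq> (0, \<kappa>)"
    using BT2_cases[OF E1 z(2)] that ev_inside_out[OF E1 A z(2,3)] by metis
  from D z(2) have "ev (inside D (inside E A)) (p, x) = ev (inside E1 A) (p, x)"
  proof (cases rule: BT2_cases)
    case (1 \<kappa>)
    have k: "(0, \<kappa>) \<in> copies 1" using 1(2) by simp
    from E k show ?thesis
    proof (cases rule: BT2_cases)
      case 2: (1 \<kappa>2)
      obtain \<kappa>3 p3 x3 where 3: "ev A ((0, \<kappa>2), x) = ((0, \<kappa>3), x3)" "E p3 = (0, \<kappa>3)" "p3 \<in> copies 1"
        "ev (inside E A) ((0, \<kappa>), x) = (p3, x3)"
        using ev_inside_inE[OF E A k z(3) 2(1)] by metis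
      obtain \<kappa>4 where 4: "p3 = (0, \<kappa>4)" "\<kappa>4 \<in> cube" using copies1_cases[OF 3(3)] .
      obtain \<kappa>5 p5 x5 where 5: "ev (inside E A) ((0, \<kappa>), x) = ((0, \<kappa>5), x5)" "D p5 = (0, \<kappa>5)" "p5 \<in> copies 1"
        "ev (inside D (inside E A)) (p, x) = (p5, x5)"
        using ev_inside_inE[OF D IE z(2,3) 1(1)] by metis
      have "E1 p = (0, \<kappa>2)" using eq[OF z(2)] 1(1) 2(1) by blast
      moreover have "E1 p5 = (0, \<kappa>3)" using eq[OF 5(3)] 3 4 5 by auto
      ultimately show ?thesis
        using ev_inside_in[OF E1 A z(2,3) _ _ 5(3), of \<kappa>2 x5] 3 5 by simp
    next
      case 2: (2 \<kappa>2)
      have "ev (inside E A) ((0, \<kappa>), x) = (D p, x)" using ev_inside_out[OF E A k z(3) 2(1)] 1(1) by simp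
      then have "ev (inside D (inside E A)) (p, x) = (p, x)"
        by (rule ev_inside_in[OF D IE z(2,3) 1(1) _ z(2)])
      moreover have "E1 p \<noteq> (0, \<kappa>')" for \<kappa>' using eq[OF z(2)] 1(1) 2(1) by auto
      ultimately show ?thesis using out by simp
    qed
  next
    case (2 \<kappa>)
    have "E1 p \<noteq> (0, \<kappa>')" for \<kappa>' using eq[OF z(2)] 2(1) by auto
    then show ?thesis using out ev_inside_out[OF D IE z(2,3) 2(1)] by simp
  qed
  then show "ev (inside D (inside E A)) z = ev (inside E1 A) z" using z(1) by simp
qed

lemma inv_M:
  assumes "B \<bullet> A = Id 1" "A \<in> Hom 1 1" "B \<in> Hom 1 1"
  shows "inv\<^bsub>M\<^esub> A = B"
  by (rule M.inv_equality) (use assms in \<open>simp_all add: carrier_M mult_M one_M\<close>)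

text \<open>
  If \<open>a\<close> carries a half off itself, then conjugating by \<open>a\<close> separates the supports of two elements
  of that half; so their commutator lies in every normal subgroup containing \<open>a\<close>.
\<close>

lemma normal_closure_full:
  assumes N: "N \<lhd> M" and a: "a \<in> N" and z: "p \<in> copies 1" "x \<in> carrier G" "fst (ev a (p, x)) \<noteq> p"
  shows "N = carrier M"
proof -
  interpret N: normal N M by (rule N)
  interpret Q: group "M Mod N" by (rule N.factorgroup_is_group)
  define \<pi> where "\<pi> A = N #>\<^bsub>M\<^esub> A" for A
  have aH: "a \<in> Hom 1 1" using a N.subset carrier_M by blast
  have \<pi>_closed: "\<pi> A \<in> carrier (M Mod N)" if "A \<in> Hom 1 1" for A
    using that by (auto simp: carrier_FactGroup \<pi>_def carrier_M)
  have \<pi>_mult: "\<pi> (A \<bullet> B) = \<pi> A \<otimes>\<^bsub>M Mod N\<^esub> \<pi> B" if "A \<in> Hom 1 1" "B \<in> Hom 1 1" for A B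
    using N.rcos_sum[of A B] that by (simp add: \<pi>_def carrier_M mult_M)
  have \<pi>_one: "\<pi> A = \<one>\<^bsub>M Mod N\<^esub>" if "A \<in> N" for A
    using that N.subset M.coset_join2[OF _ N.subgroup_axioms] by (auto simp: \<pi>_def)
  have \<pi>_oneD: "A \<in> N" if "A \<in> Hom 1 1" "\<pi> A = \<one>\<^bsub>M Mod N\<^esub>" for A
    using that M.coset_join1[OF _ _ N.subgroup_axioms, of A] by (simp add: \<pi>_def carrier_M)
  obtain E0 where E0: "E0 \<in> BT 1 2"
    "\<forall>q\<in>copies 1. \<forall>y\<in>carrier G. fst (E0 q) = 0 \<longrightarrow> fst (E0 (fst (ev a (q, y)))) = 1"
    using moves_brick[OF aH z] .
  \<comment> \<open>Conjugation by \<open>quot 2 E0 E\<close> carries the displaced half of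
    \<open>E0\<close> to that of \<open>E\<close>, so every half is displaced by some element of
    \<open>N\<close>.\<close>
  have displace: "\<exists>a'\<in>N. \<forall>z\<in>pts 1. fst (E (fst z)) = 0 \<longrightarrow> fst (E (fst (ev a' z))) = 1"
    if E: "E \<in> BT 1 2" for E
  proof -
    let ?b = "quot 2 E0 E"
    note b = quot_BT[OF E0(1) E]
    let ?c = "bt_inv 1 ?b 1"
    note c = bt_inv_closed[OF b]
    let ?a' = "Br 1 1 ?c \<bullet> a \<bullet> Br 1 1 ?b"
    have "inv\<^bsub>M\<^esub> (Br 1 1 ?b) = Br 1 1 ?c" by (rule inv_M[OF Br_inv(1)[OF b] Br_Hom[OF b] Br_Hom[OF c]])
    then have "?a' \<in> N"
      using N.inv_op_closed1[of "Br 1 1 ?b" a] a Br_Hom[OF b] by (simp add: carrier_M mult_M)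
    moreover have "fst (E (fst (ev ?a' z))) = 1" if zY: "z \<in> pts 1" "fst (E (fst z)) = 0" for z
    proof -
      obtain p x where z: "z = (p, x)" "p \<in> copies 1" "x \<in> carrier G" using zY(1) by auto
      note bp = brin_thompson_closed[OF b z(2)]
      obtain q y where q: "ev a (?b p, x) = (q, y)" by (cases "ev a (?b p, x)")
      have qc: "q \<in> copies 1" "y \<in> carrier G" using ev_closed[OF aH, of "(?b p, x)"] bp z(3) q by auto
      have "fst (E0 (?b p)) = 0" using quot_apply[OF E0(1) E z(2)] zY(2) z(1) by simp
      then have "fst (E0 q) = 1" using E0(2) bp z(3) q by (metis fst_conv)
      moreover have "ev ?a' z = (?c q, y)"
        using ev_comp[OF comp_Hom[OF Br_Hom[OF c] aH] Br_Hom[OF b], of z] ev_comp[OF Br_Hom[OF c] aH, of "(?b p, x)"]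
          ev_Br[OF b z(2,3)] ev_Br[OF c qc] z q bp by simp
      moreover have "E (?c q) = E0 q"
        using quot_apply[OF E0(1) E brin_thompson_closed[OF c qc(1)]] bt_inv_right[OF b qc(1)] by simp
      ultimately show ?thesis by simp
    qed
    ultimately show ?thesis by blast
  qed
  have commute: "\<pi> u \<otimes>\<^bsub>M Mod N\<^esub> \<pi> v = \<pi> v \<otimes>\<^bsub>M Mod N\<^esub> \<pi> u"
    if E: "E \<in> BT 1 2" and u: "supported E u" and v: "supported E v" for E u v
  proof -
    obtain b where b: "b \<in> N" "\<And>z. z \<in> pts 1 \<Longrightarrow> fst (E (fst z)) = 0 \<Longrightarrow> fst (E (fst (ev b z))) = 1"
      using displace[OF E] by blast
    have H: "b \<in> Hom 1 1" "u \<in> Hom 1 1" "v \<in> Hom 1 1"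
      using b(1) N.subset carrier_M u v by (auto simp: supported_def)
    obtain c where c: "c \<in> Hom 1 1" "c \<bullet> b = Id 1" "b \<bullet> c = Id 1" using Hom_inverse[OF H(1)] by blast
    have cN: "c \<in> N" using N.m_inv_closed[OF b(1)] inv_M[OF c(2) H(1) c(1)] by simp
    let ?w = "b \<bullet> (u \<bullet> c)"
    have w: "?w \<in> Hom 1 1" by (rule comp_Hom[OF H(1) comp_Hom[OF H(2) c(1)]])
    have "ev ?w z = z" if zY: "z \<in> pts 1" "fst (E (fst z)) = 0" for z
    proof -
      note cz = ev_closed[OF c(1) zY(1)]
      have bz: "ev b (ev c z) = z" by (rule ev_inverse[OF c(3,1) H(1) zY(1)])
      have "fst (E (fst (ev c z))) \<noteq> 0" using b(2)[OF cz] bz zY(2) by auto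
      then have "ev u (ev c z) = ev c z" using u cz by (cases "ev c z") (auto simp: supported_def)
      then show ?thesis
        using bz ev_comp[OF H(1) comp_Hom[OF H(2) c(1)] zY(1)] ev_comp[OF H(2) c(1) zY(1)] by simp
    qed
    then have "?w \<bullet> v = v \<bullet> ?w" by (rule supports_commute[OF w v])
    then have "\<pi> ?w \<otimes>\<^bsub>M Mod N\<^esub> \<pi> v = \<pi> v \<otimes>\<^bsub>M Mod N\<^esub> \<pi> ?w" using \<pi>_mult w H(3) by metis
    moreover have "\<pi> ?w = \<pi> u"
      using \<pi>_mult[OF H(1) comp_Hom[OF H(2) c(1)]] \<pi>_mult[OF H(2) c(1)] \<pi>_one[OF b(1)] \<pi>_one[OF cN]
        \<pi>_closed[OF H(2)] Q.l_one Q.r_one by metis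
    ultimately show ?thesis by simp
  qed
  obtain s where s: "s \<in> S" using S_nonempty by blast
  \<comment> \<open>The exchange \<open>?f\<close> of pieces \<open>i\<close> and \<open>j\<close>
    conjugates one squeezed element into the other. Both \<open>?f\<close> and
    \<open>inside E1 A\<close> are supported in the union of the two pieces, which is a half since a
    third piece is left over; so they commute modulo \<open>N\<close>.\<close>
  have swap: "\<pi> (inside E1 A) = \<pi> (inside E2 A)"
    if E: "E \<in> BT 1 n" and n: "3 \<le> n" "i < n" "j < n" "i \<noteq> j"
      and E1: "merges n E i E1" and E2: "merges n E j E2" and A: "A \<in> Hom 1 1" for n E i j E1 E2 A
  proof -
    note E1 = mergesD[OF E1] and E2 = mergesD[OF E2]
    obtain E3 where "merges2 n E i j s E3" using ex_merges2[OF E n s] by blast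
    note M3 = merges2D[OF this]
    have E3: "E3 \<in> BT 1 2" using M3(1)[of "(0, \<lambda>s\<in>S. undefined)"] cube_nonempty by simp
    let ?\<tau> = "Transposition.transpose i j"
    have \<tau>: "?\<tau> permutes {..<n}" using n by (intro permutes_swap_id) auto
    let ?f = "conj_perm n E ?\<tau>"
    note f = conj_perm_BT[OF E \<tau>]
    note w = Br_Hom[OF f] and I1 = inside_Hom[OF E1(1) A] and I2 = inside_Hom[OF E2(1) A]
    have fout: "?f p = p" if "p \<in> copies 1" "E p = (k, \<kappa>)" "k \<noteq> i" "k \<noteq> j" for p k \<kappa>
      using conj_perm_apply[OF E \<tau> that(1,2)] that
      by (intro bt_inj[OF E brin_thompson_closed[OF f that(1)] that(1)]) (simp add: transpose_def)
    have out3: "fst (E p) \<noteq> i \<and> fst (E p) \<noteq> j" if "p \<in> copies 1" "fst (E3 p) \<noteq> 0" for p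
      using M3(2,3)[OF that(1), of "snd (E p)"] that(2) n(4) by (metis fst_conv prod.collapse)
    have "supported E3 (Br 1 1 ?f)"
      unfolding supported_def
    proof (intro conjI w ballI impI)
      fix p x assume *: "p \<in> copies 1" "x \<in> carrier G" "fst (E3 p) \<noteq> 0"
      then show "ev (Br 1 1 ?f) (p, x) = (p, x)"
        using fout[OF *(1), of "fst (E p)" "snd (E p)"] out3[OF *(1,3)] ev_Br[OF f *(1,2)] by simp
    qed
    moreover have "supported E3 (inside E1 A)"
      unfolding supported_def
    proof (intro conjI I1 ballI impI)
      fix p x assume *: "p \<in> copies 1" "x \<in> carrier G" "fst (E3 p) \<noteq> 0"
      have "E1 p \<noteq> (0, \<kappa>)" for \<kappa> using E1(3)[OF *(1)] out3[OF *(1,3)] by (metis fst_conv)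
      then show "ev (inside E1 A) (p, x) = (p, x)"
        using BT2_cases[OF E1(1) *(1)] ev_inside_out[OF E1(1) A *(1,2)] by metis
    qed
    ultimately have com: "\<pi> (Br 1 1 ?f) \<otimes>\<^bsub>M Mod N\<^esub> \<pi> (inside E1 A) = \<pi> (inside E1 A) \<otimes>\<^bsub>M Mod N\<^esub> \<pi> (Br 1 1 ?f)"
      by (rule commute[OF E3])
    have "Br 1 1 ?f \<bullet> inside E1 A = inside E2 A \<bullet> Br 1 1 ?f"
    proof (rule ev_eqI[OF comp_Hom[OF w I1] comp_Hom[OF I2 w]])
      fix z :: "'s copies_point \<times> 'g" assume zp: "z \<in> pts 1"
      then obtain p x where z: "z = (p, x)" "p \<in> copies 1" "x \<in> carrier G" by auto
      note fp = brin_thompson_closed[OF f z(2)]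
      obtain k \<kappa> where k: "E p = (k, \<kappa>)" by (cases "E p")
      have "ev (Br 1 1 ?f) (ev (inside E1 A) (p, x)) = ev (inside E2 A) (?f p, x)"
      proof (cases "k = i")
        case True
        then have p1: "E1 p = (0, \<kappa>)" using E1(2)[OF z(2)] k by simp
        obtain \<kappa>' p' x' where *: "ev A ((0, \<kappa>), x) = ((0, \<kappa>'), x')" "E1 p' = (0, \<kappa>')" "p' \<in> copies 1"
          "x' \<in> carrier G" "ev (inside E1 A) (p, x) = (p', x')"
          using ev_inside_inE[OF E1(1) A z(2,3) p1] by metis
        note fp' = brin_thompson_closed[OF f *(3)]
        have "E (?f p) = (j, \<kappa>)" "E (?f p') = (j, \<kappa>')"
          using conj_perm_apply[OF E \<tau> z(2) k] conj_perm_apply[OF E \<tau> *(3) E1(3)[OF *(3,2)]] True by simp_all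
        then have "E2 (?f p) = (0, \<kappa>)" "E2 (?f p') = (0, \<kappa>')" using E2(2) fp fp' by simp_all
        then have "ev (inside E2 A) (?f p, x) = (?f p', x')"
          using ev_inside_in[OF E2(1) A fp z(3) _ _ fp', of \<kappa> x'] *(1) by simp
        then show ?thesis using *(5) ev_Br[OF f *(3,4)] by simp
      next
        case False
        have "E1 p \<noteq> (0, \<kappa>')" for \<kappa>' using E1(3)[OF z(2)] False k by (metis fst_conv)
        then have "ev (inside E1 A) (p, x) = (p, x)"
          using BT2_cases[OF E1(1) z(2)] ev_inside_out[OF E1(1) A z(2,3)] by metis
        moreover have "E2 (?f p) \<noteq> (0, \<kappa>')" for \<kappa>'
        proof
          assume "E2 (?f p) = (0, \<kappa>')"
          then have "?\<tau> k = j" using E2(3)[OF fp] conj_perm_apply[OF E \<tau> z(2) k] by simp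
          then show False using False by (metis transpose_apply_second transpose_involutory)
        qed
        then have "ev (inside E2 A) (?f p, x) = (?f p, x)"
          using BT2_cases[OF E2(1) fp] ev_inside_out[OF E2(1) A fp z(3)] by metis
        ultimately show ?thesis using ev_Br[OF f z(2,3)] by simp
      qed
      then show "ev (Br 1 1 ?f \<bullet> inside E1 A) z = ev (inside E2 A \<bullet> Br 1 1 ?f) z"
        using ev_comp[OF w I1 zp] ev_comp[OF I2 w zp] ev_Br[OF f z(2,3)] z(1) by simp
    qed
    then have "\<pi> (inside E1 A) \<otimes>\<^bsub>M Mod N\<^esub> \<pi> (Br 1 1 ?f) = \<pi> (inside E2 A) \<otimes>\<^bsub>M Mod N\<^esub> \<pi> (Br 1 1 ?f)"
      using \<pi>_mult[OF w I1] \<pi>_mult[OF I2 w] com by metis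
    then show ?thesis using Q.r_cancel \<pi>_closed w I1 I2 by metis
  qed
  define D where "D = simple_split S s"
  have D: "D \<in> BT 1 2" unfolding D_def by (rule bt_split[OF s])
  \<comment> \<open>The elements live in piece 0 of \<open>?E4\<close> and in piece 0 of
    \<open>?E3\<close>, which overlap. Both are therefore compared with a piece in the second half
    of \<open>D\<close>: piece 2 of \<open>?E4\<close>, which is also piece 1 of
    \<open>?E3\<close>.\<close>
  have squeeze: "\<pi> (inside D (inside E A)) = \<pi> (inside D A)" if E: "E \<in> BT 1 2" and A: "A \<in> Hom 1 1" for E A
  proof -
    let ?E4 = "compose (copies 1) (bt_sum S 1 2 1 E E) D" and ?E3 = "compose (copies 1) (bt_sum S 1 1 1 (bt_id S 1) E) D"
    have E4: "?E4 \<in> BT 1 4" using brin_thompson_compose[OF D bt_sum_halves[OF E E]] by simp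
    have E3: "?E3 \<in> BT 1 3"
      using brin_thompson_compose[OF D bt_sum_halves[OF bt_id_closed[of 1] E]] by (simp add: numeral_3_eq_3)
    have left: "?E4 p = E (0, \<kappa>)" "?E3 p = (0, \<kappa>)" if "p \<in> copies 1" "D p = (0, \<kappa>)" "\<kappa> \<in> cube" for p \<kappa>
      using that by (simp_all add: compose_def bt_sum_left)
    have right: "?E4 p = (2 + fst (E (0, \<kappa>)), snd (E (0, \<kappa>)))" "?E3 p = (1 + fst (E (0, \<kappa>)), snd (E (0, \<kappa>)))"
      if "p \<in> copies 1" "D p = (1, \<kappa>)" "\<kappa> \<in> cube" for p \<kappa>
      using that bt_sum_right[of 0 1 \<kappa> 1 2 E E] bt_sum_right[of 0 1 \<kappa> 1 1 "bt_id S 1" E]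
      by (simp_all add: compose_def)
    have small: "fst (E (0, \<kappa>)) < 2" if "\<kappa> \<in> cube" for \<kappa>
      using brin_thompson_closed[OF E, of "(0, \<kappa>)"] that by (cases "E (0, \<kappa>)") simp
    obtain E1 where E1: "merges 4 ?E4 0 E1" using ex_merges[OF E4 _ _ S_nonempty, of 0] by auto
    obtain E2 where E2: "merges 4 ?E4 2 E2" using ex_merges[OF E4 _ _ S_nonempty, of 2] by auto
    have "inside D (inside E A) = inside E1 A"
    proof (rule inside_inside[OF D E A mergesD(1)[OF E1]])
      fix p \<kappa> assume p: "p \<in> copies 1"
      from D p have "?E4 p = (0, \<kappa>) \<longleftrightarrow> (\<exists>\<kappa>'. D p = (0, \<kappa>') \<and> E (0, \<kappa>') = (0, \<kappa>))"
        by (cases rule: BT2_cases) (use left[OF p] right[OF p] in auto)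
      then show "E1 p = (0, \<kappa>) \<longleftrightarrow> (\<exists>\<kappa>'. D p = (0, \<kappa>') \<and> E (0, \<kappa>') = (0, \<kappa>))"
        using E1 p unfolding merges_def by blast
    qed
    moreover have "\<pi> (inside E1 A) = \<pi> (inside E2 A)"
      by (rule swap[OF E4 _ _ _ _ E1 E2 A]) simp_all
    moreover have "\<pi> (inside D A) = \<pi> (inside E2 A)"
    proof (rule swap[OF E3 _ _ _ _ _ _ A, of 0 1])
      have "?E3 p = (0, \<kappa>) \<longleftrightarrow> D p = (0, \<kappa>)" if p: "p \<in> copies 1" for p \<kappa>
        using D p by (cases rule: BT2_cases) (use left[OF p] right[OF p] in auto)
      then show "merges 3 ?E3 0 D" using D unfolding merges_def by blast
      have "?E3 p = (1, \<kappa>) \<longleftrightarrow> ?E4 p = (2, \<kappa>)" if p: "p \<in> copies 1" for p \<kappa>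
        using D p
      proof (cases rule: BT2_cases)
        case (1 \<kappa>')
        then show ?thesis using left[OF p 1] small[OF 1(2)] by (cases "E (0, \<kappa>')") auto
      next
        case (2 \<kappa>')
        then show ?thesis using right[OF p 2] by (cases "E (0, \<kappa>')") auto
      qed
      then show "merges 3 ?E3 1 E2" using E2 unfolding merges_def by blast
    qed simp_all
    ultimately show ?thesis by simp
  qed
  \<comment> \<open>First pass: by \<open>squeeze\<close>, the first alternative of
    \<open>\<Theta>_inside\<close> holds.\<close>
  interpret X: halving_invariant G S \<phi> "M Mod N" "\<lambda>A. \<pi> (inside D A)"
  proof unfold_locales
    fix A B assume A: "A \<in> Hom 1 1" and B: "B \<in> Hom 1 1"
    show "\<pi> (inside D A) \<in> carrier (M Mod N)" by (rule \<pi>_closed[OF inside_Hom[OF D A]])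
    show "\<pi> (inside D (A \<bullet> B)) = \<pi> (inside D A) \<otimes>\<^bsub>M Mod N\<^esub> \<pi> (inside D B)"
      unfolding inside_comp[OF D A B] by (rule \<pi>_mult[OF inside_Hom[OF D A] inside_Hom[OF D B]])
  qed (use squeeze in blast)
  \<comment> \<open>The first pass concerns the fixed half \<open>D\<close>; conjugation by the map
    matching the two cuts transfers it to every half \<open>E\<close>.\<close>
  have inN: "\<pi> (inside E A) = \<one>\<^bsub>M Mod N\<^esub>" if E: "E \<in> BT 1 2" and A: "A \<in> Hom 1 1" for E A
  proof -
    let ?b = "quot 2 D E"
    note b = quot_BT[OF D E]
    note w = Br_Hom[OF b] and I1 = inside_Hom[OF D A] and I2 = inside_Hom[OF E A]
    have "Br 1 1 ?b \<bullet> inside E A = inside D A \<bullet> Br 1 1 ?b"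
    proof (rule ev_eqI[OF comp_Hom[OF w I2] comp_Hom[OF I1 w]])
      fix z :: "'s copies_point \<times> 'g" assume zp: "z \<in> pts 1"
      then obtain p x where z: "z = (p, x)" "p \<in> copies 1" "x \<in> carrier G" by auto
      note bp = brin_thompson_closed[OF b z(2)]
      have Db: "D (?b q) = E q" if "q \<in> copies 1" for q by (rule quot_apply[OF D E that])
      from E z(2) have "ev (Br 1 1 ?b) (ev (inside E A) (p, x)) = ev (inside D A) (?b p, x)"
      proof (cases rule: BT2_cases)
        case (1 \<kappa>)
        obtain \<kappa>' p' x' where *: "ev A ((0, \<kappa>), x) = ((0, \<kappa>'), x')" "E p' = (0, \<kappa>')" "p' \<in> copies 1"
          "x' \<in> carrier G" "ev (inside E A) (p, x) = (p', x')"
          using ev_inside_inE[OF E A z(2,3) 1(1)] by metis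
        have "ev (inside D A) (?b p, x) = (?b p', x')"
          using ev_inside_in[OF D A bp z(3) _ _ brin_thompson_closed[OF b *(3)], of \<kappa> x'] Db[OF z(2)] Db[OF *(3)] 1(1) *(1,2)
          by simp
        then show ?thesis using *(5) ev_Br[OF b *(3,4)] by simp
      next
        case (2 \<kappa>)
        then show ?thesis
          using ev_inside_out[OF E A z(2,3) 2(1)] ev_inside_out[OF D A bp z(3)] Db[OF z(2)] ev_Br[OF b z(2,3)] by simp
      qed
      then show "ev (Br 1 1 ?b \<bullet> inside E A) z = ev (inside D A \<bullet> Br 1 1 ?b) z"
        using ev_comp[OF w I2 zp] ev_comp[OF I1 w zp] ev_Br[OF b z(2,3)] z(1) by simp
    qed
    then have "\<pi> (Br 1 1 ?b) \<otimes>\<^bsub>M Mod N\<^esub> \<pi> (inside E A) = \<pi> (Br 1 1 ?b)"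
      using \<pi>_mult[OF w I2] \<pi>_mult[OF I1 w] X.\<Theta>_trivial[OF A] Q.l_one[OF \<pi>_closed[OF w]] by metis
    then show ?thesis using Q.l_cancel_one[OF \<pi>_closed[OF w] \<pi>_closed[OF I2]] by blast
  qed
  \<comment> \<open>Second pass: squeezed elements are now trivial, which is the second alternative
    for \<open>\<pi>\<close> itself.\<close>
  interpret Y: halving_invariant G S \<phi> "M Mod N" \<pi>
    by unfold_locales (use \<pi>_closed \<pi>_mult inN in \<open>auto\<close>)
  show ?thesis
    using N.subset \<pi>_oneD Y.\<Theta>_trivial unfolding carrier_M by blast
qed

section \<open>The kernel of the action and the faithful quotient\<close>

abbreviation "K \<equiv> action_kernel G S \<phi>"

lemma K_normal: "K \<lhd> G"
  unfolding action_kernel_def by (rule group_hom.normal_kernel[OF group_hom])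

lemma K_iff: "g \<in> K \<longleftrightarrow> g \<in> carrier G \<and> (\<forall>s\<in>S. \<phi> g s = s)"
proof -
  have "\<phi> g = (\<lambda>s\<in>S. s) \<longleftrightarrow> (\<forall>s\<in>S. \<phi> g s = s)" if "g \<in> carrier G"
    using bij_prop0[OF that] by (auto simp: Bij_def fun_eq_iff extensional_def restrict_def)
  then show ?thesis by (auto simp: action_kernel_def kernel_def BijGroup_def)
qed

abbreviation "G' \<equiv> G Mod K"
abbreviation "\<phi>' \<equiv> induced_action \<phi>"

lemma induced_action_coset:
  assumes g: "g \<in> carrier G"
  shows "\<phi>' (K #> g) = \<phi> g"
proof -
  have "\<phi> (h \<otimes> g) = \<phi> g" if h: "h \<in> K" for h
  proof
    fix s
    have hc: "h \<in> carrier G" using h K_iff by blast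
    show "\<phi> (h \<otimes> g) s = \<phi> g s"
    proof (cases "s \<in> S")
      case True
      then show ?thesis using h g hc K_iff composition_rule by simp
    next
      case False
      then show ?thesis
        using bij_prop0[of "h \<otimes> g"] bij_prop0[OF g] g hc by (auto simp: Bij_def extensional_def)
    qed
  qed
  then have "\<phi> ` (K #> g) = (\<lambda>_. \<phi> g) ` (K #> g)" by (intro image_cong) (auto simp: r_coset_def)
  moreover have "K #> g \<noteq> {}"
    using normal_imp_subgroup[OF K_normal] subgroup.one_closed by (fastforce simp: r_coset_def)
  ultimately have "\<phi> ` (K #> g) = {\<phi> g}" by (simp add: image_constant_conv)
  then show ?thesis by (simp add: induced_action_def)
qed

lemma coset_mult: "g \<in> carrier G \<Longrightarrow> h \<in> carrier G \<Longrightarrow> (K #> g) \<otimes>\<^bsub>G'\<^esub> (K #> h) = K #> (g \<otimes> h)"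
  using normal.rcos_sum[OF K_normal] by simp

text \<open>Makes everything shown for \<open>G\<close>, in particular evaluation and completeness,
  available for the quotient by \<open>K\<close>.\<close>

lemma twisted_faithful: "twisted G' S \<phi>'"
proof -
  have "group G'" by (rule normal.factorgroup_is_group[OF K_normal])
  moreover have "\<phi>' \<in> hom G' (BijGroup S)"
    unfolding hom_def carrier_FactGroup
  proof (safe; clarsimp simp: induced_action_coset)
    fix g assume g: "g \<in> carrier G"
    show "\<phi> g \<in> carrier (BijGroup S)" using bij_prop0[OF g] by (simp add: BijGroup_def)
  next
    fix g h assume g: "g \<in> carrier G" "h \<in> carrier G"
    show "\<phi>' (K #> g <#> (K #> h)) = \<phi> g \<otimes>\<^bsub>BijGroup S\<^esub> \<phi> h"
      using coset_mult[OF g] induced_action_coset[of "g \<otimes> h"] g group_hom.hom_mult[OF group_hom g] by simp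
  qed
  ultimately have "group_hom G' (BijGroup S) \<phi>'"
    using group_BijGroup by (simp add: group_hom_def group_hom_axioms_def)
  then show ?thesis
    by (simp add: twisted_def twisted_axioms_def group_action_def S_nonempty)
qed

end

locale twisted_quotient = twisted G S \<phi> + faithful: twisted "G Mod action_kernel G S \<phi>" S "induced_action \<phi>"
  for G :: "('g, 'm) monoid_scheme" (structure) and S :: "'s set" and \<phi> :: "'g \<Rightarrow> 's \<Rightarrow> 's"
begin

abbreviation coset_term :: "('g, 's) sv_term \<Rightarrow> ('g set, 's) sv_term" where
  "coset_term \<equiv> map_sv_term (\<lambda>g. K #> g)"

lemma coset_in: "g \<in> carrier G \<Longrightarrow> K #> g \<in> carrier G'"
  by (simp add: carrier_FactGroup)

lemma coset_term_mor: "mor t m n \<Longrightarrow> faithful.mor (coset_term t) m n"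
proof (induction rule: sv_morphism.induct)
  case (label gs)
  then show ?case using faithful.mor_label[of "map (\<lambda>g. K #> g) gs" "length gs"] coset_in
    by (auto simp: Suc_le_eq)
qed (auto intro: sv_morphism.intros)

text \<open>Each rule becomes the same rule over the quotient; the only one involving the action is
  \<open>split\<close>, where a coset acts as its representative. Hence the natural map is well
  defined on classes.\<close>

lemma coset_term_equ: "t \<approx> u \<Longrightarrow> sv_eq G' S \<phi>' (coset_term t) (coset_term u)"
proof (induction rule: sv_eq.induct)
  case (refl t m n)
  then show ?case by (rule sv_eq.refl[OF coset_term_mor])
next
  case (sym t u)
  then show ?case by (blast intro: sv_eq.sym)
next
  case (trans t u v)
  then show ?case by (blast intro: sv_eq.trans)
next
  case (comp_cong t n p u m t' u')
  then show ?case using sv_eq.comp_cong[OF coset_term_mor coset_term_mor] by simp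
next
  case (sum_cong t t' u u')
  then show ?case using sv_eq.sum_cong by simp
next
  case (comp_assoc t p q u n v m)
  then show ?case using sv_eq.comp_assoc[OF coset_term_mor coset_term_mor coset_term_mor] by simp
next
  case (id_left t m n)
  then show ?case using sv_eq.id_left[OF coset_term_mor] by simp
next
  case (id_right t m n)
  then show ?case using sv_eq.id_right[OF coset_term_mor] by simp
next
  case (interchange t n p u m t' n' p' u' m')
  then show ?case
    using sv_eq.interchange[OF coset_term_mor coset_term_mor coset_term_mor coset_term_mor] by simp
next
  case (brick_comp f m n f' p)
  then show ?case using sv_eq.brick_comp[OF brick_comp, of G' \<phi>'] by simp
next
  case (brick_sum f m n f' m' n')
  then show ?case using sv_eq.brick_sum[OF brick_sum, of G' \<phi>'] by simp
next
  case (label_one n)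
  have "K #> \<one> = \<one>\<^bsub>G'\<^esub>" using coset_join2[OF one_closed] normal_imp_subgroup[OF K_normal] subgroup.one_closed by auto
  then show ?case using sv_eq.label_one[OF label_one, of G' S \<phi>'] by simp
next
  case (label_comp gs hs)
  have "map (\<lambda>g. K #> g) (map2 (\<otimes>) gs hs) =
      map2 (\<lambda>g h. g \<otimes>\<^bsub>G'\<^esub> h) (map (\<lambda>g. K #> g) gs) (map (\<lambda>g. K #> g) hs)"
  proof (rule nth_equalityI)
    fix i assume i: "i < length (map (\<lambda>g. K #> g) (map2 (\<otimes>) gs hs))"
    then have "gs ! i \<in> carrier G" "hs ! i \<in> carrier G"
      using label_comp nth_mem[of i gs] nth_mem[of i hs] by auto
    then show "map (\<lambda>g. K #> g) (map2 (\<otimes>) gs hs) ! i =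
        map2 (\<lambda>g h. g \<otimes>\<^bsub>G'\<^esub> h) (map (\<lambda>g. K #> g) gs) (map (\<lambda>g. K #> g) hs) ! i"
      using i coset_mult by simp
  qed simp
  moreover have "set (map (\<lambda>g. K #> g) gs) \<subseteq> carrier G'" "set (map (\<lambda>g. K #> g) hs) \<subseteq> carrier G'"
    using label_comp coset_in by auto
  ultimately show ?case
    using sv_eq.label_comp[of "map (\<lambda>g. K #> g) gs" "map (\<lambda>g. K #> g) hs" G' S \<phi>'] label_comp by simp
next
  case (label_sum gs hs)
  moreover have "set (map (\<lambda>g. K #> g) gs) \<subseteq> carrier G'" "set (map (\<lambda>g. K #> g) hs) \<subseteq> carrier G'"
    using label_sum coset_in by auto
  ultimately show ?case
    using sv_eq.label_sum[of "map (\<lambda>g. K #> g) gs" "map (\<lambda>g. K #> g) hs" G' S \<phi>'] by simp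
next
  case (split g s)
  then show ?case
    using sv_eq.split[OF coset_in[OF split(1)] split(2), of \<phi>'] induced_action_coset[OF split(1)] by simp
next
  case (perm gs \<sigma>)
  have "set (map (\<lambda>g. K #> g) gs) \<subseteq> carrier G'" using perm coset_in by auto
  moreover have "map (\<lambda>i. map (\<lambda>g. K #> g) gs ! \<sigma> i) [0..<length gs] = map ((\<lambda>g. K #> g) \<circ> (\<lambda>i. gs ! \<sigma> i)) [0..<length gs]"
    using permutes_in_image[OF perm(3)] by simp
  ultimately show ?case
    using sv_eq.perm[of "map (\<lambda>g. K #> g) gs" G' \<sigma> S \<phi>'] perm by (simp del: map_eq_conv)
qed

lemma natural_map_cls:
  assumes "mor t m n"
  shows "natural_map G S \<phi> (cls t) = faithful.cls (coset_term t)"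
proof -
  have "faithful.cls (coset_term u) = faithful.cls (coset_term t)" if "u \<in> cls t" for u
    using faithful.cls_eqI[OF coset_term_equ] that by (simp add: sv_class_def)
  then show ?thesis unfolding natural_map_def using in_cls[OF assms] by blast
qed

lemma natural_map_hom: "natural_map G S \<phi> \<in> hom M faithful.M"
proof (rule homI)
  fix A assume "A \<in> carrier M"
  then obtain t where "A = cls t" "mor t 1 1" unfolding carrier_M by (elim HomE)
  then show "natural_map G S \<phi> A \<in> carrier faithful.M"
    using natural_map_cls faithful.cls_Hom[OF coset_term_mor] faithful.carrier_M by simp
next
  fix A B assume "A \<in> carrier M" "B \<in> carrier M"
  then obtain t u where *: "A = cls t" "mor t 1 1" "B = cls u" "mor u 1 1" unfolding carrier_M by (elim HomE)
  have "natural_map G S \<phi> (cls (Comp t u)) = faithful.cls (coset_term (Comp t u))"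
    by (rule natural_map_cls[OF sv_morphism.comp[OF *(2,4)]])
  also have "\<dots> = faithful.comp_cls (faithful.cls (coset_term t)) (faithful.cls (coset_term u))"
    using faithful.cls_comp[OF coset_term_mor[OF *(2)] coset_term_mor[OF *(4)]] by simp
  finally show "natural_map G S \<phi> (A \<otimes>\<^bsub>M\<^esub> B) = natural_map G S \<phi> A \<otimes>\<^bsub>faithful.M\<^esub> natural_map G S \<phi> B"
    using * natural_map_cls cls_comp[OF *(2,4)] by (simp add: mult_M faithful.mult_M)
qed

abbreviation "SK \<equiv> twisted_BT_kernel G S \<phi>"

lemma SK_iff: "A \<in> SK \<longleftrightarrow> A \<in> Hom 1 1 \<and> natural_map G S \<phi> A = faithful.Id 1"
  unfolding twisted_BT_kernel_def kernel_def by (simp add: carrier_M faithful.one_M)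

lemma SK_normal: "SK \<lhd> M"
  unfolding twisted_BT_kernel_def
  by (rule group_hom.normal_kernel)
     (simp add: group_hom_def group_hom_axioms_def natural_map_hom group_M faithful.group_M)

lemma natural_map_Br: "f \<in> BT m n \<Longrightarrow> natural_map G S \<phi> (Br m n f) = faithful.Br m n f"
  unfolding Br_def faithful.Br_def using natural_map_cls[OF sv_morphism.brick[of f S m n G]] by simp

text \<open>The natural map leaves brick generators unchanged, and over the quotient a flip still
  moves a point of the cube.\<close>

lemma SK_proper: "SK \<noteq> carrier M"
proof
  assume eq: "SK = carrier M"
  obtain s where s: "s \<in> S" using S_nonempty by blast
  note f = flip_BT[OF s]
  have "Br 1 1 (flip s) \<in> SK" unfolding eq carrier_M by (rule Br_Hom[OF f])
  then have Id: "faithful.Br 1 1 (flip s) = faithful.Id 1" using natural_map_Br[OF f] SK_iff by simp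
  define \<kappa> where "\<kappa> = (\<lambda>t\<in>S. \<lambda>n::nat. False)"
  have \<kappa>: "\<kappa> \<in> cube" unfolding \<kappa>_def by (rule cube_nonempty)
  have p: "(0, scons s False \<kappa>) \<in> copies 1" using scons_cube[OF s \<kappa>] by simp
  have "faithful.ev (faithful.Br 1 1 (flip s)) ((0, scons s False \<kappa>), \<one>\<^bsub>G'\<^esub>) = ((0, scons s True \<kappa>), \<one>\<^bsub>G'\<^esub>)"
    using faithful.ev_Br[OF f p faithful.one_closed] flip_scons[OF s \<kappa>, of False] by simp
  moreover have "faithful.ev (faithful.Id 1) ((0, scons s False \<kappa>), \<one>\<^bsub>G'\<^esub>) = ((0, scons s False \<kappa>), \<one>\<^bsub>G'\<^esub>)"
    using p faithful.one_closed by (intro faithful.ev_Id) auto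
  ultimately have "scons s True \<kappa> = scons s False \<kappa>" unfolding Id by simp
  then show False using scons_inject by blast
qed

text \<open>
  An element acting trivially on the cube has all its labels in \<open>K\<close>: bricks preserve, in each
  coordinate, whether a word is eventually constant, so a label moving a coordinate is detected on
  a point whose coordinates have different constant tails.
\<close>

lemma fixing_in_SK:
  assumes A: "A \<in> Hom 1 1" and fixed: "\<And>p x. p \<in> copies 1 \<Longrightarrow> x \<in> carrier G \<Longrightarrow> fst (ev A (p, x)) = p"
  shows "A \<in> SK"
proof -
  obtain r F gs E where nf: "F \<in> BT r 1" "gs \<in> labels r" "E \<in> BT 1 r" "A = Br r 1 F \<bullet> (Lb gs \<bullet> Br 1 r E)"
    using normal_form[OF A] by metis
  have r: "1 \<le> r" using brin_thompsonD[OF nf(1)] by simp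
  have FE: "F (k, act (gs ! k) \<kappa>) = p" if "p \<in> copies 1" "E p = (k, \<kappa>)" for p k \<kappa>
    using fixed[OF that(1) one_closed] ev_nf[OF nf(1-3) that(1) one_closed that(2)] nf(4) by simp
  have gsK: "gs ! k \<in> K" if k: "k < r" for k
  proof -
    note g = labels_nth[OF nf(2) k]
    have "\<phi> (inv (gs ! k)) s = s" if s: "s \<in> S" for s
    proof (rule ccontr)
      let ?t = "\<phi> (inv (gs ! k)) s"
      assume ts: "?t \<noteq> s"
      \<comment> \<open>Constant 1 at \<open>?t\<close> and constant 0 elsewhere. Coming back
        through \<open>E\<close>, the point \<open>p\<close> has tail 0 at \<open>s\<close>; but it
        is also the image under \<open>F\<close> after the label has carried coordinate
        \<open>?t\<close> to \<open>s\<close>, which gives it tail 1 there.\<close>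
      define \<kappa> where "\<kappa> = (\<lambda>u\<in>S. \<lambda>n::nat. u = ?t)"
      have \<kappa>: "\<kappa> \<in> cube" by (simp add: \<kappa>_def cantor_cube_def)
      have t: "?t \<in> S" using g s by simp
      define p where "p = bt_inv 1 E r (k, \<kappa>)"
      have p: "p \<in> copies 1" "E p = (k, \<kappa>)"
        using brin_thompson_closed[OF bt_inv_closed[OF nf(3)]] bt_inv_right[OF nf(3)] k \<kappa> by (auto simp: p_def)
      obtain \<kappa>p where \<kappa>p: "p = (0, \<kappa>p)" "\<kappa>p \<in> cube" using copies1_cases[OF p(1)] .
      have "\<exists>l. \<forall>x\<ge>l. \<kappa>p s x = False"
        by (rule brin_thompson_tail[OF bt_inv_closed[OF nf(3)] k \<kappa> s, of 0 _ 0])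
           (use \<kappa>p(1) ts s in \<open>simp_all add: p_def \<kappa>_def\<close>)
      moreover have "\<exists>l. \<forall>x\<ge>l. \<kappa>p s x = True"
        by (rule brin_thompson_tail[OF nf(1) k act_cube s, of "gs ! k" \<kappa> 0 _ 0])
           (use FE[OF p] \<kappa>p(1) s t in \<open>simp_all add: act_def \<kappa>_def\<close>)
      ultimately obtain l l' where "\<forall>x\<ge>l. \<kappa>p s x = False" "\<forall>x\<ge>l'. \<kappa>p s x = True" by blast
      then show False by (metis max.cobounded1 max.cobounded2)
    qed
    then have "\<phi> (gs ! k) s = s" if "s \<in> S" for s using phi_inv(2)[OF g that] that by metis
    then show ?thesis using g K_iff by blast
  qed
  have m: "mor (Brick r 1 F) r 1" "mor (Label gs) r r" "mor (Brick 1 r E) 1 r"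
    using nf(1-3) r mor_label[of gs r] by (auto intro: sv_morphism.brick simp: labels_def)
  have "map (\<lambda>g. K #> g) gs = replicate r \<one>\<^bsub>G'\<^esub>"
    using labels_length[OF nf(2)] gsK coset_join2[OF labels_nth[OF nf(2)] normal_imp_subgroup[OF K_normal]]
    by (auto intro!: nth_equalityI)
  then have "natural_map G S \<phi> A = faithful.cls (Comp (Brick r 1 F) (Comp (Label (replicate r \<one>\<^bsub>G'\<^esub>)) (Brick 1 r E)))"
    using natural_map_cls[OF sv_morphism.comp[OF m(1) sv_morphism.comp[OF m(2,3)]]] nf(4)
      cls_comp[OF m(1) sv_morphism.comp[OF m(2,3)]] cls_comp[OF m(2,3)] by (simp add: Br_def Lb_def)
  also have "\<dots> = faithful.comp_cls (faithful.Br r 1 F) (faithful.comp_cls (faithful.Lb (replicate r \<one>\<^bsub>G'\<^esub>)) (faithful.Br 1 r E))"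
  proof -
    have m': "faithful.mor (Brick r 1 F) r 1" "faithful.mor (Label (replicate r \<one>\<^bsub>G'\<^esub>)) r r" "faithful.mor (Brick 1 r E) 1 r"
      using nf(1,3) r faithful.mor_label[of "replicate r \<one>\<^bsub>G'\<^esub>" r] faithful.one_closed
      by (auto intro: sv_morphism.brick)
    show ?thesis
      unfolding faithful.Br_def faithful.Lb_def faithful.cls_comp[OF m'(2,3)]
        faithful.cls_comp[OF m'(1) sv_morphism.comp[OF m'(2,3)]] ..
  qed
  also have "\<dots> = faithful.Br 1 1 (compose (copies 1) F E)"
    unfolding faithful.Lb_one[OF r] faithful.Id_left[OF faithful.Br_Hom[OF nf(3)]]
    by (rule faithful.Br_comp[OF nf(3,1)])
  also have "compose (copies 1) F E = bt_id S 1"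
  proof (rule bt_ext[OF brin_thompson_compose[OF nf(3,1)] bt_id_closed])
    fix p :: "'s copies_point" assume p: "p \<in> copies 1"
    obtain k \<kappa> where k: "E p = (k, \<kappa>)" by (cases "E p")
    have kr: "k < r" "\<kappa> \<in> cube" using brin_thompson_closed[OF nf(3) p] k by simp_all
    have "\<phi> (inv (gs ! k)) s = s" if "s \<in> S" for s
      using gsK[OF kr(1)] phi_inv(1)[OF labels_nth[OF nf(2) kr(1)] that] that K_iff by metis
    then have "act (gs ! k) \<kappa> = \<kappa>" by (intro cube_ext[OF act_cube kr(2)]) (simp add: act_def)
    then show "compose (copies 1) F E p = bt_id S 1 p" using FE[OF p k] k p by (simp add: compose_def)
  qed simp
  finally show ?thesis using A SK_iff by (simp add: faithful.Id_def)
qed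

text \<open>By \<open>fixing_in_SK\<close> an element outside \<open>SK\<close> moves a point of the
  cube, and then \<open>normal_closure_full\<close> would make \<open>N\<close> the whole
  group.\<close>

lemma proper_normal_in_SK:
  assumes N: "N \<lhd> M" "N \<noteq> carrier M"
  shows "N \<subseteq> SK"
proof
  fix A assume A: "A \<in> N"
  then have "A \<in> Hom 1 1" using subgroup.subset[OF normal_imp_subgroup[OF N(1)]] carrier_M by blast
  then show "A \<in> SK" using fixing_in_SK normal_closure_full[OF N(1) A] N(2) by metis
qed

end

theorem theoremA:
  fixes G :: "('g, 'm) monoid_scheme"
    and S :: "'s set"
    and \<phi> :: "'g \<Rightarrow> 's \<Rightarrow> 's"
  assumes "group_action G S \<phi>"
    and "S \<noteq> {}"
  shows "relatively_simple (twisted_BT G S \<phi>) \<and>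
         twisted_BT_kernel G S \<phi> \<lhd> twisted_BT G S \<phi> \<and>
         twisted_BT_kernel G S \<phi> \<noteq> carrier (twisted_BT G S \<phi>) \<and>
         (\<forall>N. N \<lhd> twisted_BT G S \<phi> \<longrightarrow> N \<noteq> carrier (twisted_BT G S \<phi>) \<longrightarrow>
              N \<subseteq> twisted_BT_kernel G S \<phi>)"
proof -
  have "twisted G S \<phi>" using assms by (simp add: twisted_def twisted_axioms_def)
  then interpret twisted_quotient G S \<phi>
    by (intro twisted_quotient.intro twisted.twisted_faithful)
  show ?thesis
    unfolding relatively_simple_def
    using group_M SK_normal SK_proper proper_normal_in_SK by blast
qed

end
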